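(* In the canonical setting described in the context (with the probability space $(\Omega,\Sigma,P)$, the random variable $\Theta$, the processes $W,X,N,S$, the filtration $\{\mathcal F_t\}_{t\ge 0}$ and the family $\{P_\theta\}_{\theta\in\Upsilon}$), the following hold. For $\beta\in\mathcal F_P$, $\beta(x,\theta)=\alpha(\theta)+\gamma(x)$, $\xi\in\mathcal R_+(\Upsilon)$, $g\in\mathfrak M_+(\Upsilon)$ and a probability measure $Q$ on $\Sigma$ consider the conditions $( ** )$: $g(\Theta)=\Theta e^{\alpha(\Theta)}$ and $\gamma=\ln f$, where $f$ is a $P_{X_1}$-a.s. positive Radon–Nikodým derivative of $Q_{X_1}$ with respect to $P_{X_1}$; $(M_\xi)$: $Q(A)=\int_A M_t^{(\beta)}(\Theta)\,dP$ for all $0\le s\le t$ and all $A\in\mathcal F_s$, where $M_t^{(\beta)}(\Theta):=\xi(\Theta)\,e^{S_t^{(\beta)}(\Theta)-t\Theta(e^{\alpha(\Theta)}-1)}$ and $S_t^{(\beta)}(\theta):=\sum_{k=1}^{N_t}\beta(X_k,\theta)$. (i) For each pair $(g,Q)$ with $g\in\mathfrak M_+(\Upsilon)$ and $Q\in\mathcal M_{S,g}$ there exists an essentially unique pair $(\beta,\xi)\in\mathcal F_P\times\mathcal R_+(\Upsilon)$, with $\xi$ a Radon–Nikodým derivative of $Q_\Theta$ with respect to $P_\Theta$, satisfying $( ** )$ and $(M_\xi)$ and such that $\{M_t^{(\beta)}(\Theta)\}_{t\ge0}$ is a martingale in $\mathcal L^1(P)$. (ii) Conversely, for every pair $(\beta,\xi)\in\mathcal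 F_P\times\mathcal R_+(\Upsilon)$ there exists a unique pair $(g,Q)$ with $g\in\mathfrak M_+(\Upsilon)$ and $Q\in\mathcal M_{S,g}$ satisfying $( ** )$ and $(M_\xi)$ and such that $\{M_t^{(\beta)}(\Theta)\}_{t\ge0}$ is a martingale in $\mathcal L^1(P)$. (iii) In both cases (i) and (ii) there exist an essentially unique regular conditional probability $\{Q_\theta\}_{\theta\in\Upsilon}$ of $Q$ over $Q_\Theta$ consistent with $\Theta$, and a $P_\Theta$-null set $V_*\in\mathfrak B(\Upsilon)$, such that for every $\theta\notin V_*$: $Q_\theta\in\widetilde{\mathcal M}_{S,g}(\theta)$; $$(M_\theta)\qquad Q_\theta(A)=\int_A \widetilde M_t^{(\beta)}(\theta)\,dP_\theta\quad\text{for all }0\le s\le t,\ A\in\mathcal F_s,$$ where $\widetilde M_t^{(\beta)}(\theta):=e^{S_t^{(\beta)}(\theta)-t\theta(e^{\alpha(\theta)}-1)}$; and $\{\widetilde M_t^{(\beta)}(\theta)\}_{t\ge0}$ is a martingale in $\mathcal L^1(P_\theta)$.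
   Context: **Canonical setting.** $\Upsilon:=(0,\infty)$, $\mathfrak B(\cdot)$ denotes Borel $\sigma$-algebras. $\Omega:=\Upsilon^{\mathbb N}\times\Upsilon^{\mathbb N}\times\Upsilon$, $\Sigma:=\mathfrak B(\Omega)$. $W_n$ and $X_n$ ($n\ge1$) are the $n$-th coordinates of the first and of the second factor, $\Theta$ is the projection onto the third factor. $T_0:=0$, $T_n:=\sum_{k=1}^nW_k$, $N_t:=\#\{n\ge1:T_n\le t\}$, $S_t:=\sum_{k=1}^{N_t}X_k$ for $t\ge0$ (the explosion event $\{\sup_nT_n<\infty\}$, which is null for all measures considered, is disregarded, i.e. treated as empty). $W=\{W_n\}$, $X=\{X_n\}$, $N=\{N_t\}$, $S=\{S_t\}$. Fix probability measures $\mu,\rho$ on $\mathfrak B(\Upsilon)$. Put $P_\theta:=\mathbf{Exp}(\theta)^{\otimes\mathbb N}\otimes\mu^{\otimes\mathbb N}\otimes\delta_\theta$ ($\mathbf{Exp}(\theta)$ is the exponential law with rate $\theta$) and $P(E):=\int P_\theta(E)\,\rho(d\theta)$, $E\in\Sigma$; so $P_{X_1}=\mu$, $P_\Theta=\rho$. For a measure $R$ and a random variable $Z$, $R_Z$ is the law of $Z$ under $R$. $\mathcal F_t:=\sigma(\{S_u:u\le t\}\cup\{\Theta\})$. **Martingales.** A martingale in $\mathcal L^\ell(R)$ is a process adapted to $\{\mathcal F_t\}_{t\ge0}$, with all members in $\mathcal L^\ell(R)$, having the martingale property under $R$ with respect to $\{\mathcal F_t\}$. **Regular conditional probabilities.**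 A r.c.p. of $Q$ over $Q_\Theta$ is a family $\{Q_\theta\}_{\theta\in\Upsilon}$ of probability measures on $\Sigma$ such that $\theta\mapsto Q_\theta(D)$ is $\mathfrak B(\Upsilon)$-measurable and $\int Q_\theta(D)\,Q_\Theta(d\theta)=Q(D)$ for every $D\in\Sigma$. It is consistent with $\Theta$ if for each $B\in\mathfrak B(\Upsilon)$ one has $Q_\theta(\Theta^{-1}(B))=1$ for $Q_\Theta$-a.a. $\theta\in B$. It is essentially unique if any two such families coincide (as measures on $\Sigma$) for all $\theta$ outside a null set of $\mathfrak B(\Upsilon)$. **Compound (mixed) Poisson processes.** Let $R$ be a probability measure on $\Sigma$. $(N,X)$ is an $R$-risk process if $N$ is a counting process, $X$ is $R$-i.i.d., and $N$ and $X$ are $R$-independent. For a positive Borel function $g$ on $\Upsilon$, $N$ is an $R$-mixed Poisson process with parameter $g(\Theta)$ if, conditionally given $\Theta$, it has stationary independent increments under $R$ and the conditional law of $N_t$ given $\Theta$ is Poisson with mean $tg(\Theta)$, for every $t>0$. $S$ is an $R$-CMPP$(g(\Theta),R_{X_1})$ if $(N,X)$ is an $R$-risk process and $N$ is an $R$-mixed Poisson process with parameter $g(\Theta)$. $S$ is an $R$-CPP$(\lambda,R_{X_1})$, $\lambda>0$, if $(N,X)$ is an $R$-risk process and $N$ is an $R$-Poisson process with rate $\lambda$. **Conditions (a1), (a2) for $R$.** (a1): $W$ and $X$ are $R$-conditionally independent given $\Theta$. (a2): $\Theta$ and $X$ are $R$-independent. **Classes.** Measures $Q,P$ are progressively equivalent,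 $Q\stackrel{pr}{\sim}P$, if they are equivalent (mutually absolutely continuous) on each $\mathcal F_t$, $t\ge0$. $\mathfrak M_+(\Upsilon)$: all positive $\mathfrak B(\Upsilon)$-measurable functions on $\Upsilon$. $\mathcal M_{S,g}$: all probability measures $Q$ on $\Sigma$ satisfying (a1), (a2), $Q\stackrel{pr}{\sim}P$, and such that $S$ is a $Q$-CMPP$(g(\Theta),Q_{X_1})$. $\widetilde{\mathcal M}_{S,g}(\theta)$: all probability measures $Q_\theta$ on $\Sigma$ with $Q_\theta\stackrel{pr}{\sim}P_\theta$ and such that $S$ is a $Q_\theta$-CPP$(g(\theta),(Q_\theta)_{X_1})$. $\mathcal F_P$: all functions $\beta:\Upsilon\times\Upsilon\to\mathbb R$ of the form $\beta(x,\theta)=\alpha(\theta)+\gamma(x)$ with $\alpha,\gamma:\Upsilon\to\mathbb R$ Borel measurable and $\mathbb E_P[e^{\gamma(X_1)}]=1$. $\mathcal R_+(\Upsilon)$: all Borel measurable $\xi:\Upsilon\to\mathbb R$ with $P_\Theta(\{\xi>0\})=1$ and $\mathbb E_P[\xi(\Theta)]=1$. Essential uniqueness of $(\beta,\xi)$ means uniqueness up to changing $\alpha,\xi$ on $P_\Theta$-null sets and $\gamma$ on $P_{X_1}$-null sets. *)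

theory Defs
  imports "HOL-Probability.Probability"
begin

definition Upsilon :: "real measure" where
  "Upsilon = restrict_space borel {0<..}"

type_synonym outcome = "(nat \<Rightarrow> real) \<times> (nat \<Rightarrow> real) \<times> real"

text \<open>Sequences are indexed by \<open>n \<ge> 1\<close>. As \<open>\<Upsilon>\<close> is second countable, the product
  \<open>\<sigma>\<close>-algebra is the Borel \<open>\<sigma>\<close>-algebra of the product space.\<close>

definition SeqU :: "(nat \<Rightarrow> real) measure" where
  "SeqU = (\<Pi>\<^sub>M n\<in>{1..}. Upsilon)"

definition Omega :: "outcome measure" where
  "Omega = SeqU \<Otimes>\<^sub>M (SeqU \<Otimes>\<^sub>M Upsilon)"

definition seqW :: "outcome \<Rightarrow> nat \<Rightarrow> real" where
  "seqW \<omega> = fst \<omega>"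

definition seqX :: "outcome \<Rightarrow> nat \<Rightarrow> real" where
  "seqX \<omega> = fst (snd \<omega>)"

definition rvW :: "nat \<Rightarrow> outcome \<Rightarrow> real" where
  "rvW n \<omega> = seqW \<omega> n"

definition rvX :: "nat \<Rightarrow> outcome \<Rightarrow> real" where
  "rvX n \<omega> = seqX \<omega> n"

definition rvTheta :: "outcome \<Rightarrow> real" where
  "rvTheta \<omega> = snd (snd \<omega>)"

definition rvT :: "nat \<Rightarrow> outcome \<Rightarrow> real" where
  "rvT n \<omega> = (\<Sum>k = 1..n. rvW k \<omega>)"

text \<open>On the (null) event that infinitely many arrivals occur up to time \<open>t\<close>, the convention
  \<open>card A = 0\<close> for infinite \<open>A\<close> gives \<open>N\<^sub>t = 0\<close> and \<open>S\<^sub>t = 0\<close>. That explosion is null is part of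
  \<open>counting_process\<close> below, whose monotonicity clause fails on exploding paths.\<close>

definition procN :: "real \<Rightarrow> outcome \<Rightarrow> nat" where
  "procN t \<omega> = card {n. 1 \<le> n \<and> rvT n \<omega> \<le> t}"

definition procS :: "real \<Rightarrow> outcome \<Rightarrow> real" where
  "procS t \<omega> = (\<Sum>k = 1..procN t \<omega>. rvX k \<omega>)"

definition filt :: "real \<Rightarrow> outcome measure" where
  "filt t = sigma (space Omega)
     ((\<Union>u\<in>{0..t}. {procS u -` B \<inter> space Omega | B. B \<in> sets borel})
      \<union> {rvTheta -` B \<inter> space Omega | B. B \<in> sets Upsilon})"

definition lawTheta :: "outcome measure \<Rightarrow> real measure" where
  "lawTheta R = distr R Upsilon rvTheta"

definition lawX1 :: "outcome measure \<Rightarrow> real measure" where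
  "lawX1 R = distr R Upsilon (rvX 1)"

definition ExpU :: "real \<Rightarrow> real measure" where
  "ExpU \<theta> = restrict_space (density lborel (exponential_density \<theta>)) {0<..}"

definition Pth :: "real measure \<Rightarrow> real \<Rightarrow> outcome measure" where
  "Pth \<mu> \<theta> = (\<Pi>\<^sub>M n\<in>{1..}. ExpU \<theta>) \<Otimes>\<^sub>M ((\<Pi>\<^sub>M n\<in>{1..}. \<mu>) \<Otimes>\<^sub>M return Upsilon \<theta>)"

definition Pmix :: "real measure \<Rightarrow> real measure \<Rightarrow> outcome measure" where
  "Pmix \<mu> \<rho> = \<rho> \<bind> Pth \<mu>"

text \<open>The library's \<open>indep_var\<close> needs both variables to have the same range type.\<close>

definition indep_rv ::
  "'w measure \<Rightarrow> 'a measure \<Rightarrow> ('w \<Rightarrow> 'a) \<Rightarrow> 'b measure \<Rightarrow> ('w \<Rightarrow> 'b) \<Rightarrow> bool" where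
  "indep_rv R M\<^sub>1 Y\<^sub>1 M\<^sub>2 Y\<^sub>2 \<longleftrightarrow>
     Y\<^sub>1 \<in> R \<rightarrow>\<^sub>M M\<^sub>1 \<and> Y\<^sub>2 \<in> R \<rightarrow>\<^sub>M M\<^sub>2 \<and>
     prob_space.indep_set R {Y\<^sub>1 -` A \<inter> space R | A. A \<in> sets M\<^sub>1}
                            {Y\<^sub>2 -` A \<inter> space R | A. A \<in> sets M\<^sub>2}"

definition sigmaTheta :: "outcome measure" where
  "sigmaTheta = vimage_algebra (space Omega) rvTheta Upsilon"

definition cpTheta :: "outcome measure \<Rightarrow> outcome set \<Rightarrow> outcome \<Rightarrow> real" where
  "cpTheta R A = real_cond_exp R sigmaTheta (indicator A)"

definition cond_indep_vars ::
  "outcome measure \<Rightarrow> ('i \<Rightarrow> 'a measure) \<Rightarrow> ('i \<Rightarrow> outcome \<Rightarrow> 'a) \<Rightarrow> 'i set \<Rightarrow> bool" where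
  "cond_indep_vars R M' Y I \<longleftrightarrow>
     (\<forall>i\<in>I. Y i \<in> R \<rightarrow>\<^sub>M M' i) \<and>
     (\<forall>J\<subseteq>I. J \<noteq> {} \<longrightarrow> finite J \<longrightarrow> (\<forall>A\<in>(\<Pi> j\<in>J. sets (M' j)).
        AE \<omega> in R. cpTheta R (\<Inter>j\<in>J. Y j -` A j \<inter> space R) \<omega>
                 = (\<Prod>j\<in>J. cpTheta R (Y j -` A j \<inter> space R) \<omega>)))"

definition cond_a1 :: "outcome measure \<Rightarrow> bool" where
  "cond_a1 R \<longleftrightarrow> cond_indep_vars R (\<lambda>_. SeqU) (case_bool seqW seqX) UNIV"

definition cond_a2 :: "outcome measure \<Rightarrow> bool" where
  "cond_a2 R \<longleftrightarrow> indep_rv R Upsilon rvTheta SeqU seqX"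

text \<open>For a monotone path with values in the natural numbers, the last clause says that the jump
  \<open>N\<^sub>t - N\<^bsub>t-\<^esub>\<close> is at most one, since left limits are attained.\<close>

definition counting_process :: "outcome measure \<Rightarrow> (real \<Rightarrow> outcome \<Rightarrow> nat) \<Rightarrow> bool" where
  "counting_process R N \<longleftrightarrow>
     (\<forall>t\<ge>0. N t \<in> R \<rightarrow>\<^sub>M count_space UNIV) \<and>
     (AE \<omega> in R. N 0 \<omega> = 0 \<and>
        (\<forall>s t. 0 \<le> s \<and> s \<le> t \<longrightarrow> N s \<omega> \<le> N t \<omega>) \<and>
        (\<forall>t\<ge>0. continuous (at_right t) (\<lambda>u. real (N u \<omega>))) \<and>
        (\<forall>t>0. \<exists>s. 0 \<le> s \<and> s < t \<and> N t \<omega> \<le> N s \<omega> + 1))"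

definition increment :: "(real \<Rightarrow> outcome \<Rightarrow> nat) \<Rightarrow> real \<Rightarrow> real \<Rightarrow> outcome \<Rightarrow> int" where
  "increment N s t \<omega> = int (N t \<omega>) - int (N s \<omega>)"

definition risk_process :: "outcome measure \<Rightarrow> bool" where
  "risk_process R \<longleftrightarrow>
     counting_process R procN \<and>
     prob_space.indep_vars R (\<lambda>_. Upsilon) rvX {1..} \<and>
     (\<forall>n\<ge>1. distr R Upsilon (rvX n) = distr R Upsilon (rvX 1)) \<and>
     indep_rv R (\<Pi>\<^sub>M t\<in>{0..}. count_space UNIV) (\<lambda>\<omega>. \<lambda>t\<in>{0..}. procN t \<omega>) SeqU seqX"

definition poisson_process ::
  "outcome measure \<Rightarrow> (real \<Rightarrow> outcome \<Rightarrow> nat) \<Rightarrow> real \<Rightarrow> bool" where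
  "poisson_process R N r \<longleftrightarrow>
     (\<forall>n (\<tau> :: nat \<Rightarrow> real). 0 \<le> \<tau> 0 \<longrightarrow> (\<forall>i<n. \<tau> i < \<tau> (Suc i)) \<longrightarrow>
        prob_space.indep_vars R (\<lambda>_. count_space UNIV)
          (\<lambda>i. increment N (\<tau> i) (\<tau> (Suc i))) {..<n}) \<and>
     (\<forall>s t h. 0 \<le> s \<and> s \<le> t \<and> 0 \<le> h \<longrightarrow>
        distr R (count_space UNIV) (increment N (s + h) (t + h))
        = distr R (count_space UNIV) (increment N s t)) \<and>
     (\<forall>t>0. distr R (count_space UNIV) (N t) = measure_pmf (poisson_pmf (t * r)))"

definition mixed_poisson_process ::
  "outcome measure \<Rightarrow> (real \<Rightarrow> outcome \<Rightarrow> nat) \<Rightarrow> (real \<Rightarrow> real) \<Rightarrow> bool" where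
  "mixed_poisson_process R N g \<longleftrightarrow>
     (\<forall>n (\<tau> :: nat \<Rightarrow> real). 0 \<le> \<tau> 0 \<longrightarrow> (\<forall>i<n. \<tau> i < \<tau> (Suc i)) \<longrightarrow>
        cond_indep_vars R (\<lambda>_. count_space UNIV)
          (\<lambda>i. increment N (\<tau> i) (\<tau> (Suc i))) {..<n}) \<and>
     (\<forall>s t h B. 0 \<le> s \<and> s \<le> t \<and> 0 \<le> h \<longrightarrow>
        (AE \<omega> in R. cpTheta R (increment N (s + h) (t + h) -` B \<inter> space R) \<omega>
                  = cpTheta R (increment N s t -` B \<inter> space R) \<omega>)) \<and>
     (\<forall>t>0. \<forall>k. AE \<omega> in R. cpTheta R (N t -` {k} \<inter> space R) \<omega>
                        = pmf (poisson_pmf (t * g (rvTheta \<omega>))) k)"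

definition S_is_CMPP :: "outcome measure \<Rightarrow> (real \<Rightarrow> real) \<Rightarrow> bool" where
  "S_is_CMPP R g \<longleftrightarrow> risk_process R \<and> mixed_poisson_process R procN g"

definition S_is_CPP :: "outcome measure \<Rightarrow> real \<Rightarrow> bool" where
  "S_is_CPP R r \<longleftrightarrow> risk_process R \<and> poisson_process R procN r"

definition progressively_equivalent :: "outcome measure \<Rightarrow> outcome measure \<Rightarrow> bool" where
  "progressively_equivalent Q P \<longleftrightarrow>
     (\<forall>t\<ge>0. absolutely_continuous (restr_to_subalg Q (filt t)) (restr_to_subalg P (filt t)) \<and>
            absolutely_continuous (restr_to_subalg P (filt t)) (restr_to_subalg Q (filt t)))"

text \<open>Functions on \<open>\<Upsilon>\<close> are represented by functions on the reals of which only the values on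
  \<open>(0,\<infinity>)\<close> matter.\<close>

definition M_plus :: "(real \<Rightarrow> real) set" where
  "M_plus = {g \<in> borel_measurable Upsilon. \<forall>\<theta>>0. 0 < g \<theta>}"

definition M_S :: "outcome measure \<Rightarrow> (real \<Rightarrow> real) \<Rightarrow> outcome measure set" where
  "M_S P g = {Q \<in> space (prob_algebra Omega).
     cond_a1 Q \<and> cond_a2 Q \<and> progressively_equivalent Q P \<and> S_is_CMPP Q g}"

definition M_S_theta ::
  "real measure \<Rightarrow> (real \<Rightarrow> real) \<Rightarrow> real \<Rightarrow> outcome measure set" where
  "M_S_theta \<mu> g \<theta> = {Q \<in> space (prob_algebra Omega).
     progressively_equivalent Q (Pth \<mu> \<theta>) \<and> S_is_CPP Q (g \<theta>)}"

text \<open>\<open>F_P_rep P \<beta> \<alpha> \<gamma>\<close> states that \<open>\<beta>\<close> belongs to the class \<open>\<F>\<^sub>P\<close>, with \<open>\<alpha>\<close> and \<open>\<gamma>\<close> as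
  witnesses. The normalisation makes the witnesses unique for a given \<open>\<beta>\<close>.\<close>

definition F_P_rep :: "outcome measure \<Rightarrow> (real \<Rightarrow> real \<Rightarrow> real) \<Rightarrow>
    (real \<Rightarrow> real) \<Rightarrow> (real \<Rightarrow> real) \<Rightarrow> bool" where
  "F_P_rep P \<beta> \<alpha> \<gamma> \<longleftrightarrow>
     \<alpha> \<in> borel_measurable Upsilon \<and> \<gamma> \<in> borel_measurable Upsilon \<and>
     (\<forall>x>0. \<forall>\<theta>>0. \<beta> x \<theta> = \<alpha> \<theta> + \<gamma> x) \<and>
     has_bochner_integral P (\<lambda>\<omega>. exp (\<gamma> (rvX 1 \<omega>))) 1"

definition R_plus :: "outcome measure \<Rightarrow> (real \<Rightarrow> real) set" where
  "R_plus P = {\<xi> \<in> borel_measurable Upsilon.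
     (AE \<theta> in lawTheta P. 0 < \<xi> \<theta>) \<and>
     has_bochner_integral P (\<lambda>\<omega>. \<xi> (rvTheta \<omega>)) 1}"

definition S_beta :: "(real \<Rightarrow> real \<Rightarrow> real) \<Rightarrow> real \<Rightarrow> real \<Rightarrow> outcome \<Rightarrow> real" where
  "S_beta \<beta> \<theta> t \<omega> = (\<Sum>k = 1..procN t \<omega>. \<beta> (rvX k \<omega>) \<theta>)"

definition M_tilde :: "(real \<Rightarrow> real \<Rightarrow> real) \<Rightarrow> (real \<Rightarrow> real) \<Rightarrow>
    real \<Rightarrow> real \<Rightarrow> outcome \<Rightarrow> real" where
  "M_tilde \<beta> \<alpha> \<theta> t \<omega> = exp (S_beta \<beta> \<theta> t \<omega> - t * \<theta> * (exp (\<alpha> \<theta>) - 1))"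

definition M_beta :: "(real \<Rightarrow> real \<Rightarrow> real) \<Rightarrow> (real \<Rightarrow> real) \<Rightarrow> (real \<Rightarrow> real) \<Rightarrow>
    real \<Rightarrow> outcome \<Rightarrow> real" where
  "M_beta \<beta> \<alpha> \<xi> t \<omega> = \<xi> (rvTheta \<omega>) *
     exp (S_beta \<beta> (rvTheta \<omega>) t \<omega>
          - t * rvTheta \<omega> * (exp (\<alpha> (rvTheta \<omega>)) - 1))"

definition martingale_L1 :: "outcome measure \<Rightarrow> (real \<Rightarrow> outcome \<Rightarrow> real) \<Rightarrow> bool" where
  "martingale_L1 R M \<longleftrightarrow>
     (\<forall>t\<ge>0. M t \<in> borel_measurable (filt t) \<and> integrable R (M t)) \<and>
     (\<forall>s t. 0 \<le> s \<and> s \<le> t \<longrightarrow> (AE \<omega> in R. real_cond_exp R (filt s) (M t) \<omega> = M s \<omega>))"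

text \<open>The Bochner integral of a non-integrable function is 0; the instance \<open>A = space Omega\<close>
  rules this out when \<open>Q\<close> is a probability measure.\<close>

definition density_identity ::
  "outcome measure \<Rightarrow> outcome measure \<Rightarrow> (real \<Rightarrow> outcome \<Rightarrow> real) \<Rightarrow> bool" where
  "density_identity Q P M \<longleftrightarrow>
     (\<forall>s t. 0 \<le> s \<and> s \<le> t \<longrightarrow>
        (\<forall>A\<in>sets (filt s). measure Q A = (LINT \<omega>:A|P. M t \<omega>)))"

definition is_RN_derivative :: "real measure \<Rightarrow> real measure \<Rightarrow> (real \<Rightarrow> real) \<Rightarrow> bool" where
  "is_RN_derivative M L f \<longleftrightarrow>
     f \<in> borel_measurable M \<and> (AE x in M. 0 \<le> f x) \<and> L = density M (\<lambda>x. ennreal (f x))"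

text \<open>The second conjunct is \<open>\<gamma> = ln f\<close>, read wherever \<open>f\<close> is positive, that is, off a
  \<open>P\<^bsub>X\<^sub>1\<^esub>\<close>-null set.\<close>

definition cond_star2 :: "outcome measure \<Rightarrow> (real \<Rightarrow> real) \<Rightarrow> outcome measure \<Rightarrow>
    (real \<Rightarrow> real) \<Rightarrow> (real \<Rightarrow> real) \<Rightarrow> bool" where
  "cond_star2 P g Q \<alpha> \<gamma> \<longleftrightarrow>
     (\<forall>\<omega>\<in>space Omega. g (rvTheta \<omega>) = rvTheta \<omega> * exp (\<alpha> (rvTheta \<omega>))) \<and>
     (\<exists>f. is_RN_derivative (lawX1 P) (lawX1 Q) f \<and>
          (AE x in lawX1 P. 0 < f x) \<and> (\<forall>x>0. 0 < f x \<longrightarrow> \<gamma> x = ln (f x)))"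

definition linked :: "outcome measure \<Rightarrow> (real \<Rightarrow> real) \<Rightarrow> outcome measure \<Rightarrow>
    (real \<Rightarrow> real \<Rightarrow> real) \<Rightarrow> (real \<Rightarrow> real) \<Rightarrow> (real \<Rightarrow> real) \<Rightarrow> (real \<Rightarrow> real) \<Rightarrow> bool" where
  "linked P g Q \<beta> \<alpha> \<gamma> \<xi> \<longleftrightarrow>
     cond_star2 P g Q \<alpha> \<gamma> \<and>
     density_identity Q P (M_beta \<beta> \<alpha> \<xi>) \<and>
     martingale_L1 P (M_beta \<beta> \<alpha> \<xi>)"

definition is_rcp :: "outcome measure \<Rightarrow> (real \<Rightarrow> outcome measure) \<Rightarrow> bool" where
  "is_rcp Q K \<longleftrightarrow>
     (\<forall>\<theta>>0. K \<theta> \<in> space (prob_algebra Omega)) \<and>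
     (\<forall>D\<in>sets Omega. (\<lambda>\<theta>. emeasure (K \<theta>) D) \<in> borel_measurable Upsilon \<and>
        (\<integral>\<^sup>+ \<theta>. emeasure (K \<theta>) D \<partial>lawTheta Q) = emeasure Q D)"

definition consistent_with_Theta ::
  "outcome measure \<Rightarrow> (real \<Rightarrow> outcome measure) \<Rightarrow> bool" where
  "consistent_with_Theta Q K \<longleftrightarrow>
     (\<forall>B\<in>sets Upsilon. AE \<theta> in lawTheta Q.
        \<theta> \<in> B \<longrightarrow> emeasure (K \<theta>) (rvTheta -` B \<inter> space Omega) = 1)"

definition rcp_essentially_unique :: "outcome measure \<Rightarrow> bool" where
  "rcp_essentially_unique Q \<longleftrightarrow>
     (\<forall>K K'. is_rcp Q K \<and> consistent_with_Theta Q K \<and>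
             is_rcp Q K' \<and> consistent_with_Theta Q K' \<longrightarrow>
        (AE \<theta> in lawTheta Q. K \<theta> = K' \<theta>))"

end

theory Submission
  imports Defs
begin

text \<open>
  Write \<open>K(l, m, \<theta>)\<close> for the law under which the waiting times are i.i.d. exponential with rate
  \<open>l\<close>, the claims are i.i.d. with law \<open>m\<close>, both sequences are independent, and \<open>\<Theta> = \<theta>\<close>. Conditioning
  on the first waiting time shows that \<open>N\<close> is a Poisson process with rate \<open>l\<close> under \<open>K(l, m, \<theta>)\<close>.
  Since the finite-dimensional distributions of \<open>N\<close> determine the law of the arrival times, every
  \<open>Q\<close> in \<open>\<M>\<^bsub>S,g\<^esub>\<close> is the mixture of the measures \<open>K(g \<theta>, Q\<^bsub>X\<^sub>1\<^esub>, \<theta>)\<close> with respect to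
  \<open>Q\<^sub>\<Theta>\<close>. This gives the disintegration, and reduces the density identity to each \<open>\<theta>\<close> separately,
  where it compares two compound Poisson processes: on an event fixing the values of \<open>N\<close> at finitely
  many times up to \<open>t\<close> and restricting the \<open>N\<^sub>t\<close> claims made by then, the ratio of the
  probabilities is read off the Poisson weights. Progressive equivalence yields the densities of
  \<open>Q\<^bsub>X\<^sub>1\<^esub>\<close> and \<open>Q\<^sub>\<Theta>\<close>.
\<close>

text \<open>Three obstacles shape the proof. The filtration is generated by S and \<Theta> alone,
  while the density at time t involves N_t and the individual claims. As claims are positive, S
  jumps at every arrival, so sums over the claims made up to t are limits of functions of finitely
  many values of S. For the identity itself, events about S are inconvenient; it is proved on the
  larger \<sigma>-algebra generated by \<open>claims_gen\<close>, where the density is explicit.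
  Next, independence of N and X and of \<Theta> and X does not make X independent of the pair (W,
  \<Theta>); here (a1) and (a2) enter together. Finally, N_t = 0 on exploding paths by convention,
  so relations between N and the arrival times hold only almost surely, and explosion must be
  excluded for the constructed measures as well as for an arbitrary Q.

  The exponent -t\<theta>(e^\<alpha> - 1) is the logarithm of the ratio of the Poisson normalising
  factors for the rates \<theta>e^\<alpha> and \<theta>. The conditional measures are given
  explicitly for every \<theta>, so no general disintegration theorem is invoked and no exceptional
  \<theta> arise.\<close>

lemma space_Upsilon [simp]: "space Upsilon = {0<..}"
  by (simp add: Upsilon_def space_restrict_space)

lemma sets_Upsilon: "sets Upsilon = {A \<in> sets borel. A \<subseteq> {0<..}}"
  unfolding Upsilon_def by (auto simp: sets_restrict_space_iff)

lemma measurable_Upsilon_borel: "(\<lambda>x. x) \<in> borel_measurable Upsilon"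
  by (auto simp: Upsilon_def intro: measurable_restrict_space1)

lemma measurable_UpsilonD: "f \<in> M \<rightarrow>\<^sub>M Upsilon \<Longrightarrow> f \<in> borel_measurable M"
  using measurable_compose[OF _ measurable_Upsilon_borel] by auto

lemma measurable_UpsilonI:
  "f \<in> borel_measurable M \<Longrightarrow> (\<And>x. x \<in> space M \<Longrightarrow> 0 < f x) \<Longrightarrow> f \<in> M \<rightarrow>\<^sub>M Upsilon"
  unfolding Upsilon_def by (rule measurable_restrict_space2) auto

lemma space_SeqU: "space SeqU = (\<Pi>\<^sub>E n\<in>{1..}. {0<..})"
  by (simp add: SeqU_def space_PiM)

lemma space_Omega: "space Omega = space SeqU \<times> space SeqU \<times> {0<..}"
  by (simp add: Omega_def space_pair_measure)

section \<open>Exponential waiting times and i.i.d. sequences of them\<close>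

lemma sets_ExpU [simp, measurable_cong]: "sets (ExpU l) = sets Upsilon"
  by (simp add: ExpU_def Upsilon_def sets_restrict_space)

lemma space_ExpU [simp]: "space (ExpU l) = {0<..}"
  using sets_eq_imp_space_eq[OF sets_ExpU] by simp

text \<open>With the restriction to the half-line turned into an explicit indicator, substitution
  and the fundamental theorem of calculus become available for integrals under
  \<open>ExpU\<close>.\<close>

lemma nn_integral_ExpU:
  assumes [measurable]: "f \<in> borel_measurable Upsilon"
  shows "(\<integral>\<^sup>+x. f x \<partial>ExpU l)
    = (\<integral>\<^sup>+x. ennreal (exponential_density l x) * (f x * indicator {0<..} x) \<partial>lborel)"
proof -
  have "(\<lambda>x. f x * indicator {0<..} x) \<in> borel_measurable borel"
    using assms unfolding Upsilon_def by (subst borel_measurable_restrict_space_iff_ennreal[symmetric]) auto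
  then show ?thesis
    unfolding ExpU_def
    by (subst nn_integral_restrict_space) (auto simp: nn_integral_density)
qed

lemma prob_space_ExpU: assumes "0 < l" shows "prob_space (ExpU l)"
proof -
  interpret D: prob_space "density lborel (exponential_density l)"
    by (rule prob_space_exponential_density) fact
  have "emeasure (ExpU l) (space (ExpU l)) = (\<integral>\<^sup>+x. ennreal (exponential_density l x) * (1 * indicator {0<..} x) \<partial>lborel)"
    by (subst nn_integral_ExpU[symmetric]) auto
  \<comment> \<open>The exponential density is positive at 0 as well, a point outside the open
    half-line; the two integrands differ only there.\<close>
  also have "\<dots> = (\<integral>\<^sup>+x. ennreal (exponential_density l x) \<partial>lborel)"
    by (rule nn_integral_cong_AE, rule AE_mp[OF AE_lborel_singleton[of 0]])
      (auto simp: exponential_density_def indicator_def intro!: AE_I2)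
  also have "\<dots> = 1"
    using D.emeasure_space_1 by (simp add: emeasure_density)
  finally show ?thesis by (rule prob_spaceI)
qed

definition expo_seq :: "real \<Rightarrow> (nat \<Rightarrow> real) measure" where
  "expo_seq l = (\<Pi>\<^sub>M n\<in>{1..}. ExpU l)"

lemma sets_PiM_SeqU:
  "sets m = sets Upsilon \<Longrightarrow> sets (\<Pi>\<^sub>M n\<in>{1::nat..}. m) = sets SeqU"
  unfolding SeqU_def by (rule sets_PiM_cong) auto

lemma sets_expo_seq [simp, measurable_cong]: "sets (expo_seq l) = sets SeqU"
  unfolding expo_seq_def by (rule sets_PiM_SeqU) simp

lemma space_expo_seq [simp]: "space (expo_seq l) = space SeqU"
  by (rule sets_eq_imp_space_eq) simp

lemma prob_space_expo_seq: "0 < l \<Longrightarrow> prob_space (expo_seq l)"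
  unfolding expo_seq_def by (rule prob_space_PiM) (rule prob_space_ExpU)

lemma measurable_SeqU_component: "1 \<le> n \<Longrightarrow> (\<lambda>w. w n) \<in> SeqU \<rightarrow>\<^sub>M Upsilon"
  unfolding SeqU_def by (rule measurable_component_singleton) simp

definition arrival :: "(nat \<Rightarrow> real) \<Rightarrow> nat \<Rightarrow> real" where
  "arrival w n = (\<Sum>k = 1..n. w k)"

lemma measurable_arrival [measurable]: "(\<lambda>w. arrival w n) \<in> borel_measurable SeqU"
  unfolding arrival_def
  by (intro borel_measurable_sum measurable_UpsilonD measurable_SeqU_component) auto

lemma arrival_0 [simp]: "arrival w 0 = 0" by (simp add: arrival_def)

lemma arrival_Suc: "arrival w (Suc n) = arrival w n + w (Suc n)" by (simp add: arrival_def)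

lemma SeqU_pos: "w \<in> space SeqU \<Longrightarrow> 1 \<le> n \<Longrightarrow> 0 < w n"
  by (auto simp: space_SeqU)

lemma strict_mono_arrival: "w \<in> space SeqU \<Longrightarrow> strict_mono (arrival w)"
  by (auto simp: strict_mono_Suc_iff arrival_Suc SeqU_pos)

lemma arrival_nonneg: "w \<in> space SeqU \<Longrightarrow> 0 \<le> arrival w n"
  using strict_mono_less_eq[OF strict_mono_arrival, of w 0 n] by simp

text \<open>Prepends a term and moves the others up by one index. Indices start at 1, and the
  restriction to \<open>{1..}\<close> puts the result into the extensional product
  \<open>space SeqU\<close>.\<close>

definition seq_cons :: "real \<Rightarrow> (nat \<Rightarrow> real) \<Rightarrow> nat \<Rightarrow> real" where
  "seq_cons x w = (\<lambda>n\<in>{1..}. if n = 1 then x else w (n - 1))"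

lemma arrival_seq_cons: "arrival (seq_cons x w) (Suc n) = x + arrival w n"
  by (induction n) (auto simp: arrival_Suc seq_cons_def)

lemma measurable_seq_cons [measurable]:
  "(\<lambda>(x, w). seq_cons x w) \<in> Upsilon \<Otimes>\<^sub>M SeqU \<rightarrow>\<^sub>M SeqU"
  unfolding SeqU_def seq_cons_def split_beta
proof (intro measurable_restrict)
  fix n :: nat assume "n \<in> {1..}"
  then show "(\<lambda>x. if n = 1 then fst x else snd x (n - 1)) \<in> Upsilon \<Otimes>\<^sub>M (\<Pi>\<^sub>M n\<in>{1..}. Upsilon) \<rightarrow>\<^sub>M Upsilon"
    by (cases "n = 1") (auto intro!: measurable_compose[OF measurable_snd] measurable_component_singleton)
qed

text \<open>An independent first term followed by an i.i.d. sequence is again an i.i.d. sequence of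
  the same law. It suffices to compare cylinders: the preimage of a cylinder is a rectangle whose
  first side carries the condition on index 1 and whose second side is a cylinder with all other
  conditions moved down by one index.\<close>

lemma distr_seq_cons:
  assumes m: "prob_space m" "sets m = sets Upsilon"
  shows "distr (m \<Otimes>\<^sub>M (\<Pi>\<^sub>M n\<in>{1::nat..}. m)) (\<Pi>\<^sub>M n\<in>{1::nat..}. m) (\<lambda>(x, w). seq_cons x w)
    = (\<Pi>\<^sub>M n\<in>{1..}. m)"
proof (rule measure_eqI_PiM_infinite[symmetric, OF refl])
  interpret m: prob_space m by fact
  interpret S: prob_space "\<Pi>\<^sub>M n\<in>{1::nat..}. m" using m by (intro prob_space_PiM)
  have [measurable_cong]: "sets (\<Pi>\<^sub>M n\<in>{1::nat..}. m) = sets SeqU" "sets m = sets Upsilon"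
    by (rule sets_PiM_SeqU[OF m(2)], rule m(2))
  show "finite_measure (\<Pi>\<^sub>M n\<in>{1::nat..}. m)" by unfold_locales
  fix A J assume J: "finite J" "J \<subseteq> {1::nat..}" and A: "\<And>i. i \<in> J \<Longrightarrow> A i \<in> sets m"
  have Am[measurable]: "A i \<in> sets m" if "i \<in> J" for i using A that by auto
  \<comment> \<open>The constrained indices other than 1, shifted down. If index 1 is not
    constrained, the first side \<open>B\<close> of the rectangle is the whole space.\<close>
  let ?J' = "(\<lambda>n. n - 1) ` (J - {1})"
  define B where "B = (if 1 \<in> J then A 1 else space m)"
  have J': "finite ?J'" "?J' \<subseteq> {1..}" using J by auto
  have inj: "inj_on (\<lambda>n. n - 1) (J - {1})" using J by (auto simp: inj_on_def)
  have B[measurable]: "B \<in> sets m" by (auto simp: B_def intro: A)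
  have mc: "(\<lambda>(x, w). seq_cons x w) \<in> m \<Otimes>\<^sub>M (\<Pi>\<^sub>M n\<in>{1::nat..}. m) \<rightarrow>\<^sub>M (\<Pi>\<^sub>M n\<in>{1::nat..}. m)"
    by measurable
  have eq: "(\<lambda>(x, w). seq_cons x w) -` prod_emb {1..} (\<lambda>_. m) J (Pi\<^sub>E J A) \<inter> space (m \<Otimes>\<^sub>M (\<Pi>\<^sub>M n\<in>{1::nat..}. m))
      = B \<times> prod_emb {1..} (\<lambda>_. m) ?J' (\<Pi>\<^sub>E i\<in>?J'. A (Suc i))" (is "?L = ?R")
  proof (intro set_eqI iffI)
    fix z assume z: "z \<in> ?L"
    obtain x w where zxw: "z = (x, w)" by force
    from z have x: "x \<in> space m" and w: "w \<in> (\<Pi>\<^sub>E i\<in>{1..}. space m)"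
      and c: "\<And>i. i \<in> J \<Longrightarrow> seq_cons x w i \<in> A i"
      using J by (auto simp: prod_emb_def space_pair_measure space_PiM PiE_def Pi_def zxw)
    have "w (i - 1) \<in> A i" if "i \<in> J" "i \<noteq> 1" for i
      using c[OF that(1)] that J by (auto simp: seq_cons_def split: if_splits)
    moreover have "1 \<in> J \<Longrightarrow> x \<in> A 1" using c[of 1] by (simp add: seq_cons_def)
    ultimately have "x \<in> B" by (simp add: B_def x)
    moreover have "w i \<in> A (Suc i)" if i: "i \<in> ?J'" for i
    proof -
      obtain j where j: "j \<in> J" "j \<noteq> 1" "i = j - 1" using i by blast
      then have "Suc i = j" using J by auto
      then show ?thesis using \<open>\<And>i. i \<in> J \<Longrightarrow> i \<noteq> 1 \<Longrightarrow> w (i - 1) \<in> A i\<close>[of j] j by simp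
    qed
    ultimately have "x \<in> B" "\<And>i. i \<in> ?J' \<Longrightarrow> w i \<in> A (Suc i)" by blast+
    then show "z \<in> ?R"
      using w by (auto simp: prod_emb_def PiE_iff zxw)
  next
    fix z assume z: "z \<in> ?R"
    obtain x w where zxw: "z = (x, w)" by force
    from z have xB: "x \<in> B" and w: "w \<in> prod_emb {1..} (\<lambda>_. m) ?J' (\<Pi>\<^sub>E i\<in>?J'. A (Suc i))"
      by (auto simp: zxw)
    have x: "x \<in> space m" using xB sets.sets_into_space[OF B] by auto
    have w': "w \<in> (\<Pi>\<^sub>E i\<in>{1..}. space m)" and wA: "\<And>i. i \<in> ?J' \<Longrightarrow> w i \<in> A (Suc i)"
      using w by (auto simp: prod_emb_def PiE_def Pi_def)
    have "seq_cons x w i \<in> A i" if "i \<in> J" for i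
    proof (cases "i = 1")
      case True then show ?thesis using xB that by (simp add: B_def seq_cons_def)
    next
      case False
      then have "i - 1 \<in> ?J'" "Suc (i - 1) = i" "1 \<le> i" using that J by auto
      then show ?thesis using wA[of "i-1"] False by (simp add: seq_cons_def)
    qed
    moreover have "seq_cons x w \<in> (\<Pi>\<^sub>E i\<in>{1..}. space m)"
      using x w' by (auto simp: seq_cons_def PiE_def Pi_def extensional_def)
    ultimately show "z \<in> ?L"
      using x w' by (auto simp: zxw prod_emb_def space_pair_measure space_PiM PiE_def Pi_def)
  qed
  have 1: "prod_emb {1..} (\<lambda>_. m) J (Pi\<^sub>E J A) \<in> sets (\<Pi>\<^sub>M n\<in>{1::nat..}. m)"
    using J A by (intro sets_PiM_I) auto
  have 2: "prod_emb {1..} (\<lambda>_. m) ?J' (\<Pi>\<^sub>E i\<in>?J'. A (Suc i)) \<in> sets (\<Pi>\<^sub>M n\<in>{1::nat..}. m)"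
    using J' A J by (intro sets_PiM_I) (auto simp: subset_iff Suc_diff_le)
  have "emeasure (distr (m \<Otimes>\<^sub>M (\<Pi>\<^sub>M n\<in>{1::nat..}. m)) (\<Pi>\<^sub>M n\<in>{1::nat..}. m) (\<lambda>(x, w). seq_cons x w))
      (prod_emb {1..} (\<lambda>_. m) J (Pi\<^sub>E J A))
    = emeasure m B * emeasure (\<Pi>\<^sub>M n\<in>{1::nat..}. m) (prod_emb {1..} (\<lambda>_. m) ?J' (\<Pi>\<^sub>E i\<in>?J'. A (Suc i)))"
    by (simp only: emeasure_distr[OF mc 1] eq S.emeasure_pair_measure_Times[OF B 2])
  also have "\<dots> = emeasure m B * (\<Prod>i\<in>?J'. emeasure m (A (Suc i)))"
    using J' J A m by (subst emeasure_PiM_emb) (auto simp: subset_iff Suc_diff_le)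
  also have "(\<Prod>i\<in>?J'. emeasure m (A (Suc i))) = (\<Prod>i\<in>J-{1}. emeasure m (A i))"
    using J by (subst prod.reindex[OF inj]) (auto intro!: prod.cong simp: subset_iff Suc_diff_le)
  also have "emeasure m B * \<dots> = (\<Prod>i\<in>J. emeasure m (A i))"
    using J by (cases "1 \<in> J") (auto simp: B_def m.emeasure_space_1 prod.remove[of J 1])
  also have "\<dots> = emeasure (\<Pi>\<^sub>M n\<in>{1::nat..}. m) (prod_emb {1..} (\<lambda>_. m) J (Pi\<^sub>E J A))"
    using J A m by (subst emeasure_PiM_emb) auto
  finally show "emeasure (\<Pi>\<^sub>M n\<in>{1::nat..}. m) (prod_emb {1..} (\<lambda>_. m) J (Pi\<^sub>E J A)) =
     emeasure (distr (m \<Otimes>\<^sub>M (\<Pi>\<^sub>M n\<in>{1::nat..}. m)) (\<Pi>\<^sub>M n\<in>{1::nat..}. m) (\<lambda>(x, w). seq_cons x w))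
      (prod_emb {1..} (\<lambda>_. m) J (Pi\<^sub>E J A))" by simp
qed simp

text \<open>Conditioning on the first waiting time, as an integral formula. The law of the remaining
  waiting times is again \<open>expo_seq l\<close>, which is what lets the Poisson weights be
  computed by induction.\<close>

lemma nn_integral_expo_seq:
  assumes l: "0 < l" and [measurable]: "f \<in> borel_measurable SeqU"
  shows "(\<integral>\<^sup>+w. f w \<partial>expo_seq l) = (\<integral>\<^sup>+x. ennreal (exponential_density l x) *
      ((\<integral>\<^sup>+w. f (seq_cons x w) \<partial>expo_seq l) * indicator {0<..} x) \<partial>lborel)"
proof -
  interpret S: prob_space "expo_seq l" by (rule prob_space_expo_seq) fact
  have *: "expo_seq l = distr (ExpU l \<Otimes>\<^sub>M expo_seq l) (expo_seq l) (\<lambda>(x, w). seq_cons x w)"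
    unfolding expo_seq_def using l by (subst distr_seq_cons) (auto intro: prob_space_ExpU)
  have "(\<integral>\<^sup>+w. f w \<partial>expo_seq l) = (\<integral>\<^sup>+z. f (case z of (x, w) \<Rightarrow> seq_cons x w) \<partial>(ExpU l \<Otimes>\<^sub>M expo_seq l))"
    by (subst *) (simp add: nn_integral_distr)
  also have "\<dots> = (\<integral>\<^sup>+x. \<integral>\<^sup>+w. f (seq_cons x w) \<partial>expo_seq l \<partial>ExpU l)"
    by (subst S.nn_integral_fst[symmetric]) auto
  also have "\<dots> = (\<integral>\<^sup>+x. ennreal (exponential_density l x) *
      ((\<integral>\<^sup>+w. f (seq_cons x w) \<partial>expo_seq l) * indicator {0<..} x) \<partial>lborel)"
    by (subst nn_integral_ExpU) auto
  finally show ?thesis .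
qed

section \<open>Arrivals with exponential waiting times\<close>

text \<open>The Poisson weights with mean \<open>r\<close>, including \<open>r = 0\<close>: since
  \<open>0 ^ 0 = 1\<close> they are then those of the point mass at 0. Time intervals of length zero
  do occur below.\<close>

definition pois :: "real \<Rightarrow> nat \<Rightarrow> real" where
  "pois r k = r ^ k / fact k * exp (- r)"

lemma pois_nonneg: "0 \<le> r \<Longrightarrow> 0 \<le> pois r k"
  by (simp add: pois_def)

lemma measurable_pois [measurable]: "(\<lambda>r. pois r k) \<in> borel_measurable borel"
  unfolding pois_def by measurable

lemma pmf_poisson_eq: "0 < r \<Longrightarrow> pmf (poisson_pmf r) k = pois r k"
  by (simp add: pois_def)

lemma pois_0: "pois 0 k = (if k = 0 then 1 else 0)"
  by (simp add: pois_def)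

lemma suminf_pois: assumes "0 \<le> r" shows "(\<Sum>k. ennreal (pois r k)) = 1"
proof (cases "r = 0")
  case True
  then have "(\<Sum>k. ennreal (pois r k)) = (\<Sum>k\<in>{0}. ennreal (pois r k))"
    by (intro suminf_finite) (auto simp: pois_0)
  then show ?thesis using True by (simp add: pois_0)
next
  case False
  then have r: "0 < r" using assms by simp
  have "(\<Sum>k. ennreal (pois r k)) = (\<integral>\<^sup>+k. ennreal (pmf (poisson_pmf r) k) \<partial>count_space UNIV)"
    using r by (simp add: nn_integral_count_space_nat pmf_poisson_eq del: pmf_poisson)
  also have "\<dots> = 1" by (simp add: nn_integral_pmf_eq_1)
  finally show ?thesis .
qed

text \<open>The list \<open>[(d\<^sub>1, k\<^sub>1), \<dots>, (d\<^sub>m, k\<^sub>m)]\<close> prescribes exactly \<open>k\<^sub>i\<close> arrivals in the \<open>i\<close>-th of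
  the consecutive intervals of lengths \<open>d\<^sub>1, \<dots>, d\<^sub>m\<close> following time \<open>t\<close>, before which there
  are \<open>n\<close> arrivals.\<close>

fun counts :: "(real \<times> nat) list \<Rightarrow> real \<Rightarrow> nat \<Rightarrow> (nat \<Rightarrow> real) \<Rightarrow> bool" where
  "counts [] t n w \<longleftrightarrow> True"
| "counts ((d, k) # ds) t n w \<longleftrightarrow>
     arrival w (n + k) \<le> t + d \<and> t + d < arrival w (Suc (n + k)) \<and> counts ds (t + d) (n + k) w"

lemma measurable_counts [measurable]: "Measurable.pred SeqU (counts ds t n)"
proof (induction ds arbitrary: t n)
  case Nil then show ?case by (subst counts.simps[abs_def]) simp
next
  case (Cons a ds)
  obtain d k where a: "a = (d, k)" by force
  note [measurable] = Cons
  have "counts (a # ds) t n = (\<lambda>w. arrival w (n + k) \<le> t + d \<and> t + d < arrival w (Suc (n + k)) \<and> counts ds (t + d) (n + k) w)"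
    by (auto simp: a)
  then show ?case by simp
qed

text \<open>Deleting an arrival that already belongs to the past moves the clock back by its waiting
  time and lowers all indices by one. This is why \<open>counts\<close> carries a starting time and
  a starting index.\<close>

lemma counts_seq_cons_Suc: "counts ds t (Suc n) (seq_cons x w) \<longleftrightarrow> counts ds (t - x) n w"
proof (induction ds arbitrary: t n)
  case (Cons a ds)
  obtain d k where a: "a = (d, k)" by force
  have *: "t + d - x = t - x + d" by simp
  show ?case using Cons.IH[of "t + d" "n + k"] by (auto simp: a arrival_seq_cons *)
qed simp

text \<open>Letting the clock run for \<open>d\<close> amounts to shortening the first waiting time
  by \<open>d\<close>. The only arrival time that does not move along is the fictitious arrival 0 at
  time 0; the sign conditions ensure that it lies in the past on both sides.\<close>

lemma counts_seq_cons_shift: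
  assumes "0 \<le> t" "0 \<le> d" "\<forall>(e, k)\<in>set ds. 0 \<le> e"
  shows "counts ds (t + d) n (seq_cons x w) \<longleftrightarrow> counts ds t n (seq_cons (x - d) w)"
  using assms
proof (induction ds arbitrary: t n)
  case (Cons a ds)
  obtain e k where a: "a = (e, k)" by force
  have e: "0 \<le> e" using Cons a by auto
  have *: "t + d + e = t + e + d" by simp
  have arrival_eq: "arrival (seq_cons x w) m \<le> t + e + d \<longleftrightarrow> arrival (seq_cons (x - d) w) m \<le> t + e" for m
    using Cons.prems e by (cases m) (auto simp: arrival_seq_cons)
  have arrival_eq': "t + e + d < arrival (seq_cons x w) (Suc m) \<longleftrightarrow> t + e < arrival (seq_cons (x - d) w) (Suc m)" for m
    by (auto simp: arrival_seq_cons)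
  show ?case
    unfolding a counts.simps * arrival_eq arrival_eq' using Cons.prems e a
    by (subst Cons.IH) auto
qed simp

text \<open>A first arrival at \<open>x\<close> followed by \<open>k\<close> arrivals in the
  remaining time \<open>d - x\<close> makes \<open>k + 1\<close> arrivals up to \<open>d\<close>.
  The two exponential factors combine to the constant \<open>exp (- l * d)\<close>, which leaves a
  power of \<open>l * (d - x)\<close>; its antiderivative \<open>?F\<close> vanishes at
  \<open>d\<close>, so the value at 0 alone gives the next Poisson weight.\<close>

lemma nn_integral_exponential_pois:
  assumes l: "0 < l" and d: "0 \<le> d"
  shows "(\<integral>\<^sup>+x. ennreal (exponential_density l x) *
     (ennreal (pois (l * (d - x)) k) * indicator {0..d} x) \<partial>lborel) = ennreal (pois (l * d) (Suc k))"
proof -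
  let ?F = "\<lambda>x. - exp (- l * d) * (l * (d - x)) ^ Suc k / fact (Suc k)"
  let ?f = "\<lambda>x. exponential_density l x * pois (l * (d - x)) k"
  have eq: "?f x = l * exp (- l * d) * (l * (d - x)) ^ k / fact k" if "x \<in> {0..d}" for x
  proof -
    have "exp (- x * l) * exp (- (l * (d - x))) = exp (- l * d)"
      by (simp add: algebra_simps flip: exp_add)
    then show ?thesis using that
      by (simp add: exponential_density_def pois_def field_simps)
  qed
  have "(\<integral>\<^sup>+x. ennreal (exponential_density l x) *
     (ennreal (pois (l * (d - x)) k) * indicator {0..d} x) \<partial>lborel)
    = (\<integral>\<^sup>+x. ennreal (l * exp (- l * d) * (l * (d - x)) ^ k / fact k) * indicator {0..d} x \<partial>lborel)"
  proof (rule nn_integral_cong)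
    fix x :: real
    show "ennreal (exponential_density l x) * (ennreal (pois (l * (d - x)) k) * indicator {0..d} x)
      = ennreal (l * exp (- l * d) * (l * (d - x)) ^ k / fact k) * indicator {0..d} x"
    proof (cases "x \<in> {0..d}")
      case True
      have "ennreal (exponential_density l x) * ennreal (pois (l * (d - x)) k) = ennreal (?f x)"
        using l True by (subst ennreal_mult) (auto simp: pois_nonneg exponential_density_nonneg)
      then show ?thesis using True eq[OF True] by simp
    qed simp
  qed
  also have "\<dots> = ennreal (?F d - ?F 0)"
  proof (rule nn_integral_FTC_Icc)
    fix x assume "x \<in> {0..d}"
    have "((\<lambda>x. l * (d - x)) has_real_derivative - l) (at x)"
      by (auto intro!: derivative_eq_intros)
    from DERIV_power_Suc[OF this, of k]
    have "((\<lambda>x. (l * (d - x)) ^ Suc k) has_real_derivative (of_nat (Suc k) * (l * (d - x)) ^ k * (- l))) (at x)"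
      by (simp add: algebra_simps)
    then have "((\<lambda>x. (- exp (- l * d) / fact (Suc k)) * (l * (d - x)) ^ Suc k) has_real_derivative
        (- exp (- l * d) / fact (Suc k)) * (of_nat (Suc k) * (l * (d - x)) ^ k * (- l))) (at x)"
      by (rule DERIV_cmult)
    moreover have "(- exp (- l * d) / fact (Suc k)) * (of_nat (Suc k) * (l * (d - x)) ^ k * (- l))
        = l * exp (- l * d) * (l * (d - x)) ^ k / fact k"
      by (simp add: field_simps del: of_nat_Suc)
    moreover have "(\<lambda>x. (- exp (- l * d) / fact (Suc k)) * (l * (d - x)) ^ Suc k) = ?F"
      by (rule ext) (simp del: fact_Suc power_Suc)
    ultimately have D: "(?F has_real_derivative l * exp (- l * d) * (l * (d - x)) ^ k / fact k) (at x)"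
      by (simp only:)
    show "(?F has_real_derivative l * exp (- l * d) * (l * (d - x)) ^ k / fact k) (at x)"
      by (rule D)
  qed (use l d in auto)
  also have "?F d - ?F 0 = pois (l * d) (Suc k)"
    by (simp add: pois_def)
  finally show ?thesis .
qed

text \<open>Lack of memory: beyond \<open>d\<close> the exponential density is
  \<open>exp (- l * d)\<close> times the density restarted at \<open>d\<close>.\<close>

lemma nn_integral_exponential_shift:
  assumes l: "0 < l" and d: "0 \<le> d" and [measurable]: "f \<in> borel_measurable borel"
  shows "(\<integral>\<^sup>+x. ennreal (exponential_density l x) * (f (x - d) * indicator {d<..} x) \<partial>lborel)
     = ennreal (exp (- l * d)) * (\<integral>\<^sup>+x. ennreal (exponential_density l x) * (f x * indicator {0<..} x) \<partial>lborel)"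
proof -
  have "(\<integral>\<^sup>+x. ennreal (exponential_density l x) * (f (x - d) * indicator {d<..} x) \<partial>lborel)
     = (\<integral>\<^sup>+x. ennreal (exponential_density l (d + x)) * (f x * indicator {0<..} x) \<partial>lborel)"
    by (subst nn_integral_real_affine[where c=1 and t=d]) (auto intro!: nn_integral_cong simp: indicator_def)
  also have "\<dots> = (\<integral>\<^sup>+x. ennreal (exp (- l * d)) * (ennreal (exponential_density l x) * (f x * indicator {0<..} x)) \<partial>lborel)"
  proof (rule nn_integral_cong)
    fix x :: real
    have "exponential_density l (d + x) = exp (- l * d) * exponential_density l x" if "0 < x"
      using that d by (simp add: exponential_density_def algebra_simps flip: exp_add)
    then show "ennreal (exponential_density l (d + x)) * (f x * indicator {0<..} x)
      = ennreal (exp (- l * d)) * (ennreal (exponential_density l x) * (f x * indicator {0<..} x))"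
      using l by (auto simp: indicator_def ennreal_mult exponential_density_nonneg mult.assoc)
  qed
  finally show ?thesis by (simp add: nn_integral_cmult)
qed

text \<open>Two nested inductions, on the list and on the count \<open>k\<close> in its first
  interval. If \<open>k = 0\<close>, lack of memory removes the whole interval and leaves the rest
  of the list. Otherwise a first arrival at \<open>x\<close> is deleted, which leaves
  \<open>k - 1\<close> arrivals in an interval of length \<open>d - x\<close>; hence the inner
  induction is over all lengths \<open>d\<close>.\<close>

lemma emeasure_counts:
  assumes l: "0 < l" and ds: "\<forall>(d, k)\<in>set ds. 0 \<le> d"
  shows "emeasure (expo_seq l) {w\<in>space SeqU. counts ds 0 0 w}
    = ennreal (\<Prod>(d, k)\<leftarrow>ds. pois (l * d) k)"
  using ds
proof (induction ds)
  case Nil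
  interpret S: prob_space "expo_seq l" by (rule prob_space_expo_seq) fact
  show ?case using S.emeasure_space_1 by simp
next
  case (Cons a ds)
  obtain d k where a: "a = (d, k)" by force
  have d: "0 \<le> d" and ds: "\<forall>(d, k)\<in>set ds. 0 \<le> d" using Cons.prems a by auto
  have IH: "emeasure (expo_seq l) {w\<in>space SeqU. counts ds 0 0 w} = ennreal (\<Prod>(d, k)\<leftarrow>ds. pois (l * d) k)"
    using Cons.IH ds by blast
  have pnn: "0 \<le> (\<Prod>(d, k)\<leftarrow>ds. pois (l * d) k)"
    using ds l by (intro prod_list_nonneg) (auto intro!: pois_nonneg)
  have em: "emeasure (expo_seq l) {w\<in>space SeqU. P w} = (\<integral>\<^sup>+w. indicator {w. P w} w \<partial>expo_seq l)"
    if [measurable]: "Measurable.pred SeqU P" for P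
  proof -
    have "(\<integral>\<^sup>+w. indicator {w. P w} w \<partial>expo_seq l) = (\<integral>\<^sup>+w. indicator {w\<in>space SeqU. P w} w \<partial>expo_seq l)"
      by (rule nn_integral_cong) (auto simp: indicator_def)
    then show ?thesis by simp
  qed
  have "emeasure (expo_seq l) {w\<in>space SeqU. counts ((d, k) # ds) 0 0 w}
      = ennreal (pois (l * d) k * (\<Prod>(d, k)\<leftarrow>ds. pois (l * d) k))"
    using d
  proof (induction k arbitrary: d)
    case 0
    interpret S: prob_space "expo_seq l" by (rule prob_space_expo_seq) fact
    define G where "G x = (\<integral>\<^sup>+w. indicator {w. counts ds 0 0 w} (seq_cons x w) \<partial>expo_seq l)" for x
    have G: "G \<in> borel_measurable Upsilon"
      unfolding G_def by measurable
    define H where "H x = G x * indicator {0<..} x" for x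
    have H: "H \<in> borel_measurable borel"
      using G unfolding H_def Upsilon_def by (subst borel_measurable_restrict_space_iff_ennreal[symmetric]) auto
    have "emeasure (expo_seq l) {w\<in>space SeqU. counts ((d, 0) # ds) 0 0 w}
      = (\<integral>\<^sup>+w. indicator {w. counts ((d, 0) # ds) 0 0 w} w \<partial>expo_seq l)"
      by (rule em) measurable
    also have "\<dots> = (\<integral>\<^sup>+x. ennreal (exponential_density l x) *
      ((\<integral>\<^sup>+w. indicator {w. counts ((d, 0) # ds) 0 0 w} (seq_cons x w) \<partial>expo_seq l) * indicator {0<..} x) \<partial>lborel)"
      by (rule nn_integral_expo_seq[OF l]) measurable
    also have "\<dots> = (\<integral>\<^sup>+x. ennreal (exponential_density l x) * (H (x - d) * indicator {d<..} x) \<partial>lborel)"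
    proof (rule nn_integral_cong)
      fix x :: real
      have "counts ((d, 0) # ds) 0 0 (seq_cons x w) \<longleftrightarrow> d < x \<and> counts ds 0 0 (seq_cons (x - d) w)" for w
        using counts_seq_cons_shift[of 0 d ds 0 x w] \<open>0 \<le> d\<close> ds arrival_seq_cons[of x w 0] by auto
      then have "(\<integral>\<^sup>+w. indicator {w. counts ((d, 0) # ds) 0 0 w} (seq_cons x w) \<partial>expo_seq l)
        = (if d < x then G (x - d) else 0)"
        unfolding G_def by (auto intro!: nn_integral_cong simp: indicator_def)
      then show "ennreal (exponential_density l x) *
          ((\<integral>\<^sup>+w. indicator {w. counts ((d, 0) # ds) 0 0 w} (seq_cons x w) \<partial>expo_seq l) * indicator {0<..} x)
        = ennreal (exponential_density l x) * (H (x - d) * indicator {d<..} x)"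
        using \<open>0 \<le> d\<close> by (auto simp: H_def indicator_def)
    qed
    also have "\<dots> = ennreal (exp (- l * d)) * (\<integral>\<^sup>+x. ennreal (exponential_density l x) * (H x * indicator {0<..} x) \<partial>lborel)"
      by (rule nn_integral_exponential_shift) (use l \<open>0 \<le> d\<close> H in auto)
    also have "(\<integral>\<^sup>+x. ennreal (exponential_density l x) * (H x * indicator {0<..} x) \<partial>lborel)
       = (\<integral>\<^sup>+w. indicator {w. counts ds 0 0 w} w \<partial>expo_seq l)"
      by (subst nn_integral_expo_seq[OF l]) (auto intro!: nn_integral_cong simp: H_def G_def indicator_def)
    also have "\<dots> = ennreal (\<Prod>(d, k)\<leftarrow>ds. pois (l * d) k)"
      using IH em[of "counts ds 0 0"] by simp
    finally show ?case by (simp add: pois_def ennreal_mult' pnn)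
  next
    case (Suc k)
    have "emeasure (expo_seq l) {w\<in>space SeqU. counts ((d, Suc k) # ds) 0 0 w}
      = (\<integral>\<^sup>+w. indicator {w. counts ((d, Suc k) # ds) 0 0 w} w \<partial>expo_seq l)"
      by (rule em) measurable
    also have "\<dots> = (\<integral>\<^sup>+x. ennreal (exponential_density l x) *
      ((\<integral>\<^sup>+w. indicator {w. counts ((d, Suc k) # ds) 0 0 w} (seq_cons x w) \<partial>expo_seq l) * indicator {0<..} x) \<partial>lborel)"
      by (rule nn_integral_expo_seq[OF l]) measurable
    also have "\<dots> = (\<integral>\<^sup>+x. (ennreal (exponential_density l x) *
        (ennreal (pois (l * (d - x)) k) * indicator {0..d} x)) * ennreal (\<Prod>(d, k)\<leftarrow>ds. pois (l * d) k) \<partial>lborel)"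
    \<comment> \<open>The integrands differ at \<open>x = 0\<close>, which the half-line excludes
      and the interval \<open>{0..d}\<close> contains; this one point is null.\<close>
    proof (rule nn_integral_cong_AE, rule AE_mp[OF AE_lborel_singleton[of 0]], rule AE_I2, rule impI)
      fix x :: real assume x0: "x \<noteq> 0"
      show "ennreal (exponential_density l x) *
          ((\<integral>\<^sup>+w. indicator {w. counts ((d, Suc k) # ds) 0 0 w} (seq_cons x w) \<partial>expo_seq l) * indicator {0<..} x)
        = (ennreal (exponential_density l x) *
        (ennreal (pois (l * (d - x)) k) * indicator {0..d} x)) * ennreal (\<Prod>(d, k)\<leftarrow>ds. pois (l * d) k)"
      proof (cases "0 < x")
        case False
        then show ?thesis using x0 by simp
      next
        case True
        have c: "counts ((d, Suc k) # ds) 0 0 (seq_cons x w) \<longleftrightarrow> x \<le> d \<and> counts ((d - x, k) # ds) 0 0 w"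
          if "w \<in> space SeqU" for w
        proof -
          have "counts ((d, Suc k) # ds) 0 0 (seq_cons x w) \<longleftrightarrow> counts ((d - x, k) # ds) 0 0 w"
            by (simp add: counts_seq_cons_Suc arrival_seq_cons) auto
          \<comment> \<open>The remaining \<open>k\<close> arrivals happen by time
            \<open>d - x\<close>, and arrival times are nonnegative.\<close>
          moreover have "x \<le> d" if "counts ((d - x, k) # ds) 0 0 w"
            using that arrival_nonneg[OF \<open>w \<in> space SeqU\<close>, of k] by simp
          ultimately show ?thesis by blast
        qed
        have "(\<integral>\<^sup>+w. indicator {w. counts ((d, Suc k) # ds) 0 0 w} (seq_cons x w) \<partial>expo_seq l)
          = (if x \<le> d then (\<integral>\<^sup>+w. indicator {w. counts ((d - x, k) # ds) 0 0 w} w \<partial>expo_seq l) else 0)"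
        proof (cases "x \<le> d")
          case False
          have "(\<integral>\<^sup>+w. indicator {w. counts ((d, Suc k) # ds) 0 0 w} (seq_cons x w) \<partial>expo_seq l) = (\<integral>\<^sup>+w. 0 \<partial>expo_seq l)"
            by (rule nn_integral_cong) (auto simp: c False simp del: counts.simps)
          then show ?thesis using False by simp
        qed (auto intro!: nn_integral_cong simp: indicator_def c simp del: counts.simps)
        also have "\<dots> = (if x \<le> d then ennreal (pois (l * (d - x)) k * (\<Prod>(d, k)\<leftarrow>ds. pois (l * d) k)) else 0)"
          using Suc.IH[of "d - x"] em[of "counts ((d - x, k) # ds) 0 0"] by (auto simp del: counts.simps)
        finally show ?thesis
          using True l pnn by (auto simp: indicator_def ennreal_mult pois_nonneg mult.assoc simp del: counts.simps)
      qed
    qed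
    also have "\<dots> = ennreal (pois (l * d) (Suc k)) * ennreal (\<Prod>(d, k)\<leftarrow>ds. pois (l * d) k)"
      by (subst nn_integral_multc) (use l Suc.prems in \<open>auto simp: nn_integral_exponential_pois\<close>)
    finally show ?case using pnn by (simp add: ennreal_mult'')
  qed
  then show ?case by (simp add: a)
qed

section \<open>The counting process of a sequence of waiting times\<close>

definition num_arrivals :: "real \<Rightarrow> (nat \<Rightarrow> real) \<Rightarrow> nat" where
  "num_arrivals t w = card {n. 1 \<le> n \<and> arrival w n \<le> t}"

text \<open>Integer bounds are enough by the Archimedean property and keep the event a countable
  combination of measurable ones.\<close>

definition nonexploding :: "(nat \<Rightarrow> real) \<Rightarrow> bool" where
  "nonexploding w \<longleftrightarrow> (\<forall>m::nat. \<exists>n. real m < arrival w n)"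

lemma measurable_nonexploding [measurable]: "Measurable.pred SeqU nonexploding"
  unfolding nonexploding_def[abs_def] by measurable

lemma nonexplodingD: "nonexploding w \<Longrightarrow> \<exists>n. t < arrival w n"
  unfolding nonexploding_def by (meson less_trans reals_Archimedean2)

lemma num_arrivals_unique:
  assumes w: "w \<in> space SeqU" and n: "arrival w n \<le> t" "t < arrival w (Suc n)"
  shows "num_arrivals t w = n"
proof -
  have "{k. 1 \<le> k \<and> arrival w k \<le> t} = {1..n}"
  proof safe
    fix k assume "1 \<le> k" "arrival w k \<le> t"
    then have "arrival w k < arrival w (Suc n)" using n by simp
    then have "k < Suc n" using strict_mono_less[OF strict_mono_arrival[OF w]] by blast
    then show "k \<in> {1..n}" using \<open>1 \<le> k\<close> by simp
  next
    fix k assume "k \<in> {1..n}"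
    then have "arrival w k \<le> arrival w n" using strict_mono_less_eq[OF strict_mono_arrival[OF w]] by simp
    then show "arrival w k \<le> t" using n by simp
  qed auto
  then show ?thesis by (simp add: num_arrivals_def)
qed

text \<open>Replaces the cardinality by a search over countably many measurable conditions, which
  yields measurability in the path. The first branch is the explosion before or at \<open>t\<close>,
  where the counted set is infinite and its \<open>card\<close> is 0.\<close>

lemma num_arrivals_alt:
  assumes w: "w \<in> space SeqU" and t: "0 \<le> t"
  shows "num_arrivals t w = (if \<forall>n. arrival w n \<le> t then 0 else (LEAST n. t < arrival w (Suc n)))"
proof (cases "\<forall>n. arrival w n \<le> t")
  case True
  then have "{n. 1 \<le> n \<and> arrival w n \<le> t} = {1..}" by auto
  then show ?thesis using True by (simp add: num_arrivals_def infinite_Ici)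
next
  case False
  then obtain n where "t < arrival w n" by (auto simp: not_le)
  moreover from this have "n \<noteq> 0" using t by (intro notI) simp
  ultimately have ex: "\<exists>n. t < arrival w (Suc n)" by (metis not0_implies_Suc)
  define N where "N = (LEAST n. t < arrival w (Suc n))"
  have 1: "t < arrival w (Suc N)" unfolding N_def using ex by (rule LeastI_ex)
  have "arrival w N \<le> t"
  proof (cases N)
    case (Suc m)
    then have "\<not> t < arrival w (Suc m)" unfolding N_def by (intro not_less_Least) simp
    then show ?thesis using Suc by simp
  qed (use t in simp)
  then show ?thesis using num_arrivals_unique[OF w _ 1] False N_def by auto
qed

lemma measurable_num_arrivals:
  assumes "0 \<le> t" shows "num_arrivals t \<in> SeqU \<rightarrow>\<^sub>M count_space UNIV"
proof -
  have "(\<lambda>w. if \<forall>n. arrival w n \<le> t then 0 else (LEAST n. t < arrival w (Suc n))) \<in> SeqU \<rightarrow>\<^sub>M count_space UNIV"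
    by measurable
  then show ?thesis
    by (subst measurable_cong[OF num_arrivals_alt]) (use assms in auto)
qed

lemma arrival_num_arrivals_bounds:
  assumes w: "w \<in> space SeqU" and ex: "\<exists>n. t < arrival w n" and t: "0 \<le> t"
  shows "arrival w (num_arrivals t w) \<le> t" "t < arrival w (Suc (num_arrivals t w))"
proof -
  define m where "m = (LEAST n. t < arrival w n)"
  have 1: "t < arrival w m" unfolding m_def using ex by (rule LeastI_ex)
  have "m \<noteq> 0" using 1 t by (intro notI) simp
  then obtain k where k: "m = Suc k" using not0_implies_Suc by blast
  have "\<not> t < arrival w k" using k unfolding m_def by (intro not_less_Least) simp
  then have "arrival w k \<le> t" "t < arrival w (Suc k)" using 1 k by auto
  moreover from this have "num_arrivals t w = k" by (rule num_arrivals_unique[OF w])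
  ultimately show "arrival w (num_arrivals t w) \<le> t" "t < arrival w (Suc (num_arrivals t w))" by auto
qed

lemma num_arrivals_eq_iff:
  assumes "w \<in> space SeqU" "\<exists>n. t < arrival w n" "0 \<le> t"
  shows "num_arrivals t w = n \<longleftrightarrow> arrival w n \<le> t \<and> t < arrival w (Suc n)"
proof
  assume "num_arrivals t w = n"
  then show "arrival w n \<le> t \<and> t < arrival w (Suc n)" using arrival_num_arrivals_bounds[OF assms] by blast
qed (use num_arrivals_unique[OF assms(1)] in blast)

lemma le_num_arrivals_iff:
  assumes "w \<in> space SeqU" "\<exists>n. t < arrival w n" "0 \<le> t"
  shows "n \<le> num_arrivals t w \<longleftrightarrow> arrival w n \<le> t"
proof
  assume "n \<le> num_arrivals t w"
  then have "arrival w n \<le> arrival w (num_arrivals t w)"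
    using strict_mono_less_eq[OF strict_mono_arrival[OF assms(1)]] by blast
  then show "arrival w n \<le> t" using arrival_num_arrivals_bounds[OF assms] by simp
next
  assume "arrival w n \<le> t"
  then have "arrival w n < arrival w (Suc (num_arrivals t w))" using arrival_num_arrivals_bounds[OF assms] by simp
  then show "n \<le> num_arrivals t w" using strict_mono_less[OF strict_mono_arrival[OF assms(1)]] by (simp add: less_Suc_eq_le)
qed

lemma num_arrivals_mono:
  assumes "w \<in> space SeqU" "\<exists>n. t < arrival w n" "0 \<le> s" "s \<le> t"
  shows "num_arrivals s w \<le> num_arrivals t w"
proof -
  have "\<exists>n. s < arrival w n" using assms(2,4) by (meson le_less_trans)
  from arrival_num_arrivals_bounds(1)[OF assms(1) this assms(3)] show ?thesis
    using assms by (subst le_num_arrivals_iff) auto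
qed

lemma num_arrivals_0: "w \<in> space SeqU \<Longrightarrow> num_arrivals 0 w = 0"
  by (rule num_arrivals_unique) (auto simp: arrival_Suc SeqU_pos)

text \<open>Passes from inequalities between arrival times, which suit the computation by
  conditioning, to increments of N. The induction removes the first interval, so the starting time
  \<open>\<sigma> 0\<close> and the number \<open>n\<close> of arrivals up to it have to be
  arbitrary.\<close>

lemma counts_map:
  assumes w: "w \<in> space SeqU" "nonexploding w" and "0 \<le> \<sigma> 0" "\<And>i. i < m \<Longrightarrow> \<sigma> i \<le> \<sigma> (Suc i)"
    and "num_arrivals (\<sigma> 0) w = n"
  shows "counts (map (\<lambda>i. (\<sigma> (Suc i) - \<sigma> i, k i)) [0..<m]) (\<sigma> 0) n w
    \<longleftrightarrow> (\<forall>i<m. num_arrivals (\<sigma> (Suc i)) w = num_arrivals (\<sigma> i) w + k i)"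
  using assms(3-)
proof (induction m arbitrary: \<sigma> k n)
  case (Suc m)
  have 0: "0 \<le> \<sigma> (Suc 0)" using Suc.prems(1) Suc.prems(2)[of 0] by simp
  have up: "[0..<Suc m] = 0 # map Suc [0..<m]" by (simp add: upt_conv_Cons map_Suc_upt del: upt_Suc)
  have IH: "counts (map (\<lambda>i. (\<sigma> (Suc (Suc i)) - \<sigma> (Suc i), k (Suc i))) [0..<m]) (\<sigma> (Suc 0)) n' w
    \<longleftrightarrow> (\<forall>i<m. num_arrivals (\<sigma> (Suc (Suc i))) w = num_arrivals (\<sigma> (Suc i)) w + k (Suc i))"
    if "num_arrivals (\<sigma> (Suc 0)) w = n'" for n'
    using Suc.IH[of "\<lambda>i. \<sigma> (Suc i)" n' "\<lambda>i. k (Suc i)"] 0 Suc.prems(2) that by simp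
  have "counts (map (\<lambda>i. (\<sigma> (Suc i) - \<sigma> i, k i)) [0..<Suc m]) (\<sigma> 0) n w \<longleftrightarrow>
     num_arrivals (\<sigma> (Suc 0)) w = n + k 0 \<and>
     counts (map (\<lambda>i. (\<sigma> (Suc (Suc i)) - \<sigma> (Suc i), k (Suc i))) [0..<m]) (\<sigma> (Suc 0)) (n + k 0) w"
    unfolding up num_arrivals_eq_iff[OF w(1) nonexplodingD[OF w(2)] 0] by (simp add: comp_def)
  also have "\<dots> \<longleftrightarrow> num_arrivals (\<sigma> (Suc 0)) w = n + k 0 \<and>
      (\<forall>i<m. num_arrivals (\<sigma> (Suc (Suc i))) w = num_arrivals (\<sigma> (Suc i)) w + k (Suc i))"
    using IH by blast
  also have "\<dots> \<longleftrightarrow> (\<forall>i<Suc m. num_arrivals (\<sigma> (Suc i)) w = num_arrivals (\<sigma> i) w + k i)"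
    using Suc.prems(3) by (auto simp: less_Suc_eq_0_disj)
  finally show ?case .
qed simp

text \<open>The events of having exactly \<open>k\<close> arrivals up to time \<open>m\<close> are
  disjoint and their Poisson probabilities sum to 1. So almost surely one of them occurs, and on it
  arrival number \<open>k + 1\<close> lies beyond \<open>m\<close>.\<close>

lemma AE_nonexploding: assumes l: "0 < l" shows "AE w in expo_seq l. nonexploding w"
proof -
  interpret S: prob_space "expo_seq l" by (rule prob_space_expo_seq) fact
  have "AE w in expo_seq l. \<exists>n. real m < arrival w n" for m
  proof -
    define A where "A k = {w \<in> space SeqU. counts [(real m, k)] 0 0 w}" for k
    have A: "A k \<in> sets SeqU" for k unfolding A_def by measurable
    have "disjoint_family A"
    unfolding disjoint_family_on_def
    proof (intro ballI impI)
      fix i j :: nat assume "i \<noteq> j"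
      moreover have "w \<in> A i \<Longrightarrow> num_arrivals (real m) w = i" for w i
        unfolding A_def by (auto intro!: num_arrivals_unique)
      ultimately show "A i \<inter> A j = {}" by blast
    qed
    then have "emeasure (expo_seq l) (\<Union>k. A k) = (\<Sum>k. emeasure (expo_seq l) (A k))"
      using A by (intro suminf_emeasure[symmetric]) auto
    also have "\<dots> = (\<Sum>k. ennreal (pois (l * m) k))"
      unfolding A_def using l by (subst emeasure_counts) auto
    also have "\<dots> = 1" using l by (intro suminf_pois) simp
    finally have "S.prob (\<Union>k. A k) = 1" by (simp add: measure_def)
    then have "AE w in expo_seq l. w \<in> (\<Union>k. A k)"
      using A by (intro S.AE_prob_1) auto
    then show ?thesis by eventually_elim (auto simp: A_def)
  qed
  then show ?thesis unfolding nonexploding_def by (simp add: AE_all_countable)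
qed

lemma emeasure_num_arrivals_increments:
  assumes l: "0 < l" and \<sigma>: "\<sigma> 0 = 0" "\<And>i. i < m \<Longrightarrow> \<sigma> i \<le> \<sigma> (Suc i)"
  shows "emeasure (expo_seq l) {w\<in>space SeqU. \<forall>i<m. num_arrivals (\<sigma> (Suc i)) w = num_arrivals (\<sigma> i) w + k i}
    = ennreal (\<Prod>i<m. pois (l * (\<sigma> (Suc i) - \<sigma> i)) (k i))"
proof -
  let ?ds = "map (\<lambda>i. (\<sigma> (Suc i) - \<sigma> i, k i)) [0..<m]"
  have pos: "0 \<le> \<sigma> i" if "i \<le> m" for i
    using that by (induction i) (use \<sigma> in \<open>auto intro: order_trans\<close>)
  have meas: "{w\<in>space SeqU. \<forall>i<m. num_arrivals (\<sigma> (Suc i)) w = num_arrivals (\<sigma> i) w + k i} \<in> sets SeqU"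
  proof -
    have "{w\<in>space SeqU. \<forall>i\<in>{..<m}. num_arrivals (\<sigma> (Suc i)) w = num_arrivals (\<sigma> i) w + k i} \<in> sets SeqU"
    proof (rule sets.sets_Collect_finite_All)
      fix i assume "i \<in> {..<m}"
      then have [measurable]: "num_arrivals (\<sigma> i) \<in> SeqU \<rightarrow>\<^sub>M count_space UNIV" "num_arrivals (\<sigma> (Suc i)) \<in> SeqU \<rightarrow>\<^sub>M count_space UNIV"
        by (auto intro!: measurable_num_arrivals pos)
      show "{w\<in>space SeqU. num_arrivals (\<sigma> (Suc i)) w = num_arrivals (\<sigma> i) w + k i} \<in> sets SeqU" by measurable
    qed simp
    then show ?thesis unfolding Ball_def lessThan_iff .
  qed
  have "emeasure (expo_seq l) {w\<in>space SeqU. \<forall>i<m. num_arrivals (\<sigma> (Suc i)) w = num_arrivals (\<sigma> i) w + k i}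
      = emeasure (expo_seq l) {w\<in>space SeqU. counts ?ds 0 0 w}"
  proof (rule emeasure_eq_AE)
    show "AE w in expo_seq l. (w \<in> {w\<in>space SeqU. \<forall>i<m. num_arrivals (\<sigma> (Suc i)) w = num_arrivals (\<sigma> i) w + k i})
       = (w \<in> {w\<in>space SeqU. counts ?ds 0 0 w})"
      using AE_nonexploding[OF l] AE_space
    proof eventually_elim
      case (elim w)
      then show ?case using counts_map[of w \<sigma> m 0 k] \<sigma> num_arrivals_0[of w] by simp
    qed
    show "{w\<in>space SeqU. \<forall>i<m. num_arrivals (\<sigma> (Suc i)) w = num_arrivals (\<sigma> i) w + k i} \<in> sets (expo_seq l)"
      unfolding sets_expo_seq by (rule meas)
    show "{w\<in>space SeqU. counts ?ds 0 0 w} \<in> sets (expo_seq l)" by measurable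
  qed
  also have "\<dots> = ennreal (\<Prod>(d, k)\<leftarrow>?ds. pois (l * d) k)"
    using \<sigma> by (intro emeasure_counts[OF l]) auto
  also have "(\<Prod>(d, k)\<leftarrow>?ds. pois (l * d) k) = (\<Prod>i<m. pois (l * (\<sigma> (Suc i) - \<sigma> i)) (k i))"
    by (simp add: comp_def prod.distinct_set_conv_list[symmetric] atLeast0LessThan)
  finally show ?thesis .
qed

text \<open>The law of an increment of N: integer-valued because \<open>increment\<close> subtracts
  in \<open>int\<close>, and a point mass for an interval of length zero.\<close>

definition poisI :: "real \<Rightarrow> int pmf" where
  "poisI r = (if r = 0 then return_pmf 0 else map_pmf int (poisson_pmf r))"

lemma pmf_poisI: "0 \<le> r \<Longrightarrow> pmf (poisI r) k = (if 0 \<le> k then pois r (nat k) else 0)"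
proof (cases "r = 0")
  case False
  assume "0 \<le> r"
  then have r: "0 < r" using False by simp
  show ?thesis
  proof (cases "0 \<le> k")
    case True
    then have "pmf (map_pmf int (poisson_pmf r)) k = pmf (map_pmf int (poisson_pmf r)) (int (nat k))" by simp
    also have "\<dots> = pmf (poisson_pmf r) (nat k)" by (rule pmf_map_inj') auto
    finally show ?thesis using r True by (simp add: poisI_def pois_def)
  next
    case F: False
    then have "k \<notin> set_pmf (map_pmf int (poisson_pmf r))" by auto
    then show ?thesis using F r by (simp add: poisI_def pmf_eq_0_set_pmf)
  qed
qed (auto simp: poisI_def pois_0 pmf_return)

text \<open>On a countable product the joint law is determined by its point masses. If these factor
  through probability mass functions \<open>p i\<close>, the joint law is the product of the
  \<open>p i\<close>, and its projections give the marginal laws. Independence and marginals thus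
  come out together.\<close>

lemma (in prob_space) indep_vars_discrete:
  fixes Y :: "'i \<Rightarrow> 'a \<Rightarrow> 'b::countable" and p :: "'i \<Rightarrow> 'b pmf"
  assumes I: "finite I" and Y: "\<And>i. i \<in> I \<Longrightarrow> random_variable (count_space UNIV) (Y i)"
    and p: "\<And>k. emeasure M {\<omega>\<in>space M. \<forall>i\<in>I. Y i \<omega> = k i} = ennreal (\<Prod>i\<in>I. pmf (p i) (k i))"
  shows "indep_vars (\<lambda>_. count_space UNIV) Y I"
    and "\<And>i. i \<in> I \<Longrightarrow> distr M (count_space UNIV) (Y i) = measure_pmf (p i)"
proof -
  let ?C = "\<Pi>\<^sub>M i\<in>I. count_space (UNIV :: 'b set)"
  let ?D = "distr M ?C (\<lambda>\<omega>. \<lambda>i\<in>I. Y i \<omega>)"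
  have C: "?C = count_space (\<Pi>\<^sub>E i\<in>I. UNIV)" using I by (intro count_space_PiM_finite) auto
  have Yr[measurable]: "random_variable ?C (\<lambda>\<omega>. \<lambda>i\<in>I. Y i \<omega>)" using Y by (intro measurable_restrict)
  have sP: "sets (\<Pi>\<^sub>M i\<in>I. measure_pmf (p i)) = sets ?C" by (rule sets_PiM_cong) auto
  interpret P: product_sigma_finite "\<lambda>i. measure_pmf (p i)"
    by standard
  have D: "?D = (\<Pi>\<^sub>M i\<in>I. measure_pmf (p i))"
  proof (rule measure_eqI_countable)
    show "countable (\<Pi>\<^sub>E i\<in>I. UNIV :: 'b set)" using I by (intro countable_PiE) auto
    show "sets ?D = Pow (\<Pi>\<^sub>E i\<in>I. UNIV)" "sets (\<Pi>\<^sub>M i\<in>I. measure_pmf (p i)) = Pow (\<Pi>\<^sub>E i\<in>I. UNIV)"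
      by (simp_all add: C sP)
    fix k :: "'i \<Rightarrow> 'b" assume k: "k \<in> (\<Pi>\<^sub>E i\<in>I. UNIV)"
    then have "{k} \<in> sets ?C" by (simp add: C)
    then have "emeasure ?D {k} = emeasure M ((\<lambda>\<omega>. \<lambda>i\<in>I. Y i \<omega>) -` {k} \<inter> space M)"
      by (rule emeasure_distr[OF Yr])
    also have "(\<lambda>\<omega>. \<lambda>i\<in>I. Y i \<omega>) -` {k} \<inter> space M = {\<omega>\<in>space M. \<forall>i\<in>I. Y i \<omega> = k i}"
      using k by (auto simp: fun_eq_iff restrict_def PiE_def extensional_def)
    also have "emeasure M \<dots> = (\<Prod>i\<in>I. emeasure (measure_pmf (p i)) {k i})"
      by (simp add: p emeasure_pmf_single prod_ennreal)
    also have "\<dots> = emeasure (\<Pi>\<^sub>M i\<in>I. measure_pmf (p i)) (\<Pi>\<^sub>E i\<in>I. {k i})"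
      using I by (subst P.emeasure_PiM) auto
    also have "(\<Pi>\<^sub>E i\<in>I. {k i}) = {k}"
      using k by (intro PiE_singleton) (simp add: PiE_def)
    finally show "emeasure ?D {k} = emeasure (\<Pi>\<^sub>M i\<in>I. measure_pmf (p i)) {k}" .
  qed
  show dY: "distr M (count_space UNIV) (Y i) = measure_pmf (p i)" if i: "i \<in> I" for i
  proof -
    interpret PP: product_prob_space "\<lambda>i. measure_pmf (p i)" I by standard
    have [measurable]: "(\<lambda>x. x i) \<in> ?C \<rightarrow>\<^sub>M count_space UNIV" using i by (rule measurable_component_singleton)
    have "measure_pmf (p i) = distr (\<Pi>\<^sub>M i\<in>I. measure_pmf (p i)) (measure_pmf (p i)) (\<lambda>x. x i)"
      using i by (simp add: PP.PiM_component)
    also have "\<dots> = distr ?D (count_space UNIV) (\<lambda>x. x i)"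
      unfolding D by (rule distr_cong) auto
    also have "\<dots> = distr M (count_space UNIV) (Y i)"
      by (subst distr_distr) (auto simp: comp_def i)
    finally show ?thesis by simp
  qed
  show "indep_vars (\<lambda>_. count_space UNIV) Y I"
  proof (cases "I = {}")
    case True then show ?thesis by (simp add: indep_vars_def2 indep_sets_def)
  next
    case False
    then show ?thesis
      using Y by (subst indep_vars_iff_distr_eq_PiM') (auto simp: D dY intro!: PiM_cong)
  qed
qed

section \<open>The laws of compound and mixed compound Poisson processes\<close>

lemma measurable_rvTheta [measurable]: "rvTheta \<in> Omega \<rightarrow>\<^sub>M Upsilon"
  unfolding rvTheta_def[abs_def] Omega_def by measurable

lemma measurable_seqW [measurable]: "seqW \<in> Omega \<rightarrow>\<^sub>M SeqU"
  unfolding seqW_def[abs_def] Omega_def by measurable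

lemma measurable_seqX [measurable]: "seqX \<in> Omega \<rightarrow>\<^sub>M SeqU"
  unfolding seqX_def[abs_def] Omega_def by measurable

lemma measurable_rvX: "1 \<le> n \<Longrightarrow> rvX n \<in> Omega \<rightarrow>\<^sub>M Upsilon"
  unfolding rvX_def[abs_def]
  using measurable_compose[OF measurable_seqX measurable_SeqU_component] by blast

lemma procN_eq: "procN t \<omega> = num_arrivals t (seqW \<omega>)"
  by (simp add: procN_def num_arrivals_def rvT_def rvW_def arrival_def)

lemma measurable_procN: "0 \<le> t \<Longrightarrow> procN t \<in> Omega \<rightarrow>\<^sub>M count_space UNIV"
  unfolding procN_eq[abs_def] using measurable_compose[OF measurable_seqW measurable_num_arrivals] by blast

definition iid_seq :: "'a measure \<Rightarrow> (nat \<Rightarrow> 'a) measure" where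
  "iid_seq m = (\<Pi>\<^sub>M n\<in>{1..}. m)"

text \<open>The rate \<open>l\<close> is separate from the value \<theta> of the third coordinate:
  \<open>P_\<theta>\<close> is the member with rate \<theta>, and the conditional laws of Q are
  members with rate \<open>g \<theta>\<close> and another claim law \<open>m\<close>.\<close>

definition cpp_law :: "real \<Rightarrow> real measure \<Rightarrow> real \<Rightarrow> outcome measure" where
  "cpp_law l m \<theta> = expo_seq l \<Otimes>\<^sub>M (iid_seq m \<Otimes>\<^sub>M return Upsilon \<theta>)"

definition cmpp_law :: "(real \<Rightarrow> real) \<Rightarrow> real measure \<Rightarrow> real measure \<Rightarrow> outcome measure" where
  "cmpp_law g m r = r \<bind> (\<lambda>\<theta>. cpp_law (g \<theta>) m \<theta>)"

lemma Pth_eq: "Pth \<mu> \<theta> = cpp_law \<theta> \<mu> \<theta>"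
  by (simp add: Pth_def cpp_law_def expo_seq_def iid_seq_def)

lemma Pmix_eq: "Pmix \<mu> \<rho> = cmpp_law (\<lambda>\<theta>. \<theta>) \<mu> \<rho>"
  by (simp add: Pmix_def cmpp_law_def Pth_eq[abs_def])

lemma prob_algebraD:
  assumes "m \<in> space (prob_algebra M)"
  shows "prob_space m" "sets m = sets M" "space m = space M"
  using assms sets_eq_imp_space_eq[of m M] by (auto simp: space_prob_algebra)

lemma sets_iid: "m \<in> space (prob_algebra Upsilon) \<Longrightarrow> sets (iid_seq m) = sets SeqU"
  unfolding iid_seq_def by (rule sets_PiM_SeqU) (rule prob_algebraD)

lemma prob_space_iid: "m \<in> space (prob_algebra Upsilon) \<Longrightarrow> prob_space (iid_seq m)"
  unfolding iid_seq_def by (intro prob_space_PiM prob_algebraD)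

lemma iid_in_prob_algebra:
  "m \<in> space (prob_algebra Upsilon) \<Longrightarrow> iid_seq m \<in> space (prob_algebra SeqU)"
  using sets_iid prob_space_iid by (simp add: space_prob_algebra)

lemma sets_cpp_law: "m \<in> space (prob_algebra Upsilon) \<Longrightarrow> sets (cpp_law l m \<theta>) = sets Omega"
  unfolding cpp_law_def Omega_def by (intro sets_pair_measure_cong) (simp_all add: sets_iid)

lemma space_cpp_law: "m \<in> space (prob_algebra Upsilon) \<Longrightarrow> space (cpp_law l m \<theta>) = space Omega"
  by (rule sets_eq_imp_space_eq) (rule sets_cpp_law)

lemma prob_space_cpp_law:
  "m \<in> space (prob_algebra Upsilon) \<Longrightarrow> 0 < l \<Longrightarrow> 0 < \<theta> \<Longrightarrow> prob_space (cpp_law l m \<theta>)"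
  unfolding cpp_law_def
  by (intro prob_space_pair prob_space_expo_seq prob_space_iid prob_space_return) auto

lemma cpp_law_in_prob_algebra:
  "m \<in> space (prob_algebra Upsilon) \<Longrightarrow> 0 < l \<Longrightarrow> 0 < \<theta> \<Longrightarrow> cpp_law l m \<theta> \<in> space (prob_algebra Omega)"
  by (simp add: space_prob_algebra prob_space_cpp_law sets_cpp_law)

lemma space_OmegaI: "\<omega> \<in> space Omega \<longleftrightarrow>
    seqW \<omega> \<in> space SeqU \<and> seqX \<omega> \<in> space SeqU \<and> 0 < rvTheta \<omega>"
  by (cases \<omega>) (auto simp: space_Omega seqW_def seqX_def rvTheta_def)

lemma emeasure_cpp_law_rect:
  assumes m: "m \<in> space (prob_algebra Upsilon)" and l: "0 < l" and \<theta>: "0 < \<theta>"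
    and A: "A \<in> sets SeqU" and C: "C \<in> sets SeqU" and B: "B \<in> sets Upsilon"
  shows "emeasure (cpp_law l m \<theta>) {\<omega>\<in>space Omega. seqW \<omega> \<in> A \<and> seqX \<omega> \<in> C \<and> rvTheta \<omega> \<in> B}
    = emeasure (expo_seq l) A * emeasure (iid_seq m) C * indicator B \<theta>"
proof -
  interpret R: prob_space "return Upsilon \<theta>" using \<theta> by (intro prob_space_return) simp
  interpret X: prob_space "iid_seq m" by (rule prob_space_iid) fact
  interpret XR: prob_space "iid_seq m \<Otimes>\<^sub>M return Upsilon \<theta>"
    by (intro prob_space_pair prob_space_iid m R.prob_space_axioms)
  have "{\<omega>\<in>space Omega. seqW \<omega> \<in> A \<and> seqX \<omega> \<in> C \<and> rvTheta \<omega> \<in> B} = A \<times> (C \<times> B)"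
    using sets.sets_into_space[OF A] sets.sets_into_space[OF C] sets.sets_into_space[OF B]
    by (auto simp: space_OmegaI seqW_def seqX_def rvTheta_def)
  moreover have C': "C \<in> sets (iid_seq m)" using C sets_iid[OF m] by simp
  moreover have "C \<times> B \<in> sets (iid_seq m \<Otimes>\<^sub>M return Upsilon \<theta>)"
    using C' B by auto
  ultimately show ?thesis
    using A B unfolding cpp_law_def
    by (simp add: XR.emeasure_pair_measure_Times R.emeasure_pair_measure_Times mult.assoc del: One_nat_def)
qed

lemma nn_integral_cpp_law:
  assumes m: "m \<in> space (prob_algebra Upsilon)" and l: "0 < l" and \<theta>: "0 < \<theta>"
    and [measurable]: "u \<in> borel_measurable SeqU" "v \<in> borel_measurable SeqU"
  shows "(\<integral>\<^sup>+\<omega>. u (seqW \<omega>) * v (seqX \<omega>) \<partial>cpp_law l m \<theta>)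
    = (\<integral>\<^sup>+w. u w \<partial>expo_seq l) * (\<integral>\<^sup>+x. v x \<partial>iid_seq m)"
proof -
  interpret R: prob_space "return Upsilon \<theta>" using \<theta> by (intro prob_space_return) simp
  interpret X: prob_space "iid_seq m" by (rule prob_space_iid) fact
  interpret XR: prob_space "iid_seq m \<Otimes>\<^sub>M return Upsilon \<theta>"
    by (intro prob_space_pair prob_space_iid m R.prob_space_axioms)
  have [measurable_cong]: "sets (iid_seq m) = sets SeqU" using m by (rule sets_iid)
  have inner: "(\<integral>\<^sup>+y. u w * v (fst y) \<partial>(iid_seq m \<Otimes>\<^sub>M return Upsilon \<theta>))
     = u w * (\<integral>\<^sup>+x. v x \<partial>iid_seq m)" for w
    by (subst nn_integral_cmult, measurable, subst R.nn_integral_fst[symmetric], measurable)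
      (simp add: nn_integral_const R.emeasure_space_1 del: space_return)
  have "(\<integral>\<^sup>+\<omega>. u (seqW \<omega>) * v (seqX \<omega>) \<partial>cpp_law l m \<theta>)
     = (\<integral>\<^sup>+w. \<integral>\<^sup>+y. u w * v (fst y) \<partial>(iid_seq m \<Otimes>\<^sub>M return Upsilon \<theta>) \<partial>expo_seq l)"
    unfolding cpp_law_def seqW_def seqX_def
    by (subst XR.nn_integral_fst[symmetric]) auto
  with inner show ?thesis by (simp add: inner nn_integral_multc)
qed

lemma AE_cpp_law_rvTheta:
  assumes m: "m \<in> space (prob_algebra Upsilon)" and l: "0 < l" and \<theta>: "0 < \<theta>"
  shows "AE \<omega> in cpp_law l m \<theta>. rvTheta \<omega> = \<theta>"
proof -
  interpret K: prob_space "cpp_law l m \<theta>" by (rule prob_space_cpp_law) fact+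
  interpret X: prob_space "iid_seq m" by (rule prob_space_iid) fact
  interpret W: prob_space "expo_seq l" by (rule prob_space_expo_seq) fact
  have B: "{\<theta>} \<in> sets Upsilon" using \<theta> by (auto simp: sets_Upsilon)
  have "emeasure (cpp_law l m \<theta>) {\<omega>\<in>space Omega. seqW \<omega> \<in> space SeqU \<and> seqX \<omega> \<in> space SeqU \<and> rvTheta \<omega> \<in> {\<theta>}} = 1"
    using W.emeasure_space_1 X.emeasure_space_1 sets_eq_imp_space_eq[OF sets_iid[OF m]]
    by (subst emeasure_cpp_law_rect) (use assms B in \<open>simp_all del: One_nat_def\<close>)
  then have "K.prob {\<omega>\<in>space Omega. seqW \<omega> \<in> space SeqU \<and> seqX \<omega> \<in> space SeqU \<and> rvTheta \<omega> \<in> {\<theta>}} = 1"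
    by (simp add: measure_def)
  from K.AE_prob_1[OF this] show ?thesis by eventually_elim simp
qed

lemma distr_cpp_law_seqW:
  assumes m: "m \<in> space (prob_algebra Upsilon)" and l: "0 < l" and \<theta>: "0 < \<theta>"
  shows "distr (cpp_law l m \<theta>) SeqU seqW = expo_seq l"
proof (rule measure_eqI)
  interpret X: prob_space "iid_seq m" by (rule prob_space_iid) fact
  fix A assume "A \<in> sets (distr (cpp_law l m \<theta>) SeqU seqW)"
  then have A: "A \<in> sets SeqU" by simp
  have mW: "seqW \<in> cpp_law l m \<theta> \<rightarrow>\<^sub>M SeqU" by (simp add: sets_cpp_law[OF m] cong: measurable_cong_sets)
  have "seqW -` A \<inter> space Omega =
     {\<omega>\<in>space Omega. seqW \<omega> \<in> A \<and> seqX \<omega> \<in> space SeqU \<and> rvTheta \<omega> \<in> space Upsilon}"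
    by (auto simp: space_OmegaI)
  then show "emeasure (distr (cpp_law l m \<theta>) SeqU seqW) A = emeasure (expo_seq l) A"
    using emeasure_cpp_law_rect[OF m l \<theta> A sets.top sets.top] X.emeasure_space_1 sets_eq_imp_space_eq[OF sets_iid[OF m]] \<theta>
    by (simp add: emeasure_distr[OF mW A] space_cpp_law[OF m])
qed simp

lemma AE_cpp_law_seqW:
  assumes m: "m \<in> space (prob_algebra Upsilon)" and l: "0 < l" and \<theta>: "0 < \<theta>"
    and AE: "AE w in expo_seq l. P w"
  shows "AE \<omega> in cpp_law l m \<theta>. P (seqW \<omega>)"
proof -
  have mW: "seqW \<in> cpp_law l m \<theta> \<rightarrow>\<^sub>M SeqU" by (simp add: sets_cpp_law[OF m] cong: measurable_cong_sets)
  show ?thesis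
    using AE unfolding distr_cpp_law_seqW[OF m l \<theta>, symmetric] by (rule AE_distrD[OF mW])
qed

section \<open>Measurable dependence on the parameter, and mixtures\<close>

lemma measurable_ExpU: "ExpU \<in> Upsilon \<rightarrow>\<^sub>M prob_algebra Upsilon"
proof (rule measurable_prob_algebraI)
  show "prob_space (ExpU l)" if "l \<in> space Upsilon" for l
    using that by (auto intro: prob_space_ExpU)
  show "ExpU \<in> Upsilon \<rightarrow>\<^sub>M subprob_algebra Upsilon"
  proof (rule measurable_subprob_algebra)
    fix l assume "l \<in> space Upsilon"
    then show "subprob_space (ExpU l)"
      by (auto intro: prob_space_imp_subprob_space prob_space_ExpU)
  next
    fix A assume A: "A \<in> sets Upsilon"
    then have [measurable]: "A \<in> sets borel" by (auto simp: sets_Upsilon)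
    have "emeasure (ExpU l) A = (\<integral>\<^sup>+x. ennreal (exponential_density l x) * (indicator A x * indicator {0<..} x) \<partial>lborel)" for l
      using A by (subst nn_integral_ExpU[symmetric]) auto
    moreover have "(\<lambda>l. \<integral>\<^sup>+x. ennreal (exponential_density l x) * (indicator A x * indicator {0<..} x) \<partial>lborel) \<in> borel_measurable borel"
      unfolding exponential_density_def by measurable
    ultimately have "(\<lambda>l. emeasure (ExpU l) A) \<in> borel_measurable borel" by simp
    then show "(\<lambda>l. emeasure (ExpU l) A) \<in> borel_measurable Upsilon"
      unfolding Upsilon_def by (rule measurable_restrict_space1)
  qed simp
qed

text \<open>For a kernel of probability measures, measurability needs checking only on an
  intersection-stable generator. On a cylinder the mass is a finite product of one-dimensional
  masses, each measurable in the rate.\<close>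

lemma measurable_expo_seq: "expo_seq \<in> Upsilon \<rightarrow>\<^sub>M prob_algebra SeqU"
proof (rule measurable_prob_algebra_generated)
  let ?M = "\<lambda>n::nat. Upsilon"
  show "sets SeqU = sigma_sets (\<Pi>\<^sub>E i\<in>{1..}. space Upsilon) (prod_algebra {1..} ?M)"
    unfolding SeqU_def by (rule sets_PiM)
  show "Int_stable (prod_algebra {1..} ?M)" by (rule Int_stable_prod_algebra)
  show "prod_algebra {1..} ?M \<subseteq> Pow (\<Pi>\<^sub>E i\<in>{1..}. space Upsilon)" by (rule prod_algebra_sets_into_space)
  show "prob_space (expo_seq l)" if "l \<in> space Upsilon" for l using that by (auto intro: prob_space_expo_seq)
  show "sets (expo_seq l) = sets SeqU" for l by simp
  fix A assume "A \<in> prod_algebra {1..} ?M"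
  then obtain J E where A: "A = prod_emb {1..} ?M J (\<Pi>\<^sub>E j\<in>J. E j)"
      and J: "finite J" "J \<subseteq> {1..}" and E: "E \<in> (\<Pi> i\<in>J. sets Upsilon)"
    by (rule prod_algebraE) (auto simp del: One_nat_def)
  have "emeasure (expo_seq l) A = (\<Prod>j\<in>J. emeasure (ExpU l) (E j))" if "l \<in> space Upsilon" for l
  proof -
    have "A = prod_emb {1..} (\<lambda>_. ExpU l) J (\<Pi>\<^sub>E j\<in>J. E j)"
      by (simp add: A prod_emb_def)
    then show ?thesis
      using that J E unfolding expo_seq_def
      by (simp add: emeasure_PiM_emb[OF prob_space_ExpU] Pi_iff del: One_nat_def)
  qed
  moreover have "(\<lambda>l. \<Prod>j\<in>J. emeasure (ExpU l) (E j)) \<in> borel_measurable Upsilon"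
  proof (rule borel_measurable_prod_ennreal)
    fix j assume "j \<in> J"
    then have "E j \<in> sets Upsilon" using E by auto
    then show "(\<lambda>l. emeasure (ExpU l) (E j)) \<in> borel_measurable Upsilon"
      by (rule measurable_emeasure_kernel[OF measurable_prob_algebraD[OF measurable_ExpU]])
  qed
  ultimately show "(\<lambda>l. emeasure (expo_seq l) A) \<in> borel_measurable Upsilon"
    by (subst measurable_cong) auto
qed

lemma M_plusD: "g \<in> M_plus \<Longrightarrow> 0 < \<theta> \<Longrightarrow> 0 < g \<theta>"
  and M_plus_measurable: "g \<in> M_plus \<Longrightarrow> g \<in> Upsilon \<rightarrow>\<^sub>M Upsilon"
  by (auto simp: M_plus_def intro: measurable_UpsilonI)

lemma id_M_plus: "(\<lambda>\<theta>. \<theta>) \<in> M_plus"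
  by (auto simp: M_plus_def intro: measurable_Upsilon_borel)

lemma measurable_cpp_law:
  assumes g: "g \<in> M_plus" and m: "m \<in> space (prob_algebra Upsilon)"
  shows "(\<lambda>\<theta>. cpp_law (g \<theta>) m \<theta>) \<in> Upsilon \<rightarrow>\<^sub>M prob_algebra Omega"
  unfolding cpp_law_def Omega_def
  by (intro measurable_pair_prob measurable_compose[OF M_plus_measurable[OF g] measurable_expo_seq]
      measurable_const iid_in_prob_algebra m measurable_return_prob_space)

lemma cmpp_law_in_prob_algebra:
  assumes "g \<in> M_plus" "m \<in> space (prob_algebra Upsilon)" "r \<in> space (prob_algebra Upsilon)"
  shows "cmpp_law g m r \<in> space (prob_algebra Omega)"
  using prob_space_bind'[OF assms(3) measurable_cpp_law[OF assms(1,2)]]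
    sets_bind'[OF assms(3) measurable_cpp_law[OF assms(1,2)]]
  by (simp add: space_prob_algebra cmpp_law_def)

lemma nn_integral_cmpp_law:
  assumes "g \<in> M_plus" "m \<in> space (prob_algebra Upsilon)" "r \<in> space (prob_algebra Upsilon)"
    and "f \<in> borel_measurable Omega"
  shows "(\<integral>\<^sup>+\<omega>. f \<omega> \<partial>cmpp_law g m r) = (\<integral>\<^sup>+\<theta>. \<integral>\<^sup>+\<omega>. f \<omega> \<partial>cpp_law (g \<theta>) m \<theta> \<partial>r)"
  unfolding cmpp_law_def
  by (rule nn_integral_bind[OF assms(4)])
    (use prob_algebraD(2)[OF assms(3)] measurable_prob_algebraD[OF measurable_cpp_law[OF assms(1,2)]] in
      \<open>simp cong: measurable_cong_sets\<close>)

lemma emeasure_cmpp_law: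
  assumes "g \<in> M_plus" "m \<in> space (prob_algebra Upsilon)" "r \<in> space (prob_algebra Upsilon)"
    and "D \<in> sets Omega"
  shows "emeasure (cmpp_law g m r) D = (\<integral>\<^sup>+\<theta>. emeasure (cpp_law (g \<theta>) m \<theta>) D \<partial>r)"
  unfolding cmpp_law_def
  using emeasure_bind_prob_algebra[OF assms(3) measurable_cpp_law[OF assms(1,2)] assms(4)] .

text \<open>Under the component with parameter \<theta> one has \<Theta> = \<theta> almost surely,
  so factors depending on \<Theta> leave the inner integral. Indicators of \<Theta> give the
  conditional probabilities, and the factor \<xi>(\<Theta>) gives the density of the
  mixture.\<close>

lemma nn_integral_cmpp_law_Theta:
  assumes g: "g \<in> M_plus" and m: "m \<in> space (prob_algebra Upsilon)" and r: "r \<in> space (prob_algebra Upsilon)"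
    and f[measurable]: "f \<in> borel_measurable Omega" and h[measurable]: "h \<in> borel_measurable Upsilon"
  shows "(\<integral>\<^sup>+\<omega>. h (rvTheta \<omega>) * f \<omega> \<partial>cmpp_law g m r)
    = (\<integral>\<^sup>+\<theta>. h \<theta> * (\<integral>\<^sup>+\<omega>. f \<omega> \<partial>cpp_law (g \<theta>) m \<theta>) \<partial>r)"
proof (subst nn_integral_cmpp_law[OF g m r], measurable, rule nn_integral_cong)
  fix \<theta> assume "\<theta> \<in> space r"
  then have \<theta>: "0 < \<theta>" using prob_algebraD[OF r] by simp
  have f': "f \<in> borel_measurable (cpp_law (g \<theta>) m \<theta>)"
    using f sets_cpp_law[OF m] by (simp cong: measurable_cong_sets)
  have "(\<integral>\<^sup>+\<omega>. h (rvTheta \<omega>) * f \<omega> \<partial>cpp_law (g \<theta>) m \<theta>) = (\<integral>\<^sup>+\<omega>. h \<theta> * f \<omega> \<partial>cpp_law (g \<theta>) m \<theta>)"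
    by (rule nn_integral_cong_AE, rule AE_mp[OF AE_cpp_law_rvTheta[OF m M_plusD[OF g \<theta>] \<theta>]]) simp
  then show "(\<integral>\<^sup>+\<omega>. h (rvTheta \<omega>) * f \<omega> \<partial>cpp_law (g \<theta>) m \<theta>)
      = h \<theta> * (\<integral>\<^sup>+\<omega>. f \<omega> \<partial>cpp_law (g \<theta>) m \<theta>)"
    using f' by (simp add: nn_integral_cmult)
qed

lemma emeasure_cmpp_law_Theta:
  assumes g: "g \<in> M_plus" and m: "m \<in> space (prob_algebra Upsilon)" and r: "r \<in> space (prob_algebra Upsilon)"
    and D: "D \<in> sets Omega" and B: "B \<in> sets Upsilon"
  shows "emeasure (cmpp_law g m r) {\<omega>\<in>D. rvTheta \<omega> \<in> B}
    = (\<integral>\<^sup>+\<theta>. indicator B \<theta> * emeasure (cpp_law (g \<theta>) m \<theta>) D \<partial>r)"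
proof -
  note R = prob_algebraD[OF cmpp_law_in_prob_algebra[OF g m r]]
  have [measurable]: "D \<in> sets Omega" "B \<in> sets Upsilon" by fact+
  have eq: "{\<omega>\<in>D. rvTheta \<omega> \<in> B} = D \<inter> (rvTheta -` B \<inter> space Omega)"
    using sets.sets_into_space[OF D] by auto
  have "{\<omega>\<in>D. rvTheta \<omega> \<in> B} \<in> sets Omega"
    unfolding eq by measurable
  then have "emeasure (cmpp_law g m r) {\<omega>\<in>D. rvTheta \<omega> \<in> B}
    = (\<integral>\<^sup>+\<omega>. indicator {\<omega>\<in>D. rvTheta \<omega> \<in> B} \<omega> \<partial>cmpp_law g m r)"
    using R by simp
  also have "\<dots> = (\<integral>\<^sup>+\<omega>. indicator B (rvTheta \<omega>) * indicator D \<omega> \<partial>cmpp_law g m r)"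
    by (rule nn_integral_cong) (auto simp: indicator_def)
  also have "\<dots> = (\<integral>\<^sup>+\<theta>. indicator B \<theta> * emeasure (cpp_law (g \<theta>) m \<theta>) D \<partial>r)"
    by (subst nn_integral_cmpp_law_Theta[OF g m r]) (use D sets_cpp_law[OF m] in auto)
  finally show ?thesis .
qed

text \<open>A single component is itself a mixture, with a constant rate function over a point mass.
  Structural properties of mixtures thereby transfer to each fixed \<theta>.\<close>

lemma cmpp_law_return:
  assumes "0 < l" "0 < \<theta>" and m: "m \<in> space (prob_algebra Upsilon)"
  shows "cmpp_law (\<lambda>_. l) m (return Upsilon \<theta>) = cpp_law l m \<theta>"
proof -
  have "(\<lambda>_. l) \<in> M_plus" using assms by (simp add: M_plus_def)
  from measurable_prob_algebraD[OF measurable_cpp_law[OF this m]] show ?thesis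
    unfolding cmpp_law_def using assms by (intro bind_return) auto
qed

lemma lawTheta_in_prob_algebra:
  assumes "R \<in> space (prob_algebra Omega)" shows "lawTheta R \<in> space (prob_algebra Upsilon)"
proof -
  note R = prob_algebraD[OF assms]
  interpret R: prob_space R by (rule R)
  have "rvTheta \<in> R \<rightarrow>\<^sub>M Upsilon" using R by (simp cong: measurable_cong_sets)
  then show ?thesis by (simp add: lawTheta_def space_prob_algebra R.prob_space_distr)
qed

lemma lawX1_in_prob_algebra:
  assumes "R \<in> space (prob_algebra Omega)" shows "lawX1 R \<in> space (prob_algebra Upsilon)"
proof -
  note R = prob_algebraD[OF assms]
  interpret R: prob_space R by (rule R)
  have "rvX 1 \<in> R \<rightarrow>\<^sub>M Upsilon" using R measurable_rvX[of 1] by (simp cong: measurable_cong_sets)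
  then show ?thesis by (simp add: lawX1_def space_prob_algebra R.prob_space_distr)
qed

lemma emeasure_lawTheta:
  assumes "R \<in> space (prob_algebra Omega)" "B \<in> sets Upsilon"
  shows "emeasure (lawTheta R) B = emeasure R {\<omega>\<in>space Omega. rvTheta \<omega> \<in> B}"
proof -
  note R = prob_algebraD[OF assms(1)]
  have "rvTheta \<in> R \<rightarrow>\<^sub>M Upsilon" using R by (simp cong: measurable_cong_sets)
  then show ?thesis using assms(2) R by (auto simp: lawTheta_def emeasure_distr intro!: arg_cong2[of _ _ _ _ emeasure])
qed

lemma lawTheta_cmpp_law:
  assumes g: "g \<in> M_plus" and m: "m \<in> space (prob_algebra Upsilon)" and r: "r \<in> space (prob_algebra Upsilon)"
  shows "lawTheta (cmpp_law g m r) = r"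
proof (rule measure_eqI)
  show "sets (lawTheta (cmpp_law g m r)) = sets r" using prob_algebraD[OF r] by (simp add: lawTheta_def)
  fix B assume "B \<in> sets (lawTheta (cmpp_law g m r))"
  then have B: "B \<in> sets Upsilon" by (simp add: lawTheta_def)
  have "emeasure (cpp_law (g \<theta>) m \<theta>) (space Omega) = 1" if "\<theta> \<in> space r" for \<theta>
    using that prob_algebraD[OF r] M_plusD[OF g] prob_space.emeasure_space_1[OF prob_space_cpp_law[OF m], of "g \<theta>" \<theta>]
    by (simp add: space_cpp_law[OF m])
  then have "emeasure (lawTheta (cmpp_law g m r)) B = (\<integral>\<^sup>+\<theta>. indicator B \<theta> \<partial>r)"
    using B emeasure_cmpp_law_Theta[OF g m r sets.top B]
    by (simp add: emeasure_lawTheta[OF cmpp_law_in_prob_algebra[OF g m r]] cong: nn_integral_cong)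
  then show "emeasure (lawTheta (cmpp_law g m r)) B = emeasure r B"
    using B prob_algebraD[OF r] by simp
qed

section \<open>Conditional probabilities given \<Theta>\<close>

lemma space_sigmaTheta [simp]: "space sigmaTheta = space Omega"
  by (simp add: sigmaTheta_def)

lemma sets_sigmaTheta: "sets sigmaTheta = {rvTheta -` B \<inter> space Omega |B. B \<in> sets Upsilon}"
  unfolding sigmaTheta_def
  using measurable_space[OF measurable_rvTheta] by (intro sets_vimage_algebra2) auto

lemma subalgebra_sigmaTheta:
  assumes "R \<in> space (prob_algebra Omega)" shows "subalgebra R sigmaTheta"
  using prob_algebraD[OF assms] measurable_sets[OF measurable_rvTheta]
  by (auto simp: subalgebra_def sets_sigmaTheta)

lemma measurable_rvTheta_sigmaTheta: "rvTheta \<in> sigmaTheta \<rightarrow>\<^sub>M Upsilon"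
  unfolding sigmaTheta_def
  using measurable_space[OF measurable_rvTheta] by (intro measurable_vimage_algebra1) auto

context
  fixes R :: "outcome measure"
  assumes R: "R \<in> space (prob_algebra Omega)"
begin

interpretation R: prob_space R by (rule prob_algebraD[OF R])

interpretation finite_measure_subalgebra R sigmaTheta
  by unfold_locales (rule subalgebra_sigmaTheta[OF R])

lemma cpTheta_nonneg: "D \<in> sets Omega \<Longrightarrow> AE \<omega> in R. 0 \<le> cpTheta R D \<omega>"
  unfolding cpTheta_def using prob_algebraD[OF R] by (intro real_cond_exp_pos) auto

lemma measurable_cpTheta: "cpTheta R D \<in> borel_measurable R"
  unfolding cpTheta_def by simp

lemma cpTheta_nn_integral:
  assumes D: "D \<in> sets Omega" and B: "B \<in> sets Upsilon"
  shows "emeasure R {\<omega>\<in>D. rvTheta \<omega> \<in> B}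
    = (\<integral>\<^sup>+\<omega>. indicator B (rvTheta \<omega>) * ennreal (cpTheta R D \<omega>) \<partial>R)"
proof -
  let ?A = "rvTheta -` B \<inter> space Omega"
  have A: "?A \<in> sets sigmaTheta" using B by (auto simp: sets_sigmaTheta)
  have AR: "?A \<in> sets R" using measurable_sets[OF measurable_rvTheta B] prob_algebraD[OF R] by simp
  have DR: "D \<in> sets R" using D prob_algebraD[OF R] by simp
  have int: "integrable R (indicator D :: outcome \<Rightarrow> real)"
    using DR by (intro integrable_real_indicator) (simp_all add: less_top[symmetric])
  have intc: "integrable R (\<lambda>\<omega>. indicator ?A \<omega> * cpTheta R D \<omega>)"
    using integrable_mult_indicator[OF AR real_cond_exp_int(1)[OF int]] by (simp add: cpTheta_def)
  have "measure R (D \<inter> ?A) = (\<integral>\<omega>\<in>?A. indicator D \<omega> \<partial>R)"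
    using DR AR by (simp add: set_lebesgue_integral_def indicator_inter_arith[symmetric] Int_commute)
  also have "\<dots> = (\<integral>\<omega>. indicator ?A \<omega> * cpTheta R D \<omega> \<partial>R)"
    using real_cond_exp_intA[OF int A] by (simp add: set_lebesgue_integral_def cpTheta_def)
  finally have "emeasure R (D \<inter> ?A) = ennreal (\<integral>\<omega>. indicator ?A \<omega> * cpTheta R D \<omega> \<partial>R)"
    by (simp add: R.emeasure_eq_measure)
  also have "\<dots> = (\<integral>\<^sup>+\<omega>. ennreal (indicator ?A \<omega> * cpTheta R D \<omega>) \<partial>R)"
    by (rule nn_integral_eq_integral[symmetric, OF intc])
      (use cpTheta_nonneg[OF D] in \<open>auto simp: indicator_def\<close>)
  also have "\<dots> = (\<integral>\<^sup>+\<omega>. indicator B (rvTheta \<omega>) * ennreal (cpTheta R D \<omega>) \<partial>R)"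
    using prob_algebraD[OF R] by (intro nn_integral_cong) (auto simp: indicator_def)
  also have "D \<inter> ?A = {\<omega>\<in>D. rvTheta \<omega> \<in> B}" using sets.sets_into_space[OF D] by auto
  finally show ?thesis .
qed

text \<open>A function of \<Theta> with the right integrals over all events of \<Theta> is a version
  of the conditional probability. Integrals are stated as nonnegative ones, so that integrability of
  the candidate is a conclusion instead of a premise.\<close>

lemma cpTheta_eqI:
  assumes D: "D \<in> sets Omega" and h[measurable]: "h \<in> borel_measurable Upsilon" and h0: "\<And>\<theta>. 0 < \<theta> \<Longrightarrow> 0 \<le> h \<theta>"
    and eq: "\<And>B. B \<in> sets Upsilon \<Longrightarrow> emeasure R {\<omega>\<in>D. rvTheta \<omega> \<in> B}
      = (\<integral>\<^sup>+\<omega>. indicator B (rvTheta \<omega>) * ennreal (h (rvTheta \<omega>)) \<partial>R)"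
  shows "AE \<omega> in R. cpTheta R D \<omega> = h (rvTheta \<omega>)"
  unfolding cpTheta_def
proof (rule real_cond_exp_charact)
  note RO = prob_algebraD[OF R]
  have DR: "D \<in> sets R" using D RO by simp
  have [measurable_cong]: "sets R = sets Omega" by (rule RO)
  show "integrable R (indicator D :: outcome \<Rightarrow> real)"
    using DR by (intro integrable_real_indicator) (simp_all add: less_top[symmetric])
  have pos: "AE \<omega> in R. 0 \<le> h (rvTheta \<omega>)"
    using RO h0 by (intro AE_I2) (simp add: space_OmegaI)
  \<comment> \<open>Taking for \<open>B\<close> the whole half-line bounds the integral of the
    candidate by a probability, which yields its integrability.\<close>
  have "(\<integral>\<^sup>+\<omega>. ennreal (h (rvTheta \<omega>)) \<partial>R) = emeasure R {\<omega>\<in>D. rvTheta \<omega> \<in> {0<..}}"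
    using RO by (subst eq) (auto intro!: nn_integral_cong simp: space_OmegaI sets_Upsilon)
  also have "\<dots> \<le> 1" by (rule R.emeasure_le_1)
  finally have fin: "(\<integral>\<^sup>+\<omega>. ennreal (h (rvTheta \<omega>)) \<partial>R) < \<infinity>"
    by (rule le_less_trans) simp
  show hint: "integrable R (\<lambda>\<omega>. h (rvTheta \<omega>))"
    using pos fin by (intro integrableI_nonneg) auto
  show "(\<lambda>\<omega>. h (rvTheta \<omega>)) \<in> borel_measurable sigmaTheta"
    by (rule measurable_compose[OF measurable_rvTheta_sigmaTheta h])
  fix A assume "A \<in> sets sigmaTheta"
  then obtain B where A: "A = rvTheta -` B \<inter> space Omega" and B: "B \<in> sets Upsilon"
    by (auto simp: sets_sigmaTheta)
  have AR: "A \<in> sets R" using measurable_sets[OF measurable_rvTheta B] RO A by simp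
  have "ennreal (\<integral>\<omega>\<in>A. h (rvTheta \<omega>) \<partial>R) = (\<integral>\<^sup>+\<omega>. ennreal (indicator A \<omega> * h (rvTheta \<omega>)) \<partial>R)"
    unfolding set_lebesgue_integral_def
    using integrable_mult_indicator[OF AR hint] pos
    by (subst nn_integral_eq_integral) (auto simp: indicator_def)
  also have "\<dots> = (\<integral>\<^sup>+\<omega>. indicator B (rvTheta \<omega>) * ennreal (h (rvTheta \<omega>)) \<partial>R)"
    using RO A by (intro nn_integral_cong) (auto simp: indicator_def)
  also have "\<dots> = emeasure R {\<omega>\<in>D. rvTheta \<omega> \<in> B}" using eq[OF B] by simp
  also have "{\<omega>\<in>D. rvTheta \<omega> \<in> B} = D \<inter> A" using sets.sets_into_space[OF D] A by auto
  finally have *: "ennreal (\<integral>\<omega>\<in>A. h (rvTheta \<omega>) \<partial>R) = ennreal (measure R (D \<inter> A))"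
    by (simp add: R.emeasure_eq_measure)
  have "0 \<le> (\<integral>\<omega>\<in>A. h (rvTheta \<omega>) \<partial>R)"
    unfolding set_lebesgue_integral_def using pos by (intro integral_nonneg_AE) (auto simp: indicator_def)
  with * have "(\<integral>\<omega>\<in>A. h (rvTheta \<omega>) \<partial>R) = measure R (D \<inter> A)" by simp
  then show "(\<integral>\<omega>\<in>A. indicator D \<omega> \<partial>R) = (\<integral>\<omega>\<in>A. h (rvTheta \<omega>) \<partial>R)"
    using DR AR by (simp add: set_lebesgue_integral_def indicator_inter_arith[symmetric] Int_commute)
qed

lemma nn_integral_rvTheta:
  "f \<in> borel_measurable Upsilon \<Longrightarrow> (\<integral>\<^sup>+\<omega>. f (rvTheta \<omega>) \<partial>R) = (\<integral>\<^sup>+\<theta>. f \<theta> \<partial>lawTheta R)"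
  using prob_algebraD[OF R] unfolding lawTheta_def
  by (subst nn_integral_distr) (auto cong: measurable_cong_sets)

end

text \<open>The components of the mixture are its conditional laws given \<Theta>. Conditional
  independence, stationarity and the conditional Poisson law of a mixture thereby become
  unconditional statements about each component.\<close>

lemma cpTheta_cmpp_law:
  assumes g: "g \<in> M_plus" and m: "m \<in> space (prob_algebra Upsilon)" and r: "r \<in> space (prob_algebra Upsilon)"
    and D: "D \<in> sets Omega"
  shows "AE \<omega> in cmpp_law g m r. cpTheta (cmpp_law g m r) D \<omega> = measure (cpp_law (g (rvTheta \<omega>)) m (rvTheta \<omega>)) D"
proof (rule cpTheta_eqI[OF cmpp_law_in_prob_algebra[OF g m r] D])
  show hm[measurable]: "(\<lambda>\<theta>. measure (cpp_law (g \<theta>) m \<theta>) D) \<in> borel_measurable Upsilon"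
    by (rule measurable_compose[OF measurable_cpp_law[OF g m] measurable_measure_prob_algebra[OF D]])
  fix B assume B[measurable]: "B \<in> sets Upsilon"
  have "emeasure (cmpp_law g m r) {\<omega>\<in>D. rvTheta \<omega> \<in> B}
     = (\<integral>\<^sup>+\<theta>. indicator B \<theta> * ennreal (measure (cpp_law (g \<theta>) m \<theta>) D) \<partial>r)"
    unfolding emeasure_cmpp_law_Theta[OF g m r D B]
  proof (rule nn_integral_cong)
    fix \<theta> assume "\<theta> \<in> space r"
    then have "0 < \<theta>" using prob_algebraD[OF r] by simp
    then interpret K: prob_space "cpp_law (g \<theta>) m \<theta>" by (intro prob_space_cpp_law[OF m M_plusD[OF g]])
    show "indicator B \<theta> * emeasure (cpp_law (g \<theta>) m \<theta>) D = indicator B \<theta> * ennreal (measure (cpp_law (g \<theta>) m \<theta>) D)"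
      by (simp add: K.emeasure_eq_measure)
  qed
  also have "\<dots> = (\<integral>\<^sup>+\<omega>. indicator B (rvTheta \<omega>) * ennreal (measure (cpp_law (g (rvTheta \<omega>)) m (rvTheta \<omega>)) D) \<partial>cmpp_law g m r)"
    using nn_integral_rvTheta[OF cmpp_law_in_prob_algebra[OF g m r], of "\<lambda>\<theta>. indicator B \<theta> * ennreal (measure (cpp_law (g \<theta>) m \<theta>) D)"]
    by (simp add: lawTheta_cmpp_law[OF g m r])
  finally show "emeasure (cmpp_law g m r) {\<omega>\<in>D. rvTheta \<omega> \<in> B}
     = (\<integral>\<^sup>+\<omega>. indicator B (rvTheta \<omega>) * ennreal (measure (cpp_law (g (rvTheta \<omega>)) m (rvTheta \<omega>)) D) \<partial>cmpp_law g m r)" .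
qed simp

lemma AE_cmpp_law:
  assumes g: "g \<in> M_plus" and m: "m \<in> space (prob_algebra Upsilon)" and r: "r \<in> space (prob_algebra Upsilon)"
    and P: "Measurable.pred Omega P" and AE: "\<And>\<theta>. 0 < \<theta> \<Longrightarrow> AE \<omega> in cpp_law (g \<theta>) m \<theta>. P \<omega>"
  shows "AE \<omega> in cmpp_law g m r. P \<omega>"
proof -
  note R = prob_algebraD[OF cmpp_law_in_prob_algebra[OF g m r]]
  have D: "{\<omega>\<in>space Omega. \<not> P \<omega>} \<in> sets Omega" using P by measurable
  have "emeasure (cmpp_law g m r) {\<omega>\<in>space Omega. \<not> P \<omega>} = (\<integral>\<^sup>+\<theta>. 0 \<partial>r)"
    unfolding emeasure_cmpp_law[OF g m r D]
  proof (rule nn_integral_cong)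
    fix \<theta> assume "\<theta> \<in> space r"
    then have "0 < \<theta>" using prob_algebraD[OF r] by simp
    from AE[OF this] show "emeasure (cpp_law (g \<theta>) m \<theta>) {\<omega>\<in>space Omega. \<not> P \<omega>} = 0"
      using D by (subst (asm) AE_iff_measurable[OF _ refl]) (auto simp: sets_cpp_law[OF m] space_cpp_law[OF m])
  qed
  then show ?thesis
    using D R by (subst AE_iff_measurable[OF _ refl]) auto
qed

lemma emeasure_cmpp_law_rect:
  assumes g: "g \<in> M_plus" and m: "m \<in> space (prob_algebra Upsilon)" and r: "r \<in> space (prob_algebra Upsilon)"
    and A: "A \<in> sets SeqU" and C: "C \<in> sets SeqU" and B: "B \<in> sets Upsilon"
  shows "emeasure (cmpp_law g m r) {\<omega>\<in>space Omega. seqW \<omega> \<in> A \<and> seqX \<omega> \<in> C \<and> rvTheta \<omega> \<in> B}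
    = (\<integral>\<^sup>+\<theta>. emeasure (expo_seq (g \<theta>)) A * indicator B \<theta> \<partial>r) * emeasure (iid_seq m) C"
proof -
  have D: "{\<omega>\<in>space Omega. seqW \<omega> \<in> A \<and> seqX \<omega> \<in> C \<and> rvTheta \<omega> \<in> B} \<in> sets Omega"
    using A B C by measurable
  have A': "(\<lambda>\<theta>. emeasure (expo_seq (g \<theta>)) A) \<in> borel_measurable Upsilon"
    by (rule measurable_compose[OF M_plus_measurable[OF g]
          measurable_emeasure_kernel[OF measurable_prob_algebraD[OF measurable_expo_seq] A]])
  have "emeasure (cmpp_law g m r) {\<omega>\<in>space Omega. seqW \<omega> \<in> A \<and> seqX \<omega> \<in> C \<and> rvTheta \<omega> \<in> B}
    = (\<integral>\<^sup>+\<theta>. (emeasure (expo_seq (g \<theta>)) A * indicator B \<theta>) * emeasure (iid_seq m) C \<partial>r)"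
    unfolding emeasure_cmpp_law[OF g m r D]
  proof (rule nn_integral_cong)
    fix \<theta> assume "\<theta> \<in> space r"
    then have "0 < \<theta>" using prob_algebraD[OF r] by simp
    then show "emeasure (cpp_law (g \<theta>) m \<theta>) {\<omega>\<in>space Omega. seqW \<omega> \<in> A \<and> seqX \<omega> \<in> C \<and> rvTheta \<omega> \<in> B}
       = (emeasure (expo_seq (g \<theta>)) A * indicator B \<theta>) * emeasure (iid_seq m) C"
      using A B C by (subst emeasure_cpp_law_rect[OF m M_plusD[OF g]]) (auto simp: ac_simps)
  qed
  also have "\<dots> = (\<integral>\<^sup>+\<theta>. emeasure (expo_seq (g \<theta>)) A * indicator B \<theta> \<partial>r) * emeasure (iid_seq m) C"
    using A' B prob_algebraD(2)[OF r]
    by (intro nn_integral_multc borel_measurable_times_ennreal borel_measurable_indicator)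
      (auto cong: measurable_cong_sets)
  finally show ?thesis .
qed

section \<open>Path properties and independence under the mixture\<close>

lemma counting_paths:
  assumes w: "w \<in> space SeqU" "nonexploding w"
  shows "num_arrivals 0 w = 0" "\<forall>s t. 0 \<le> s \<and> s \<le> t \<longrightarrow> num_arrivals s w \<le> num_arrivals t w"
    "\<forall>t\<ge>0. continuous (at_right t) (\<lambda>u. real (num_arrivals u w))"
    "\<forall>t>0. \<exists>s. 0 \<le> s \<and> s < t \<and> num_arrivals t w \<le> num_arrivals s w + 1"
proof -
  show "num_arrivals 0 w = 0" "\<forall>s t. 0 \<le> s \<and> s \<le> t \<longrightarrow> num_arrivals s w \<le> num_arrivals t w"
    using num_arrivals_0[OF w(1)] num_arrivals_mono[OF w(1) nonexplodingD[OF w(2)]] by auto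
  show "\<forall>t\<ge>0. continuous (at_right t) (\<lambda>u. real (num_arrivals u w))"
  proof (intro allI impI)
    fix t :: real assume t: "0 \<le> t"
    \<comment> \<open>The path is constant until the next arrival, which lies strictly after
      \<open>t\<close>.\<close>
    have "\<forall>\<^sub>F u in at_right t. real (num_arrivals u w) = real (num_arrivals t w)"
      unfolding eventually_at_right_field
    proof (intro exI conjI allI impI)
      show "t < arrival w (Suc (num_arrivals t w))" using arrival_num_arrivals_bounds[OF w(1) nonexplodingD[OF w(2)] t] by simp
      fix u assume "t < u" "u < arrival w (Suc (num_arrivals t w))"
      then show "real (num_arrivals u w) = real (num_arrivals t w)"
        using arrival_num_arrivals_bounds[OF w(1) nonexplodingD[OF w(2)] t] by (intro arg_cong[of _ _ real] num_arrivals_unique[OF w(1)]) auto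
    qed
    then show "continuous (at_right t) (\<lambda>u. real (num_arrivals u w))"
      unfolding continuous_within by (rule tendsto_eventually)
  qed
  show "\<forall>t>0. \<exists>s. 0 \<le> s \<and> s < t \<and> num_arrivals t w \<le> num_arrivals s w + 1"
  proof (intro allI impI)
    fix t :: real assume t: "0 < t"
    define n where "n = num_arrivals t w"
    have n: "arrival w n \<le> t" using arrival_num_arrivals_bounds[OF w(1) nonexplodingD[OF w(2)], of t] t by (simp add: n_def)
    \<comment> \<open>The witness for the jump condition is the arrival before the last one up to
      \<open>t\<close>: it lies before \<open>t\<close>, and at that time at least
      \<open>n - 1\<close> arrivals have been counted. For \<open>n = 0\<close> truncated
      subtraction makes it the time 0.\<close>
    have "arrival w (n - 1) < t"
    proof (cases n)
      case (Suc k)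
      then have "arrival w k < arrival w n" using strict_mono_less[OF strict_mono_arrival[OF w(1)]] by blast
      then show ?thesis using Suc n by simp
    qed (use t in simp)
    moreover have "0 \<le> arrival w (n - 1)" by (rule arrival_nonneg[OF w(1)])
    moreover from this have "n - 1 \<le> num_arrivals (arrival w (n - 1)) w" by (subst le_num_arrivals_iff[OF w(1) nonexplodingD[OF w(2)]]) auto
    ultimately show "\<exists>s. 0 \<le> s \<and> s < t \<and> num_arrivals t w \<le> num_arrivals s w + 1"
      unfolding n_def[symmetric] by (intro exI[of _ "arrival w (n - 1)"]) auto
  qed
qed

lemma measurable_num_arrivals_path: "(\<lambda>w. \<lambda>t\<in>{0..}. num_arrivals t w) \<in> SeqU \<rightarrow>\<^sub>M (\<Pi>\<^sub>M t\<in>{0..}. count_space UNIV)"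
  by (intro measurable_restrict measurable_num_arrivals) auto

lemma distr_cmpp_law_seqX:
  assumes g: "g \<in> M_plus" and m: "m \<in> space (prob_algebra Upsilon)" and r: "r \<in> space (prob_algebra Upsilon)"
  shows "distr (cmpp_law g m r) SeqU seqX = iid_seq m"
proof (rule measure_eqI)
  note R = prob_algebraD[OF cmpp_law_in_prob_algebra[OF g m r]]
  interpret r: prob_space r by (rule prob_algebraD[OF r])
  show "sets (distr (cmpp_law g m r) SeqU seqX) = sets (iid_seq m)" by (simp add: sets_iid[OF m])
  fix C assume "C \<in> sets (distr (cmpp_law g m r) SeqU seqX)"
  then have C: "C \<in> sets SeqU" by simp
  have mX: "seqX \<in> cmpp_law g m r \<rightarrow>\<^sub>M SeqU" using R by (simp cong: measurable_cong_sets)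
  have "seqX -` C \<inter> space Omega =
     {\<omega>\<in>space Omega. seqW \<omega> \<in> space SeqU \<and> seqX \<omega> \<in> C \<and> rvTheta \<omega> \<in> space Upsilon}"
    by (auto simp: space_OmegaI)
  moreover have "(\<integral>\<^sup>+\<theta>. emeasure (expo_seq (g \<theta>)) (space SeqU) * indicator (space Upsilon) \<theta> \<partial>r) = (\<integral>\<^sup>+\<theta>. 1 \<partial>r)"
  proof (rule nn_integral_cong)
    fix \<theta> assume "\<theta> \<in> space r"
    then have \<theta>: "0 < \<theta>" using prob_algebraD[OF r] by simp
    interpret E: prob_space "expo_seq (g \<theta>)" by (rule prob_space_expo_seq[OF M_plusD[OF g \<theta>]])
    show "emeasure (expo_seq (g \<theta>)) (space SeqU) * indicator (space Upsilon) \<theta> = 1"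
      using E.emeasure_space_1 \<theta> by simp
  qed
  ultimately show "emeasure (distr (cmpp_law g m r) SeqU seqX) C = emeasure (iid_seq m) C"
    using emeasure_cmpp_law_rect[OF g m r sets.top C sets.top] r.emeasure_space_1
    by (simp add: emeasure_distr[OF mX C] R)
qed

lemma distr_iid_component:
  assumes m: "m \<in> space (prob_algebra Upsilon)" and n: "1 \<le> n"
  shows "distr (iid_seq m) Upsilon (\<lambda>x. x n) = m"
proof -
  interpret P: product_prob_space "\<lambda>_::nat. m" "{1..}"
    using prob_algebraD[OF m] by (intro product_prob_spaceI) auto
  have "distr (iid_seq m) Upsilon (\<lambda>x. x n) = distr (iid_seq m) m (\<lambda>x. x n)"
    using prob_algebraD[OF m] by (intro distr_cong) auto
  also have "\<dots> = m" unfolding iid_seq_def using n by (intro P.PiM_component) auto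
  finally show ?thesis .
qed

lemma seqX_eq_restrict: "\<omega> \<in> space Omega \<Longrightarrow> (\<lambda>n\<in>{1..}. rvX n \<omega>) = seqX \<omega>"
  by (auto simp: space_OmegaI space_SeqU rvX_def PiE_def extensional_restrict)

lemma risk_process_iidI:
  assumes R: "R \<in> space (prob_algebra Omega)" and m: "m \<in> space (prob_algebra Upsilon)"
    and X: "distr R SeqU seqX = iid_seq m"
  shows "prob_space.indep_vars R (\<lambda>_. Upsilon) rvX {1..}" "\<And>n. 1 \<le> n \<Longrightarrow> distr R Upsilon (rvX n) = m"
proof -
  note RO = prob_algebraD[OF R]
  interpret R: prob_space R by (rule RO)
  have mX: "seqX \<in> R \<rightarrow>\<^sub>M SeqU" using RO by (simp cong: measurable_cong_sets)
  have Xn: "rvX n \<in> R \<rightarrow>\<^sub>M Upsilon" if "1 \<le> n" for n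
    using RO measurable_rvX[OF that] by (simp cong: measurable_cong_sets)
  show dX: "distr R Upsilon (rvX n) = m" if "1 \<le> n" for n
  proof -
    have "distr R Upsilon (rvX n) = distr (distr R SeqU seqX) Upsilon (\<lambda>x. x n)"
      by (subst distr_distr[OF measurable_SeqU_component[OF that] mX]) (simp add: comp_def rvX_def[abs_def])
    then show ?thesis using distr_iid_component[OF m that] X by simp
  qed
  have "distr R (\<Pi>\<^sub>M n\<in>{1..}. Upsilon) (\<lambda>\<omega>. \<lambda>n\<in>{1..}. rvX n \<omega>) = distr R SeqU seqX"
    unfolding SeqU_def[symmetric] using RO by (intro distr_cong) (simp_all add: seqX_eq_restrict del: One_nat_def)
  also have "\<dots> = (\<Pi>\<^sub>M n\<in>{1..}. distr R Upsilon (rvX n))"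
    unfolding X iid_seq_def by (intro PiM_cong) (auto simp: dX)
  finally show "R.indep_vars (\<lambda>_. Upsilon) rvX {1..}"
    using Xn by (subst R.indep_vars_iff_distr_eq_PiM') auto
qed

lemma indep_rvI:
  assumes R: "prob_space R" and Y: "Y1 \<in> R \<rightarrow>\<^sub>M M1" "Y2 \<in> R \<rightarrow>\<^sub>M M2"
    and eq: "\<And>A B. A \<in> sets M1 \<Longrightarrow> B \<in> sets M2 \<Longrightarrow>
      emeasure R {\<omega>\<in>space R. Y1 \<omega> \<in> A \<and> Y2 \<omega> \<in> B}
      = emeasure R {\<omega>\<in>space R. Y1 \<omega> \<in> A} * emeasure R {\<omega>\<in>space R. Y2 \<omega> \<in> B}"
  shows "indep_rv R M1 Y1 M2 Y2"
proof -
  interpret R: prob_space R by fact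
  have "R.indep_set {Y1 -` A \<inter> space R |A. A \<in> sets M1} {Y2 -` A \<inter> space R |A. A \<in> sets M2}"
    unfolding R.indep_sets2_eq
  proof (intro conjI ballI)
    fix a b assume "a \<in> {Y1 -` A \<inter> space R |A. A \<in> sets M1}" "b \<in> {Y2 -` A \<inter> space R |A. A \<in> sets M2}"
    then obtain A B where A: "A \<in> sets M1" "a = Y1 -` A \<inter> space R" and B: "B \<in> sets M2" "b = Y2 -` B \<inter> space R"
      by auto
    have *: "a \<inter> b = {\<omega>\<in>space R. Y1 \<omega> \<in> A \<and> Y2 \<omega> \<in> B}" "a = {\<omega>\<in>space R. Y1 \<omega> \<in> A}" "b = {\<omega>\<in>space R. Y2 \<omega> \<in> B}"
      using A B by auto
    show "R.prob (a \<inter> b) = R.prob a * R.prob b"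
      using eq[OF A(1) B(1)] unfolding *(1) unfolding *(2,3) R.emeasure_eq_measure
      by (simp add: ennreal_mult[symmetric])
  qed (use Y in \<open>auto intro: measurable_sets\<close>)
  then show ?thesis using Y by (simp add: indep_rv_def)
qed

lemma (in prob_space) indep_sets_reindex:
  assumes h: "inj_on h I" and F: "indep_sets F (h ` I)"
  shows "indep_sets (\<lambda>i. F (h i)) I"
proof (rule indep_setsI)
  show "F (h i) \<subseteq> events" if "i \<in> I" for i
    using F that by (auto simp: indep_sets_def)
  fix A J assume J: "J \<noteq> {}" "J \<subseteq> I" "finite J" and A: "\<forall>j\<in>J. A j \<in> F (h j)"
  have inj: "inj_on h J" using J h by (auto intro: inj_on_subset)
  let ?A = "\<lambda>i. A (inv_into J h i)"
  have "prob (\<Inter>i\<in>h ` J. ?A i) = (\<Prod>i\<in>h ` J. prob (?A i))"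
    using J A inj by (intro indep_setsD[OF F]) auto
  then show "prob (\<Inter>j\<in>J. A j) = (\<Prod>j\<in>J. prob (A j))"
    using inj by (simp add: prod.reindex cong: INF_cong_simp)
qed

lemma (in prob_space) indep_vars_reindex:
  assumes "inj_on h I" and "indep_vars M' X (h ` I)"
  shows "indep_vars (\<lambda>i. M' (h i)) (\<lambda>i. X (h i)) I"
proof -
  have "indep_sets (\<lambda>i. {X i -` A \<inter> space M |A. A \<in> sets (M' i)}) (h ` I)"
    using assms by (simp add: indep_vars_def2)
  from indep_sets_reindex[OF assms(1) this] show ?thesis
    using assms(2) unfolding indep_vars_def2 by auto
qed

lemma counting_processI:
  assumes "R \<in> space (prob_algebra Omega)" and "AE \<omega> in R. nonexploding (seqW \<omega>)"
  shows "counting_process R procN"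
  unfolding counting_process_def
proof (intro conjI allI impI)
  note R = prob_algebraD[OF assms(1)]
  show "procN t \<in> R \<rightarrow>\<^sub>M count_space UNIV" if "0 \<le> t" for t
    using measurable_procN[OF that] R by (simp cong: measurable_cong_sets)
  show "AE \<omega> in R. procN 0 \<omega> = 0 \<and> (\<forall>s t. 0 \<le> s \<and> s \<le> t \<longrightarrow> procN s \<omega> \<le> procN t \<omega>) \<and>
      (\<forall>t\<ge>0. continuous (at_right t) (\<lambda>u. real (procN u \<omega>))) \<and>
      (\<forall>t>0. \<exists>s\<ge>0. s < t \<and> procN t \<omega> \<le> procN s \<omega> + 1)"
    using assms(2) AE_space
  proof eventually_elim
    case (elim \<omega>)
    then have "seqW \<omega> \<in> space SeqU" using R by (simp add: space_OmegaI)
    from counting_paths[OF this elim(1)] show ?case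
      unfolding procN_eq by blast
  qed
qed

context
  fixes g :: "real \<Rightarrow> real" and m r :: "real measure"
  assumes g: "g \<in> M_plus" and m: "m \<in> space (prob_algebra Upsilon)" and r: "r \<in> space (prob_algebra Upsilon)"
begin

text \<open>The claim law \<open>m\<close> does not vary with \<theta>, so the mass of the claims
  factor leaves the integral over \<theta>. Independence of X from the pair (W, \<Theta>) contains
  both the independence of N and X and condition (a2).\<close>

lemma emeasure_cmpp_law_indep:
  assumes A: "A \<in> sets SeqU" and C: "C \<in> sets SeqU" and B: "B \<in> sets Upsilon"
  shows "emeasure (cmpp_law g m r) {\<omega>\<in>space Omega. seqW \<omega> \<in> A \<and> seqX \<omega> \<in> C \<and> rvTheta \<omega> \<in> B}
    = emeasure (cmpp_law g m r) {\<omega>\<in>space Omega. seqW \<omega> \<in> A \<and> rvTheta \<omega> \<in> B}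
      * emeasure (cmpp_law g m r) {\<omega>\<in>space Omega. seqX \<omega> \<in> C}"
proof -
  interpret X: prob_space "iid_seq m" by (rule prob_space_iid[OF m])
  note R = prob_algebraD[OF cmpp_law_in_prob_algebra[OF g m r]]
  have "{\<omega>\<in>space Omega. seqW \<omega> \<in> A \<and> rvTheta \<omega> \<in> B}
      = {\<omega>\<in>space Omega. seqW \<omega> \<in> A \<and> seqX \<omega> \<in> space SeqU \<and> rvTheta \<omega> \<in> B}"
    by (auto simp: space_OmegaI)
  then have 1: "emeasure (cmpp_law g m r) {\<omega>\<in>space Omega. seqW \<omega> \<in> A \<and> rvTheta \<omega> \<in> B}
     = (\<integral>\<^sup>+\<theta>. emeasure (expo_seq (g \<theta>)) A * indicator B \<theta> \<partial>r)"
    using emeasure_cmpp_law_rect[OF g m r A sets.top B] X.emeasure_space_1 sets_eq_imp_space_eq[OF sets_iid[OF m]]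
    by simp
  have "seqX \<in> cmpp_law g m r \<rightarrow>\<^sub>M SeqU" using R by (simp cong: measurable_cong_sets)
  then have "emeasure (distr (cmpp_law g m r) SeqU seqX) C = emeasure (cmpp_law g m r) (seqX -` C \<inter> space Omega)"
    using C R by (simp add: emeasure_distr)
  also have "seqX -` C \<inter> space Omega = {\<omega>\<in>space Omega. seqX \<omega> \<in> C}" by auto
  finally have 2: "emeasure (cmpp_law g m r) {\<omega>\<in>space Omega. seqX \<omega> \<in> C} = emeasure (iid_seq m) C"
    by (simp add: distr_cmpp_law_seqX[OF g m r])
  show ?thesis unfolding 1 2 by (rule emeasure_cmpp_law_rect[OF g m r A C B])
qed

lemma AE_cmpp_law_nonexploding: "AE \<omega> in cmpp_law g m r. nonexploding (seqW \<omega>)"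
proof (rule AE_cmpp_law[OF g m r])
  show "AE \<omega> in cpp_law (g \<theta>) m \<theta>. nonexploding (seqW \<omega>)" if "0 < \<theta>" for \<theta>
    using that by (intro AE_cpp_law_seqW[OF m] AE_nonexploding M_plusD[OF g])
qed measurable

lemma risk_process_cmpp_law: "risk_process (cmpp_law g m r)"
  unfolding risk_process_def
proof (intro conjI allI impI)
  note RP = cmpp_law_in_prob_algebra[OF g m r]
  note R = prob_algebraD[OF RP]
  show "counting_process (cmpp_law g m r) procN"
    by (rule counting_processI[OF RP AE_cmpp_law_nonexploding])
  note X = risk_process_iidI[OF RP m distr_cmpp_law_seqX[OF g m r]]
  show "prob_space.indep_vars (cmpp_law g m r) (\<lambda>_. Upsilon) rvX {1..}" by (rule X(1))
  show "distr (cmpp_law g m r) Upsilon (rvX n) = distr (cmpp_law g m r) Upsilon (rvX 1)" if "1 \<le> n" for n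
    using X(2)[OF that] X(2)[of 1] by simp
  show "indep_rv (cmpp_law g m r) (\<Pi>\<^sub>M t\<in>{0..}. count_space UNIV) (\<lambda>\<omega>. \<lambda>t\<in>{0..}. procN t \<omega>) SeqU seqX"
  proof (rule indep_rvI)
    show "prob_space (cmpp_law g m r)" by (rule R)
    show "seqX \<in> cmpp_law g m r \<rightarrow>\<^sub>M SeqU" using R by (simp cong: measurable_cong_sets)
    have "(\<lambda>\<omega>. \<lambda>t\<in>{0..}. procN t \<omega>) \<in> Omega \<rightarrow>\<^sub>M (\<Pi>\<^sub>M t\<in>{0..}. count_space UNIV)"
      unfolding procN_eq by (rule measurable_compose[OF measurable_seqW measurable_num_arrivals_path])
    then show "(\<lambda>\<omega>. \<lambda>t\<in>{0..}. procN t \<omega>) \<in> cmpp_law g m r \<rightarrow>\<^sub>M (\<Pi>\<^sub>M t\<in>{0..}. count_space UNIV)"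
      using R by (simp cong: measurable_cong_sets)
    fix A :: "(real \<Rightarrow> nat) set" and C
    assume A: "A \<in> sets (\<Pi>\<^sub>M t\<in>{0..}. count_space UNIV)" and C: "C \<in> sets SeqU"
    let ?A = "(\<lambda>w. \<lambda>t\<in>{0..}. num_arrivals t w) -` A \<inter> space SeqU"
    have A': "?A \<in> sets SeqU" by (rule measurable_sets[OF measurable_num_arrivals_path A])
    have *: "{\<omega>\<in>space Omega. (\<lambda>t\<in>{0..}. procN t \<omega>) \<in> A \<and> seqX \<omega> \<in> C}
        = {\<omega>\<in>space Omega. seqW \<omega> \<in> ?A \<and> seqX \<omega> \<in> C \<and> rvTheta \<omega> \<in> space Upsilon}"
      "{\<omega>\<in>space Omega. (\<lambda>t\<in>{0..}. procN t \<omega>) \<in> A} = {\<omega>\<in>space Omega. seqW \<omega> \<in> ?A \<and> rvTheta \<omega> \<in> space Upsilon}"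
      unfolding procN_eq by (auto simp: space_OmegaI)
    show "emeasure (cmpp_law g m r) {\<omega>\<in>space (cmpp_law g m r). (\<lambda>t\<in>{0..}. procN t \<omega>) \<in> A \<and> seqX \<omega> \<in> C}
      = emeasure (cmpp_law g m r) {\<omega>\<in>space (cmpp_law g m r). (\<lambda>t\<in>{0..}. procN t \<omega>) \<in> A}
       * emeasure (cmpp_law g m r) {\<omega>\<in>space (cmpp_law g m r). seqX \<omega> \<in> C}"
      unfolding R(3) * by (rule emeasure_cmpp_law_indep[OF A' C sets.top])
  qed
qed

lemma cond_a2_cmpp_law: "cond_a2 (cmpp_law g m r)"
  unfolding cond_a2_def
proof (rule indep_rvI)
  note R = prob_algebraD[OF cmpp_law_in_prob_algebra[OF g m r]]
  show "prob_space (cmpp_law g m r)" by (rule R)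
  show "seqX \<in> cmpp_law g m r \<rightarrow>\<^sub>M SeqU" "rvTheta \<in> cmpp_law g m r \<rightarrow>\<^sub>M Upsilon"
    using R by (simp_all cong: measurable_cong_sets)
  fix B C assume B: "B \<in> sets Upsilon" and C: "C \<in> sets SeqU"
  have *: "{\<omega>\<in>space Omega. rvTheta \<omega> \<in> B \<and> seqX \<omega> \<in> C}
      = {\<omega>\<in>space Omega. seqW \<omega> \<in> space SeqU \<and> seqX \<omega> \<in> C \<and> rvTheta \<omega> \<in> B}"
    "{\<omega>\<in>space Omega. rvTheta \<omega> \<in> B} = {\<omega>\<in>space Omega. seqW \<omega> \<in> space SeqU \<and> rvTheta \<omega> \<in> B}"
    by (auto simp: space_OmegaI)
  show "emeasure (cmpp_law g m r) {\<omega>\<in>space (cmpp_law g m r). rvTheta \<omega> \<in> B \<and> seqX \<omega> \<in> C}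
      = emeasure (cmpp_law g m r) {\<omega>\<in>space (cmpp_law g m r). rvTheta \<omega> \<in> B}
       * emeasure (cmpp_law g m r) {\<omega>\<in>space (cmpp_law g m r). seqX \<omega> \<in> C}"
    unfolding R(3) * by (rule emeasure_cmpp_law_indep[OF sets.top C B])
qed

text \<open>Independence in each component is conditional independence in the mixture. The
  definition speaks of finite subfamilies, so only finitely many exceptional null sets have to be
  avoided at a time.\<close>

lemma cond_indep_vars_cmpp_law:
  assumes Y: "\<And>i. i \<in> I \<Longrightarrow> Y i \<in> Omega \<rightarrow>\<^sub>M M' i"
    and indep: "\<And>\<theta>. 0 < \<theta> \<Longrightarrow> prob_space.indep_vars (cpp_law (g \<theta>) m \<theta>) M' Y I"
  shows "cond_indep_vars (cmpp_law g m r) M' Y I"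
  unfolding cond_indep_vars_def
proof (intro conjI ballI allI impI)
  note R = prob_algebraD[OF cmpp_law_in_prob_algebra[OF g m r]]
  show "Y i \<in> cmpp_law g m r \<rightarrow>\<^sub>M M' i" if "i \<in> I" for i
    using Y[OF that] R by (simp cong: measurable_cong_sets)
  fix J A assume J: "J \<subseteq> I" "J \<noteq> {}" "finite J" and A: "A \<in> (\<Pi> j\<in>J. sets (M' j))"
  let ?E = "\<lambda>j. Y j -` A j \<inter> space Omega"
  have E: "?E j \<in> sets Omega" if "j \<in> J" for j
    using that J A by (intro measurable_sets[OF Y]) auto
  have EI: "(\<Inter>j\<in>J. ?E j) \<in> sets Omega" using J E by (intro sets.finite_INT) auto
  have 1: "AE \<omega> in cmpp_law g m r. \<forall>j\<in>J. cpTheta (cmpp_law g m r) (?E j) \<omega>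
      = measure (cpp_law (g (rvTheta \<omega>)) m (rvTheta \<omega>)) (?E j)"
    using J E by (intro AE_finite_allI cpTheta_cmpp_law[OF g m r]) auto
  show "AE \<omega> in cmpp_law g m r. cpTheta (cmpp_law g m r) (\<Inter>j\<in>J. Y j -` A j \<inter> space (cmpp_law g m r)) \<omega>
       = (\<Prod>j\<in>J. cpTheta (cmpp_law g m r) (Y j -` A j \<inter> space (cmpp_law g m r)) \<omega>)"
    unfolding R(3)
    using 1 cpTheta_cmpp_law[OF g m r EI] AE_space
  proof eventually_elim
    case (elim \<omega>)
    then have \<theta>: "0 < rvTheta \<omega>" using R by (simp add: space_OmegaI)
    interpret K: prob_space "cpp_law (g (rvTheta \<omega>)) m (rvTheta \<omega>)"
      by (rule prob_space_cpp_law[OF m M_plusD[OF g \<theta>] \<theta>])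
    have "K.prob (\<Inter>j\<in>J. ?E j) = (\<Prod>j\<in>J. K.prob (?E j))"
      using K.indep_varsD[OF indep[OF \<theta>] J(2,3,1), of A] A by (simp add: space_cpp_law[OF m] Pi_iff)
    then show ?case using elim by simp
  qed
qed

end

lemma measurable_cpp_lawI:
  "m \<in> space (prob_algebra Upsilon) \<Longrightarrow> f \<in> Omega \<rightarrow>\<^sub>M N \<Longrightarrow> f \<in> cpp_law l m \<theta> \<rightarrow>\<^sub>M N"
  using measurable_cong_sets[OF sets_cpp_law refl, of m] by blast

lemma cond_a1_cmpp_law:
  assumes g: "g \<in> M_plus" and m: "m \<in> space (prob_algebra Upsilon)" and r: "r \<in> space (prob_algebra Upsilon)"
  shows "cond_a1 (cmpp_law g m r)"
  unfolding cond_a1_def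
proof (rule cond_indep_vars_cmpp_law[OF g m r])
  show "case_bool seqW seqX i \<in> Omega \<rightarrow>\<^sub>M SeqU" for i by (cases i) auto
  fix \<theta> :: real assume \<theta>: "0 < \<theta>"
  interpret K: prob_space "cpp_law (g \<theta>) m \<theta>" by (rule prob_space_cpp_law[OF m M_plusD[OF g \<theta>] \<theta>])
  interpret E: prob_space "expo_seq (g \<theta>)" by (rule prob_space_expo_seq[OF M_plusD[OF g \<theta>]])
  interpret X: prob_space "iid_seq m" by (rule prob_space_iid[OF m])
  have W: "seqW \<in> cpp_law (g \<theta>) m \<theta> \<rightarrow>\<^sub>M SeqU" and X: "seqX \<in> cpp_law (g \<theta>) m \<theta> \<rightarrow>\<^sub>M SeqU"
    by (simp_all add: sets_cpp_law[OF m] cong: measurable_cong_sets)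
  have "K.indep_var SeqU seqW SeqU seqX"
    unfolding K.indep_var_eq
  proof (intro conjI W X)
    have "K.indep_set {seqW -` A \<inter> space (cpp_law (g \<theta>) m \<theta>) |A. A \<in> sets SeqU}
       {seqX -` A \<inter> space (cpp_law (g \<theta>) m \<theta>) |A. A \<in> sets SeqU}"
      unfolding K.indep_sets2_eq
    proof (intro conjI ballI)
      fix a b assume "a \<in> {seqW -` A \<inter> space (cpp_law (g \<theta>) m \<theta>) |A. A \<in> sets SeqU}"
        "b \<in> {seqX -` A \<inter> space (cpp_law (g \<theta>) m \<theta>) |A. A \<in> sets SeqU}"
      then obtain A C where A: "A \<in> sets SeqU" "a = seqW -` A \<inter> space Omega"
        and C: "C \<in> sets SeqU" "b = seqX -` C \<inter> space Omega" by (auto simp: space_cpp_law[OF m])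
      have *: "a \<inter> b = {\<omega>\<in>space Omega. seqW \<omega> \<in> A \<and> seqX \<omega> \<in> C \<and> rvTheta \<omega> \<in> space Upsilon}"
        "a = {\<omega>\<in>space Omega. seqW \<omega> \<in> A \<and> seqX \<omega> \<in> space SeqU \<and> rvTheta \<omega> \<in> space Upsilon}"
        "b = {\<omega>\<in>space Omega. seqW \<omega> \<in> space SeqU \<and> seqX \<omega> \<in> C \<and> rvTheta \<omega> \<in> space Upsilon}"
        using A C by (auto simp: space_OmegaI)
      note rect = emeasure_cpp_law_rect[OF m M_plusD[OF g \<theta>] \<theta>]
      have "emeasure (cpp_law (g \<theta>) m \<theta>) (a \<inter> b)
         = emeasure (cpp_law (g \<theta>) m \<theta>) a * emeasure (cpp_law (g \<theta>) m \<theta>) b"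
        unfolding *(1) unfolding *(2,3) rect[OF A(1) C(1) sets.top] rect[OF A(1) sets.top sets.top] rect[OF sets.top C(1) sets.top]
        using \<theta> E.emeasure_space_1 X.emeasure_space_1 sets_eq_imp_space_eq[OF sets_iid[OF m]] by simp
      then show "K.prob (a \<inter> b) = K.prob a * K.prob b"
        by (simp add: K.emeasure_eq_measure ennreal_mult[symmetric])
    qed (use W X in \<open>auto intro: measurable_sets\<close>)
    moreover have "Int_stable {f -` A \<inter> space M |A. A \<in> sets N}" for f :: "outcome \<Rightarrow> (nat \<Rightarrow> real)" and M N
    proof (rule Int_stableI)
      fix a b assume "a \<in> {f -` A \<inter> space M |A. A \<in> sets N}" "b \<in> {f -` A \<inter> space M |A. A \<in> sets N}"
      then obtain A B where "A \<in> sets N" "B \<in> sets N" "a = f -` A \<inter> space M" "b = f -` B \<inter> space M" by auto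
      then show "a \<inter> b \<in> {f -` A \<inter> space M |A. A \<in> sets N}"
        by (intro CollectI exI[of _ "A \<inter> B"]) auto
    qed
    ultimately show "K.indep_set (sigma_sets (space (cpp_law (g \<theta>) m \<theta>)) {seqW -` A \<inter> space (cpp_law (g \<theta>) m \<theta>) |A. A \<in> sets SeqU})
        (sigma_sets (space (cpp_law (g \<theta>) m \<theta>)) {seqX -` A \<inter> space (cpp_law (g \<theta>) m \<theta>) |A. A \<in> sets SeqU})"
      by (intro K.indep_set_sigma_sets)
  qed
  then have "K.indep_vars (case_bool SeqU SeqU) (case_bool seqW seqX) UNIV" by (simp add: K.indep_var_def)
  moreover have "case_bool SeqU SeqU = (\<lambda>_. SeqU)" by (auto split: bool.split)
  ultimately show "K.indep_vars (\<lambda>_. SeqU) (case_bool seqW seqX) UNIV" by simp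
qed

section \<open>Poisson increments of the counting process\<close>

lemma measurable_increment:
  assumes "0 \<le> s" "0 \<le> t" shows "increment procN s t \<in> Omega \<rightarrow>\<^sub>M count_space UNIV"
proof -
  note [measurable] = measurable_procN[OF assms(1)] measurable_procN[OF assms(2)]
  show ?thesis unfolding increment_def[abs_def] by measurable
qed

context
  fixes l \<theta> :: real and m :: "real measure"
  assumes m: "m \<in> space (prob_algebra Upsilon)" and l: "0 < l" and \<theta>: "0 < \<theta>"
begin

interpretation K: prob_space "cpp_law l m \<theta>" by (rule prob_space_cpp_law[OF m l \<theta>])

text \<open>The prescribed increments may be any integers, as a joint law on integer tuples
  requires. A negative one has Poisson mass 0, and off explosion N is monotone, so both sides
  vanish. The partition starts at 0 and may have intervals of length zero.\<close>

lemma emeasure_cpp_law_increments: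
  assumes \<sigma>: "\<sigma> 0 = 0" "\<And>i. i < n \<Longrightarrow> \<sigma> i \<le> \<sigma> (Suc i)"
  shows "emeasure (cpp_law l m \<theta>) {\<omega>\<in>space (cpp_law l m \<theta>). \<forall>i\<in>{..<n}. increment procN (\<sigma> i) (\<sigma> (Suc i)) \<omega> = k i}
    = ennreal (\<Prod>i<n. pmf (poisI (l * (\<sigma> (Suc i) - \<sigma> i))) (k i))"
proof -
  have pos: "0 \<le> \<sigma> i" if "i \<le> n" for i
    using that by (induction i) (use \<sigma> in \<open>auto intro: order_trans\<close>)
  have mW: "seqW \<in> cpp_law l m \<theta> \<rightarrow>\<^sub>M SeqU" by (simp add: sets_cpp_law[OF m] cong: measurable_cong_sets)
  let ?A = "{w\<in>space SeqU. \<forall>i\<in>{..<n}. int (num_arrivals (\<sigma> (Suc i)) w) - int (num_arrivals (\<sigma> i) w) = k i}"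
  have A: "?A \<in> sets SeqU"
  proof (intro sets.sets_Collect_finite_All)
    fix i assume "i \<in> {..<n}"
    then have [measurable]: "num_arrivals (\<sigma> i) \<in> SeqU \<rightarrow>\<^sub>M count_space UNIV" "num_arrivals (\<sigma> (Suc i)) \<in> SeqU \<rightarrow>\<^sub>M count_space UNIV"
      by (auto intro!: measurable_num_arrivals pos)
    show "{w\<in>space SeqU. int (num_arrivals (\<sigma> (Suc i)) w) - int (num_arrivals (\<sigma> i) w) = k i} \<in> sets SeqU" by measurable
  qed simp
  have "{\<omega>\<in>space (cpp_law l m \<theta>). \<forall>i\<in>{..<n}. increment procN (\<sigma> i) (\<sigma> (Suc i)) \<omega> = k i}
      = seqW -` ?A \<inter> space (cpp_law l m \<theta>)"
    by (auto simp: increment_def procN_eq space_cpp_law[OF m] space_OmegaI)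
  then have eq: "emeasure (cpp_law l m \<theta>) {\<omega>\<in>space (cpp_law l m \<theta>). \<forall>i\<in>{..<n}. increment procN (\<sigma> i) (\<sigma> (Suc i)) \<omega> = k i}
      = emeasure (expo_seq l) ?A"
    using emeasure_distr[OF mW A] by (simp add: distr_cpp_law_seqW[OF m l \<theta>])
  show ?thesis
  proof (cases "\<forall>i<n. 0 \<le> k i")
    case True
    have eq_nat: "int a - int b = j \<longleftrightarrow> a = b + nat j" if "0 \<le> j" for a b j
      using that by arith
    have "?A = {w\<in>space SeqU. \<forall>i<n. num_arrivals (\<sigma> (Suc i)) w = num_arrivals (\<sigma> i) w + nat (k i)}"
      using True eq_nat by auto
    then have "emeasure (expo_seq l) ?A = ennreal (\<Prod>i<n. pois (l * (\<sigma> (Suc i) - \<sigma> i)) (nat (k i)))"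
      using emeasure_num_arrivals_increments[where k = "\<lambda>i. nat (k i)", OF l \<sigma>] by simp
    also have "(\<Prod>i<n. pois (l * (\<sigma> (Suc i) - \<sigma> i)) (nat (k i))) = (\<Prod>i<n. pmf (poisI (l * (\<sigma> (Suc i) - \<sigma> i))) (k i))"
      using True l \<sigma> by (intro prod.cong) (auto simp: pmf_poisI)
    finally show ?thesis using eq by simp
  next
    case False
    then obtain i where i: "i < n" "k i < 0" by (auto simp: not_le)
    have "pmf (poisI (l * (\<sigma> (Suc i) - \<sigma> i))) (k i) = 0"
      using i l \<sigma> by (subst pmf_poisI) auto
    then have 0: "(\<Prod>i<n. pmf (poisI (l * (\<sigma> (Suc i) - \<sigma> i))) (k i)) = 0"
      using i by (intro prod_zero) auto
    have "AE w in expo_seq l. w \<notin> ?A"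
      using AE_nonexploding[OF l] AE_space
    proof eventually_elim
      case (elim w)
      then have "num_arrivals (\<sigma> i) w \<le> num_arrivals (\<sigma> (Suc i)) w" using i pos \<sigma> by (intro num_arrivals_mono nonexplodingD) auto
      then have "int (num_arrivals (\<sigma> (Suc i)) w) - int (num_arrivals (\<sigma> i) w) \<noteq> k i" using i by linarith
      then show ?case using i by auto
    qed
    then have "emeasure (expo_seq l) ?A = 0" using A by (intro AE_iff_measurable[THEN iffD1, rotated 2]) auto
    then show ?thesis unfolding eq 0 by simp
  qed
qed

lemma cpp_law_increments:
  assumes \<sigma>: "\<sigma> 0 = 0" "\<And>i. i < n \<Longrightarrow> \<sigma> i \<le> \<sigma> (Suc i)"
  shows "K.indep_vars (\<lambda>_. count_space UNIV) (\<lambda>i. increment procN (\<sigma> i) (\<sigma> (Suc i))) {..<n}"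
    and "\<And>i. i < n \<Longrightarrow> distr (cpp_law l m \<theta>) (count_space UNIV) (increment procN (\<sigma> i) (\<sigma> (Suc i)))
      = measure_pmf (poisI (l * (\<sigma> (Suc i) - \<sigma> i)))"
proof -
  have pos: "0 \<le> \<sigma> i" if "i \<le> n" for i
    using that by (induction i) (use \<sigma> in \<open>auto intro: order_trans\<close>)
  have rv: "K.random_variable (count_space UNIV) (increment procN (\<sigma> i) (\<sigma> (Suc i)))" if "i \<in> {..<n}" for i
    using that by (intro measurable_cpp_lawI[OF m] measurable_increment pos) auto
  note * = K.indep_vars_discrete[where p = "\<lambda>i. poisI (l * (\<sigma> (Suc i) - \<sigma> i))", OF _ rv emeasure_cpp_law_increments[OF \<sigma>]]
  show "K.indep_vars (\<lambda>_. count_space UNIV) (\<lambda>i. increment procN (\<sigma> i) (\<sigma> (Suc i))) {..<n}"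
    by (rule *(1)) auto
  show "distr (cpp_law l m \<theta>) (count_space UNIV) (increment procN (\<sigma> i) (\<sigma> (Suc i)))
      = measure_pmf (poisI (l * (\<sigma> (Suc i) - \<sigma> i)))" if "i < n" for i
    by (rule *(2)) (use that in auto)
qed

lemma indep_increments_cpp_law:
  assumes "0 \<le> \<tau> 0" "\<And>i. i < n \<Longrightarrow> \<tau> i < \<tau> (Suc i)"
  shows "K.indep_vars (\<lambda>_. count_space UNIV) (\<lambda>i. increment procN (\<tau> i) (\<tau> (Suc i))) {..<n}"
proof -
  \<comment> \<open>The time 0 is put in front, and the increment over \<open>[0, \<tau> 0]\<close>
    is discarded afterwards. As \<open>\<tau> 0\<close> may itself be 0, the new partition is
    increasing only in the weak sense.\<close>
  define \<sigma> where "\<sigma> = case_nat 0 \<tau>"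
  have "\<sigma> i \<le> \<sigma> (Suc i)" if "i < Suc n" for i
    using assms that by (cases i) (auto simp: \<sigma>_def less_imp_le)
  then have "K.indep_vars (\<lambda>_. count_space UNIV) (\<lambda>i. increment procN (\<sigma> i) (\<sigma> (Suc i))) {..<Suc n}"
    by (intro cpp_law_increments(1)) (auto simp: \<sigma>_def)
  then have "K.indep_vars (\<lambda>_. count_space UNIV) (\<lambda>i. increment procN (\<sigma> i) (\<sigma> (Suc i))) (Suc ` {..<n})"
    by (rule K.indep_vars_subset) auto
  from K.indep_vars_reindex[OF _ this] show ?thesis
    by (simp add: \<sigma>_def)
qed

lemma distr_increment_cpp_law:
  assumes "0 \<le> s" "s \<le> t"
  shows "distr (cpp_law l m \<theta>) (count_space UNIV) (increment procN s t) = measure_pmf (poisI (l * (t - s)))"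
proof -
  \<comment> \<open>The partition 0, s, t, in which the required increment has number 1.\<close>
  define \<sigma> :: "nat \<Rightarrow> real" where "\<sigma> i = (if i = 0 then 0 else if i = 1 then s else t)" for i
  show ?thesis
    using cpp_law_increments(2)[of \<sigma> 2 1] assms by (simp add: \<sigma>_def less_2_cases_iff)
qed

lemma distr_procN_cpp_law:
  assumes "0 < t"
  shows "distr (cpp_law l m \<theta>) (count_space UNIV) (procN t) = measure_pmf (poisson_pmf (t * l))"
proof -
  have inc: "increment procN 0 t \<in> cpp_law l m \<theta> \<rightarrow>\<^sub>M count_space UNIV"
    using assms by (intro measurable_cpp_lawI[OF m] measurable_increment) auto
  have "distr (cpp_law l m \<theta>) (count_space UNIV) (procN t)
      = distr (cpp_law l m \<theta>) (count_space UNIV) (nat \<circ> increment procN 0 t)"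
    by (intro distr_cong) (auto simp: increment_def procN_eq num_arrivals_0 space_cpp_law[OF m] space_OmegaI)
  also have "\<dots> = distr (distr (cpp_law l m \<theta>) (count_space UNIV) (increment procN 0 t)) (count_space UNIV) nat"
    using inc by (subst distr_distr) auto
  also have "\<dots> = measure_pmf (map_pmf nat (poisI (l * t)))"
    using assms by (simp add: distr_increment_cpp_law map_pmf_rep_eq)
  also have "map_pmf nat (poisI (l * t)) = poisson_pmf (t * l)"
    using l assms by (simp add: poisI_def pmf.map_comp comp_def mult.commute pmf.map_ident)
  finally show ?thesis .
qed

lemma poisson_process_cpp_law: "poisson_process (cpp_law l m \<theta>) procN l"
  unfolding poisson_process_def
  using indep_increments_cpp_law distr_procN_cpp_law by (auto simp: distr_increment_cpp_law)

end

lemma S_is_CPP_cpp_law: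
  assumes m: "m \<in> space (prob_algebra Upsilon)" and l: "0 < l" and \<theta>: "0 < \<theta>"
  shows "S_is_CPP (cpp_law l m \<theta>) l"
proof -
  have "(\<lambda>_. l) \<in> M_plus" using l by (simp add: M_plus_def)
  moreover have "return Upsilon \<theta> \<in> space (prob_algebra Upsilon)"
    using \<theta> by (simp add: space_prob_algebra prob_space_return)
  ultimately have "risk_process (cmpp_law (\<lambda>_. l) m (return Upsilon \<theta>))"
    using m by (intro risk_process_cmpp_law)
  then show ?thesis
    using poisson_process_cpp_law[OF assms] by (simp add: S_is_CPP_def cmpp_law_return[OF l \<theta> m])
qed

lemma S_is_CMPP_cmpp_law:
  assumes g: "g \<in> M_plus" and m: "m \<in> space (prob_algebra Upsilon)" and r: "r \<in> space (prob_algebra Upsilon)"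
  shows "S_is_CMPP (cmpp_law g m r) g"
proof -
  note R = prob_algebraD[OF cmpp_law_in_prob_algebra[OF g m r]]
  have "mixed_poisson_process (cmpp_law g m r) procN g"
    unfolding mixed_poisson_process_def
  proof (intro conjI allI impI)
    fix n and \<tau> :: "nat \<Rightarrow> real" assume \<tau>: "0 \<le> \<tau> 0" "\<forall>i<n. \<tau> i < \<tau> (Suc i)"
    have pos: "0 \<le> \<tau> i" if "i \<le> n" for i
      using that
    proof (induction i)
      case (Suc i)
      then show ?case using \<tau>(2)[rule_format, of i] by simp
    qed (use \<tau> in simp)
    show "cond_indep_vars (cmpp_law g m r) (\<lambda>_. count_space UNIV) (\<lambda>i. increment procN (\<tau> i) (\<tau> (Suc i))) {..<n}"
    proof (rule cond_indep_vars_cmpp_law[OF g m r])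
      show "increment procN (\<tau> i) (\<tau> (Suc i)) \<in> Omega \<rightarrow>\<^sub>M count_space UNIV" if "i \<in> {..<n}" for i
        using that pos by (intro measurable_increment) auto
      show "prob_space.indep_vars (cpp_law (g \<theta>) m \<theta>) (\<lambda>_. count_space UNIV) (\<lambda>i. increment procN (\<tau> i) (\<tau> (Suc i))) {..<n}"
        if "0 < \<theta>" for \<theta>
        using \<tau> by (intro indep_increments_cpp_law[OF m M_plusD[OF g that] that]) auto
    qed
  next
    fix s t h :: real and B :: "int set"
    assume st: "0 \<le> s \<and> s \<le> t \<and> 0 \<le> h"
    have D: "increment procN u v -` B \<inter> space Omega \<in> sets Omega" if "0 \<le> u" "u \<le> v" for u v
      using that by (intro measurable_sets[OF measurable_increment]) auto
    have K: "measure (cpp_law (g \<theta>) m \<theta>) (increment procN u v -` B \<inter> space Omega) = measure (measure_pmf (poisI (g \<theta> * (v - u)))) B"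
      if "0 < \<theta>" "0 \<le> u" "u \<le> v" for \<theta> u v
    proof -
      have "increment procN u v \<in> cpp_law (g \<theta>) m \<theta> \<rightarrow>\<^sub>M count_space UNIV"
        using that by (intro measurable_cpp_lawI[OF m] measurable_increment) auto
      from measure_distr[OF this, of B] show ?thesis
        using distr_increment_cpp_law[OF m M_plusD[OF g that(1)] that] by (simp add: space_cpp_law[OF m])
    qed
    have D1: "increment procN (s + h) (t + h) -` B \<inter> space Omega \<in> sets Omega"
      and D2: "increment procN s t -` B \<inter> space Omega \<in> sets Omega"
      using st by (auto intro: D)
    show "AE \<omega> in cmpp_law g m r. cpTheta (cmpp_law g m r) (increment procN (s + h) (t + h) -` B \<inter> space (cmpp_law g m r)) \<omega>
       = cpTheta (cmpp_law g m r) (increment procN s t -` B \<inter> space (cmpp_law g m r)) \<omega>"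
      unfolding R(3) using cpTheta_cmpp_law[OF g m r D1] cpTheta_cmpp_law[OF g m r D2] AE_space
    proof eventually_elim
      case (elim \<omega>)
      then have "0 < rvTheta \<omega>" using R by (simp add: space_OmegaI)
      then show ?case using elim st by (simp add: K)
    qed
  next
    fix t :: real and k :: nat assume t: "0 < t"
    have D: "procN t -` {k} \<inter> space Omega \<in> sets Omega"
      using t by (intro measurable_sets[OF measurable_procN]) auto
    have K: "measure (cpp_law (g \<theta>) m \<theta>) (procN t -` {k} \<inter> space Omega) = pmf (poisson_pmf (t * g \<theta>)) k"
      if "0 < \<theta>" for \<theta>
    proof -
      have "procN t \<in> cpp_law (g \<theta>) m \<theta> \<rightarrow>\<^sub>M count_space UNIV"
        using t by (intro measurable_cpp_lawI[OF m] measurable_procN) auto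
      from measure_distr[OF this, of "{k}"] show ?thesis
        using distr_procN_cpp_law[OF m M_plusD[OF g that] that t]
        by (simp add: space_cpp_law[OF m] pmf.rep_eq del: pmf_poisson)
    qed
    show "AE \<omega> in cmpp_law g m r. cpTheta (cmpp_law g m r) (procN t -` {k} \<inter> space (cmpp_law g m r)) \<omega>
       = pmf (poisson_pmf (t * g (rvTheta \<omega>))) k"
      unfolding R(3) using cpTheta_cmpp_law[OF g m r D] AE_space
    proof eventually_elim
      case (elim \<omega>)
      then have "0 < rvTheta \<omega>" using R by (simp add: space_OmegaI)
      then show ?case using elim by (simp add: K del: pmf_poisson)
    qed
  qed
  then show ?thesis
    using risk_process_cmpp_law[OF g m r] by (simp add: S_is_CMPP_def)
qed

section \<open>Uniqueness of the law of a compound mixed Poisson process\<close>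

text \<open>An outcome is the triple of its coordinates, so a \<sigma>-algebra that makes all three
  measurable makes the identity into \<open>Omega\<close> measurable. Candidate generators of
  \<open>sets Omega\<close> are tested in this way.\<close>

lemma sets_Omega_subsetI:
  assumes N: "space N = space Omega" and W: "seqW \<in> N \<rightarrow>\<^sub>M SeqU" and X: "seqX \<in> N \<rightarrow>\<^sub>M SeqU"
    and \<Theta>: "rvTheta \<in> N \<rightarrow>\<^sub>M Upsilon"
  shows "sets Omega \<subseteq> sets N"
proof
  fix A assume A: "A \<in> sets Omega"
  have "(\<lambda>\<omega>. (seqW \<omega>, seqX \<omega>, rvTheta \<omega>)) \<in> N \<rightarrow>\<^sub>M Omega"
    unfolding Omega_def by (intro measurable_Pair W X \<Theta>)
  from measurable_sets[OF this A]
  show "A \<in> sets N" using sets.sets_into_space[OF A] N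
    by (simp add: seqW_def seqX_def rvTheta_def vimage_def Int_absorb2)
qed

lemma measurable_SeqUI:
  assumes "\<And>\<omega>. \<omega> \<in> space N \<Longrightarrow> f \<omega> \<in> space SeqU"
    and "\<And>n. 1 \<le> n \<Longrightarrow> (\<lambda>\<omega>. f \<omega> n) \<in> N \<rightarrow>\<^sub>M Upsilon"
  shows "f \<in> N \<rightarrow>\<^sub>M SeqU"
proof -
  have "(\<lambda>\<omega>. \<lambda>n\<in>{1..}. f \<omega> n) \<in> N \<rightarrow>\<^sub>M SeqU"
    unfolding SeqU_def using assms(2) by (intro measurable_restrict) auto
  then show ?thesis
    by (rule measurable_cong[THEN iffD1, rotated])
      (use assms(1) in \<open>auto simp: space_SeqU PiE_def extensional_restrict simp del: One_nat_def\<close>)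
qed

text \<open>For an arbitrary Q the definition prescribes only the conditional law of each N_t.
  Stationarity moves an increment to an interval starting at 0, where it coincides with a value of
  N; conditional independence then multiplies the Poisson weights. The resulting integral depends on
  Q only through the law of \<Theta>.\<close>

lemma mixed_poisson_increments:
  assumes Q: "Q \<in> space (prob_algebra Omega)" and mp: "mixed_poisson_process Q procN g" and g: "g \<in> M_plus"
    and \<sigma>: "\<sigma> 0 = 0" "\<And>i. i < n \<Longrightarrow> \<sigma> i < \<sigma> (Suc i)" and B: "B \<in> sets Upsilon"
  shows "emeasure Q {\<omega>\<in>space Omega. (\<forall>i<n. increment procN (\<sigma> i) (\<sigma> (Suc i)) \<omega> = k i) \<and> rvTheta \<omega> \<in> B}
    = (\<integral>\<^sup>+\<theta>. indicator B \<theta> * ennreal (\<Prod>i<n. pmf (poisI (g \<theta> * (\<sigma> (Suc i) - \<sigma> i))) (k i)) \<partial>lawTheta Q)"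
proof -
  note QO = prob_algebraD[OF Q]
  interpret Q: prob_space Q by (rule QO)
  have pos: "0 \<le> \<sigma> i" if "i \<le> n" for i
    using that
  proof (induction i)
    case (Suc i)
    then show ?case using \<sigma>(2)[of i] by simp
  qed (use \<sigma> in simp)
  let ?E = "\<lambda>i. increment procN (\<sigma> i) (\<sigma> (Suc i)) -` {k i} \<inter> space Omega"
  let ?h = "\<lambda>i \<theta>. pmf (poisI (g \<theta> * (\<sigma> (Suc i) - \<sigma> i))) (k i)"
  let ?D = "{\<omega>\<in>space Omega. \<forall>i<n. increment procN (\<sigma> i) (\<sigma> (Suc i)) \<omega> = k i}"
  have E: "?E i \<in> sets Omega" if "i < n" for i
    using that by (intro measurable_sets[OF measurable_increment] pos) auto
  have D: "?D \<in> sets Omega"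
  proof -
    have "{\<omega>\<in>space Omega. \<forall>i\<in>{..<n}. increment procN (\<sigma> i) (\<sigma> (Suc i)) \<omega> = k i} \<in> sets Omega"
    proof (rule sets.sets_Collect_finite_All)
      fix i assume "i \<in> {..<n}"
      then have "?E i \<in> sets Omega" using E by blast
      moreover have "?E i = {\<omega>\<in>space Omega. increment procN (\<sigma> i) (\<sigma> (Suc i)) \<omega> = k i}" by blast
      ultimately show "{\<omega>\<in>space Omega. increment procN (\<sigma> i) (\<sigma> (Suc i)) \<omega> = k i} \<in> sets Omega"
        by metis
    qed simp
    then show ?thesis unfolding Ball_def lessThan_iff .
  qed
  have each: "AE \<omega> in Q. cpTheta Q (?E i) \<omega> = ?h i (rvTheta \<omega>)" if i: "i < n" for i
  proof -
    let ?d = "\<sigma> (Suc i) - \<sigma> i"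
    have d: "0 < ?d" using \<sigma>(2)[OF i] by simp
    \<comment> \<open>Stationarity is applied to the interval \<open>[0, ?d]\<close> with shift
      \<open>\<sigma> i\<close>.\<close>
    have st: "AE \<omega> in Q. cpTheta Q (?E i) \<omega> = cpTheta Q (increment procN 0 ?d -` {k i} \<inter> space Omega) \<omega>"
      using mp[unfolded mixed_poisson_process_def, THEN conjunct2, THEN conjunct1, rule_format, of 0 ?d "\<sigma> i" "{k i}"]
        d pos[of i] i by (simp add: QO)
    show ?thesis
    proof (cases "0 \<le> k i")
      case True
      have "increment procN 0 ?d -` {k i} \<inter> space Omega = procN ?d -` {nat (k i)} \<inter> space Q"
        using True QO by (auto simp: increment_def procN_eq num_arrivals_0 space_OmegaI)
      moreover have "AE \<omega> in Q. cpTheta Q (procN ?d -` {nat (k i)} \<inter> space Q) \<omega>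
          = pmf (poisson_pmf (?d * g (rvTheta \<omega>))) (nat (k i))"
        using mp d unfolding mixed_poisson_process_def by blast
      ultimately have "AE \<omega> in Q. cpTheta Q (?E i) \<omega> = pmf (poisson_pmf (?d * g (rvTheta \<omega>))) (nat (k i))"
        using st by auto
      then show ?thesis using AE_space
      proof eventually_elim
        case (elim \<omega>)
        then have "0 < g (rvTheta \<omega>)" using QO by (intro M_plusD[OF g]) (simp add: space_OmegaI)
        then have "0 < ?d * g (rvTheta \<omega>)" using d by simp
        then show ?case using elim True by (simp add: pmf_poisI pmf_poisson_eq mult.commute del: pmf_poisson)
      qed
    next
      case False
      have emp: "increment procN 0 ?d -` {k i} \<inter> space Omega = {}"
        using False by (auto simp: increment_def procN_eq num_arrivals_0 space_OmegaI)
      have "AE \<omega> in Q. cpTheta Q {} \<omega> = (\<lambda>_. 0) (rvTheta \<omega>)"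
        by (rule cpTheta_eqI[OF Q]) auto
      then have "AE \<omega> in Q. cpTheta Q (?E i) \<omega> = 0" using st unfolding emp by auto
      then show ?thesis using AE_space
      proof eventually_elim
        case (elim \<omega>)
        then have "0 < g (rvTheta \<omega>)" using QO by (intro M_plusD[OF g]) (simp add: space_OmegaI)
        then show ?case using elim False d by (subst pmf_poisI) auto
      qed
    qed
  qed
  have cpD: "AE \<omega> in Q. cpTheta Q ?D \<omega> = (\<Prod>i<n. ?h i (rvTheta \<omega>))"
  \<comment> \<open>Conditional independence concerns nonempty families. For \<open>n = 0\<close>
    the event is the whole space and the product is 1.\<close>
  proof (cases "n = 0")
    case True
    have "AE \<omega> in Q. cpTheta Q (space Omega) \<omega> = (\<lambda>_. 1) (rvTheta \<omega>)"
    proof (rule cpTheta_eqI[OF Q])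
      fix B assume B: "B \<in> sets Upsilon"
      have "{\<omega>\<in>space Omega. rvTheta \<omega> \<in> B} = rvTheta -` B \<inter> space Q" using QO by auto
      moreover have "rvTheta -` B \<inter> space Q \<in> sets Q"
        using measurable_sets[OF measurable_rvTheta B] QO by simp
      then have "emeasure Q (rvTheta -` B \<inter> space Q) = (\<integral>\<^sup>+\<omega>. indicator (rvTheta -` B \<inter> space Q) \<omega> \<partial>Q)"
        by simp
      moreover have "\<dots> = (\<integral>\<^sup>+\<omega>. indicator B (rvTheta \<omega>) * ennreal 1 \<partial>Q)"
        by (rule nn_integral_cong) (auto simp: indicator_def)
      ultimately show "emeasure Q {\<omega>\<in>space Omega. rvTheta \<omega> \<in> B} = (\<integral>\<^sup>+\<omega>. indicator B (rvTheta \<omega>) * ennreal 1 \<partial>Q)"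
        by (simp only:)
    qed auto
    then show ?thesis using True by simp
  next
    case False
    have "cond_indep_vars Q (\<lambda>_. count_space UNIV) (\<lambda>i. increment procN (\<sigma> i) (\<sigma> (Suc i))) {..<n}"
      using mp \<sigma> unfolding mixed_poisson_process_def by auto
    from this[unfolded cond_indep_vars_def, THEN conjunct2, rule_format, of "{..<n}" "\<lambda>i. {k i}"] False
    have "AE \<omega> in Q. cpTheta Q (\<Inter>i<n. ?E i) \<omega> = (\<Prod>i<n. cpTheta Q (?E i) \<omega>)"
      by (simp add: QO lessThan_empty_iff)
    moreover have "(\<Inter>i<n. ?E i) = ?D" using False by auto
    moreover have "AE \<omega> in Q. \<forall>i\<in>{..<n}. cpTheta Q (?E i) \<omega> = ?h i (rvTheta \<omega>)"
      using each by (intro AE_finite_allI) auto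
    ultimately show ?thesis by auto
  qed
  have h: "(\<lambda>\<theta>. ?h i \<theta>) \<in> borel_measurable Upsilon" if "i < n" for i
  proof -
    have "(\<lambda>\<theta>. g \<theta> * (\<sigma> (Suc i) - \<sigma> i)) \<in> borel_measurable Upsilon"
      using measurable_UpsilonD[OF M_plus_measurable[OF g]] by measurable
    then have "(\<lambda>\<theta>. if 0 \<le> k i then pois (g \<theta> * (\<sigma> (Suc i) - \<sigma> i)) (nat (k i)) else 0) \<in> borel_measurable Upsilon"
      by measurable
    then show ?thesis
    proof (rule measurable_cong[THEN iffD1, rotated])
      fix \<theta> assume "\<theta> \<in> space Upsilon"
      then have "0 < g \<theta>" using M_plusD[OF g] by simp
      then have "0 \<le> g \<theta> * (\<sigma> (Suc i) - \<sigma> i)" using \<sigma>(2)[OF that] by simp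
      then show "(if 0 \<le> k i then pois (g \<theta> * (\<sigma> (Suc i) - \<sigma> i)) (nat (k i)) else 0) = ?h i \<theta>"
        by (simp add: pmf_poisI)
    qed
  qed
  have "{\<omega>\<in>space Omega. (\<forall>i<n. increment procN (\<sigma> i) (\<sigma> (Suc i)) \<omega> = k i) \<and> rvTheta \<omega> \<in> B}
      = {\<omega>\<in>?D. rvTheta \<omega> \<in> B}" by auto
  then have "emeasure Q {\<omega>\<in>space Omega. (\<forall>i<n. increment procN (\<sigma> i) (\<sigma> (Suc i)) \<omega> = k i) \<and> rvTheta \<omega> \<in> B}
     = (\<integral>\<^sup>+\<omega>. indicator B (rvTheta \<omega>) * ennreal (cpTheta Q ?D \<omega>) \<partial>Q)"
    using cpTheta_nn_integral[OF Q D B] by simp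
  also have "\<dots> = (\<integral>\<^sup>+\<omega>. indicator B (rvTheta \<omega>) * ennreal (\<Prod>i<n. ?h i (rvTheta \<omega>)) \<partial>Q)"
    by (rule nn_integral_cong_AE, rule AE_mp[OF cpD]) simp
  also have "\<dots> = (\<integral>\<^sup>+\<theta>. indicator B \<theta> * ennreal (\<Prod>i<n. ?h i \<theta>) \<partial>lawTheta Q)"
    using nn_integral_rvTheta[OF Q, of "\<lambda>\<theta>. indicator B \<theta> * ennreal (\<Prod>i<n. ?h i \<theta>)"] B h
    by (simp add: borel_measurable_prod)
  finally show ?thesis .
qed

lemma enumerate_times:
  fixes J :: "real set"
  assumes "finite J" "J \<subseteq> {0..}"
  obtains \<sigma> n where "\<sigma> 0 = 0" "\<And>i. i < n \<Longrightarrow> \<sigma> i < \<sigma> (Suc i)" "\<sigma> ` {..n} = insert 0 J" "\<sigma> n = Max (insert 0 J)"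
proof -
  define ts where "ts = sorted_list_of_set (insert 0 J)"
  have set: "set ts = insert 0 J" unfolding ts_def using assms by (intro set_sorted_list_of_set) auto
  have "distinct ts" by (simp add: ts_def del: sorted_list_of_set.sorted_key_list_of_set_insert_remove)
  then have len: "length ts = card (insert 0 J)" using distinct_card[of ts] set by simp
  then have len0: "0 < length ts" using assms by (simp add: card_gt_0_iff)
  have sorted: "sorted_wrt (<) ts" unfolding ts_def by (rule strict_sorted_list_of_set)
  define n where "n = length ts - 1"
  have n_lt: "i < length ts" if "i \<le> n" for i using that len0 unfolding n_def by linarith
  have lt: "ts ! i < ts ! j" if "i < j" "j < length ts" for i j
    using sorted that by (simp add: sorted_wrt_nth_less)
  have mono: "ts ! i \<le> ts ! j" if "i \<le> j" "j < length ts" for i j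
    using lt[of i j] that by (cases "i = j") auto
  have "{..n} = {0..<length ts}" using len0 by (cases ts) (auto simp: n_def)
  then have im: "(!) ts ` {..n} = insert 0 J" using nth_image[of "length ts" ts] set by simp
  show ?thesis
  proof (rule that[of "(!) ts" n])
    have "0 \<in> (!) ts ` {..n}" using im by blast
    then obtain i where i: "i \<le> n" "ts ! i = 0" by auto
    have "ts ! 0 \<in> insert 0 J" using im by blast
    then have "0 \<le> ts ! 0" using assms by auto
    moreover have "ts ! 0 \<le> ts ! i" using i n_lt by (intro mono) auto
    ultimately show "ts ! 0 = 0" using i by simp
    show "ts ! i < ts ! Suc i" if "i < n" for i using that by (intro lt) (auto simp: n_def)
    show "(!) ts ` {..n} = insert 0 J" by (rule im)
    show "ts ! n = Max (insert 0 J)"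
    proof (rule Max_eqI[symmetric])
      show "finite (insert 0 J)" using assms by simp
      show "ts ! n \<in> insert 0 J" using im by blast
      fix y assume "y \<in> insert 0 J"
      then have "y \<in> (!) ts ` {..n}" using im by blast
      then obtain i where "i \<le> n" "y = ts ! i" by auto
      then show "y \<le> ts ! n" using n_lt by (auto intro!: mono)
    qed
  qed
qed

lemma procN_0: "\<omega> \<in> space Omega \<Longrightarrow> procN 0 \<omega> = 0"
  by (simp add: procN_eq num_arrivals_0 space_OmegaI)

lemma counts_iff_increments:
  assumes \<omega>: "\<omega> \<in> space Omega" and \<sigma>: "\<sigma> 0 = 0" and k: "k 0 = 0"
  shows "(\<forall>i\<le>n. procN (\<sigma> i) \<omega> = k i) \<longleftrightarrow> (\<forall>i<n. increment procN (\<sigma> i) (\<sigma> (Suc i)) \<omega> = int (k (Suc i)) - int (k i))"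
proof (induction n)
  case 0
  then show ?case using procN_0[OF \<omega>] \<sigma> k by simp
next
  case (Suc n)
  have "(\<forall>i\<le>Suc n. procN (\<sigma> i) \<omega> = k i) \<longleftrightarrow> (\<forall>i\<le>n. procN (\<sigma> i) \<omega> = k i) \<and> procN (\<sigma> (Suc n)) \<omega> = k (Suc n)"
    by (auto simp: le_Suc_eq)
  also have "\<dots> \<longleftrightarrow> (\<forall>i\<le>n. procN (\<sigma> i) \<omega> = k i) \<and> increment procN (\<sigma> n) (\<sigma> (Suc n)) \<omega> = int (k (Suc n)) - int (k n)"
    by (auto simp: increment_def)
  also have "\<dots> \<longleftrightarrow> (\<forall>i<Suc n. increment procN (\<sigma> i) (\<sigma> (Suc i)) \<omega> = int (k (Suc i)) - int (k i))"
    unfolding Suc.IH by (auto simp: less_Suc_eq)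
  finally show ?case .
qed

text \<open>Turns values of N at an unordered finite set of times into increments along the sorted
  times, with 0 added as the first one. The hypothesis on \<open>\<nu>\<close> rules out a
  contradiction with N_0 = 0. The last time and the value prescribed there are returned because the
  change of rate will depend on them.\<close>

lemma times_event_increments:
  assumes J: "finite J" "J \<subseteq> {0..}" and \<nu>: "0 \<in> J \<longrightarrow> \<nu> 0 = 0"
  obtains \<sigma> N k where "\<sigma> 0 = 0" "\<And>i. i < N \<Longrightarrow> \<sigma> i < \<sigma> (Suc i)" "\<sigma> N = Max (insert 0 J)"
    "k 0 = 0" "\<sigma> N \<in> J \<Longrightarrow> k N = \<nu> (\<sigma> N)"
    "\<And>\<omega>. \<omega> \<in> space Omega \<Longrightarrow> (\<forall>u\<in>J. procN u \<omega> = \<nu> u) \<longleftrightarrow>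
       (\<forall>i<N. increment procN (\<sigma> i) (\<sigma> (Suc i)) \<omega> = int (k (Suc i)) - int (k i))"
proof -
  obtain \<sigma> N where \<sigma>: "\<sigma> 0 = 0" "\<And>i. i < N \<Longrightarrow> \<sigma> i < \<sigma> (Suc i)" "\<sigma> ` {..N} = insert 0 J" "\<sigma> N = Max (insert 0 J)"
    using enumerate_times[OF J] by metis
  \<comment> \<open>The value at time 0 is overwritten because 0 has been added to the times and N_0
    = 0 on all of \<open>Omega\<close>.\<close>
  define k where "k i = (\<nu>(0 := 0)) (\<sigma> i)" for i
  have k0: "k 0 = 0" by (simp add: k_def \<sigma>(1))
  have kN: "k N = \<nu> (\<sigma> N)" if "\<sigma> N \<in> J" using \<nu> that by (auto simp: k_def)
  have "(\<forall>u\<in>J. procN u \<omega> = \<nu> u) \<longleftrightarrow> (\<forall>i<N. increment procN (\<sigma> i) (\<sigma> (Suc i)) \<omega> = int (k (Suc i)) - int (k i))"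
    if \<omega>: "\<omega> \<in> space Omega" for \<omega>
  proof -
    have "(\<forall>u\<in>J. procN u \<omega> = \<nu> u) \<longleftrightarrow> (\<forall>u\<in>insert 0 J. procN u \<omega> = (\<nu>(0 := 0)) u)"
      using \<nu> procN_0[OF \<omega>] by auto
    also have "\<dots> \<longleftrightarrow> (\<forall>i\<le>N. procN (\<sigma> i) \<omega> = k i)"
      unfolding \<sigma>(3)[symmetric] k_def by auto
    also have "\<dots> \<longleftrightarrow> (\<forall>i<N. increment procN (\<sigma> i) (\<sigma> (Suc i)) \<omega> = int (k (Suc i)) - int (k i))"
      by (rule counts_iff_increments[where \<sigma>=\<sigma> and k=k, OF \<omega> \<sigma>(1) k0])
    finally show ?thesis .
  qed
  with \<sigma>(1,2,4) k0 kN show thesis by (rule that)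
qed

lemma mixed_poisson_unique_fdd:
  assumes Q: "Q \<in> space (prob_algebra Omega)" "mixed_poisson_process Q procN g"
    and R: "R \<in> space (prob_algebra Omega)" "mixed_poisson_process R procN g"
    and law: "lawTheta Q = lawTheta R" and g: "g \<in> M_plus"
    and J: "finite J" "J \<subseteq> {0..}" and B: "B \<in> sets Upsilon"
  shows "emeasure Q {\<omega>\<in>space Omega. (\<forall>u\<in>J. procN u \<omega> = n u) \<and> rvTheta \<omega> \<in> B}
    = emeasure R {\<omega>\<in>space Omega. (\<forall>u\<in>J. procN u \<omega> = n u) \<and> rvTheta \<omega> \<in> B}"
proof (cases "0 \<in> J \<longrightarrow> n 0 = 0")
  case False
  then have "{\<omega>\<in>space Omega. (\<forall>u\<in>J. procN u \<omega> = n u) \<and> rvTheta \<omega> \<in> B} = {}" using procN_0 by fastforce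
  then show ?thesis by (simp only: emeasure_empty)
next
  case True
  obtain \<sigma> N k where \<sigma>: "\<sigma> 0 = 0" "\<And>i. i < N \<Longrightarrow> \<sigma> i < \<sigma> (Suc i)"
      "\<sigma> N = Max (insert 0 J)" "k 0 = 0" "\<sigma> N \<in> J \<Longrightarrow> k N = n (\<sigma> N)"
    and eq: "\<And>\<omega>. \<omega> \<in> space Omega \<Longrightarrow> (\<forall>u\<in>J. procN u \<omega> = n u) \<longleftrightarrow>
       (\<forall>i<N. increment procN (\<sigma> i) (\<sigma> (Suc i)) \<omega> = int (k (Suc i)) - int (k i))"
  proof (rule times_event_increments[where \<nu>=n, OF J True], goal_cases)
    case (1 \<sigma> N k)
    show ?case by (rule 1(1)[of \<sigma> N k, OF 1(2-7)])
  qed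
  from eq have "{\<omega>\<in>space Omega. (\<forall>u\<in>J. procN u \<omega> = n u) \<and> rvTheta \<omega> \<in> B}
    = {\<omega>\<in>space Omega. (\<forall>i<N. increment procN (\<sigma> i) (\<sigma> (Suc i)) \<omega> = int (k (Suc i)) - int (k i)) \<and> rvTheta \<omega> \<in> B}"
    by auto
  then show ?thesis
    using mixed_poisson_increments[where n=N and k="\<lambda>i. int (k (Suc i)) - int (k i)", OF Q g \<sigma>(1,2) B]
      mixed_poisson_increments[where n=N and k="\<lambda>i. int (k (Suc i)) - int (k i)", OF R g \<sigma>(1,2) B] law
    by simp
qed

text \<open>On an exploding path N equals 1 at the first arrival time, but drops to 0 at any bound
  of all arrival times, where the counted set is infinite. The monotonicity clause of
  \<open>counting_process\<close> excludes this.\<close>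

lemma counting_process_nonexploding:
  assumes Q: "Q \<in> space (prob_algebra Omega)" and c: "counting_process Q procN"
  shows "AE \<omega> in Q. nonexploding (seqW \<omega>)"
proof -
  have "AE \<omega> in Q. \<forall>s t. 0 \<le> s \<and> s \<le> t \<longrightarrow> procN s \<omega> \<le> procN t \<omega>"
    using c unfolding counting_process_def by auto
  then show ?thesis using AE_space
  proof eventually_elim
    case (elim \<omega>)
    then have w: "seqW \<omega> \<in> space SeqU" using prob_algebraD[OF Q] by (simp add: space_OmegaI)
    show ?case
    proof (rule ccontr)
      assume "\<not> nonexploding (seqW \<omega>)"
      then obtain m where m: "\<And>n. arrival (seqW \<omega>) n \<le> real m" by (auto simp: nonexploding_def not_less)
      let ?t = "arrival (seqW \<omega>) 1"
      have "num_arrivals ?t (seqW \<omega>) = 1"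
        using strict_mono_less[OF strict_mono_arrival[OF w], of 1 "Suc 1"] by (intro num_arrivals_unique[OF w]) auto
      moreover have "num_arrivals (real m) (seqW \<omega>) = 0" using m by (subst num_arrivals_alt[OF w]) auto
      moreover have "procN ?t \<omega> \<le> procN (real m) \<omega>" using elim(1) m arrival_nonneg[OF w] by blast
      ultimately show False by (simp add: procN_eq)
    qed
  qed
qed

text \<open>An event about the arrival times is a countable union of events fixing the values of \<open>N\<close> at
  finitely many times.\<close>

lemma mixed_poisson_unique_arrivals:
  fixes L :: "(nat \<times> real) list"
  assumes Q: "Q \<in> space (prob_algebra Omega)" "mixed_poisson_process Q procN g" "counting_process Q procN"
    and R: "R \<in> space (prob_algebra Omega)" "mixed_poisson_process R procN g" "counting_process R procN"
    and law: "lawTheta Q = lawTheta R" and g: "g \<in> M_plus" and B: "B \<in> sets Upsilon"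
  shows "emeasure Q {\<omega>\<in>space Omega. (\<forall>(i, t)\<in>set L. arrival (seqW \<omega>) i \<le> t) \<and> rvTheta \<omega> \<in> B}
    = emeasure R {\<omega>\<in>space Omega. (\<forall>(i, t)\<in>set L. arrival (seqW \<omega>) i \<le> t) \<and> rvTheta \<omega> \<in> B}"
proof (cases "\<forall>(i, t)\<in>set L. 0 \<le> t")
  case False
  then obtain i t where it: "(i, t) \<in> set L" "t < 0" by (auto simp: not_le)
  have "\<not> arrival (seqW \<omega>) i \<le> t" if "\<omega> \<in> space Omega" for \<omega>
    using it arrival_nonneg[of "seqW \<omega>" i] that by (simp add: space_OmegaI)
  then have "{\<omega>\<in>space Omega. (\<forall>(i, t)\<in>set L. arrival (seqW \<omega>) i \<le> t) \<and> rvTheta \<omega> \<in> B} = {}"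
    using it by fastforce
  then show ?thesis by (simp only: emeasure_empty)
next
  case True
  define J where "J = snd ` set L"
  have J: "finite J" "J \<subseteq> {0..}" using True by (auto simp: J_def)
  let ?C = "\<Pi>\<^sub>M u\<in>J. count_space (UNIV :: nat set)"
  have C: "?C = count_space (\<Pi>\<^sub>E u\<in>J. UNIV)" using J by (intro count_space_PiM_finite) auto
  let ?N = "\<lambda>\<omega>. \<lambda>u\<in>J. procN u \<omega>"
  have N: "?N \<in> Omega \<rightarrow>\<^sub>M ?C" using J by (intro measurable_restrict measurable_procN) auto
  let ?I = "indicator (rvTheta -` B \<inter> space Omega) :: outcome \<Rightarrow> ennreal"
  have BO: "rvTheta -` B \<inter> space Omega \<in> sets Omega" by (rule measurable_sets[OF measurable_rvTheta B])
  \<comment> \<open>The part of \<open>M\<close> on which \<Theta> lies in \<open>B\<close>, pushed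
    forward to the values of N at the times in \<open>J\<close>. These form a countable space, so
    agreement of the point masses gives agreement on every set of value tuples.\<close>
  let ?F = "\<lambda>M. distr (density M ?I) ?C ?N"
  have F: "emeasure (?F M) S = emeasure M {\<omega>\<in>space Omega. ?N \<omega> \<in> S \<and> rvTheta \<omega> \<in> B}"
    if M: "M \<in> space (prob_algebra Omega)" and S: "S \<in> sets ?C" for M S
  proof -
    note MO = prob_algebraD[OF M]
    have S': "?N -` S \<inter> space Omega \<in> sets Omega" by (rule measurable_sets[OF N S])
    have NM: "?N \<in> density M ?I \<rightarrow>\<^sub>M ?C" using N MO by (simp cong: measurable_cong_sets)
    have "emeasure (?F M) S = emeasure (density M ?I) (?N -` S \<inter> space M)"
      using emeasure_distr[OF NM S] by simp
    also have "\<dots> = (\<integral>\<^sup>+\<omega>. ?I \<omega> * indicator (?N -` S \<inter> space M) \<omega> \<partial>M)"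
      using S' BO MO by (intro emeasure_density) auto
    also have "\<dots> = (\<integral>\<^sup>+\<omega>. indicator ((rvTheta -` B \<inter> space Omega) \<inter> (?N -` S \<inter> space Omega)) \<omega> \<partial>M)"
      using MO by (intro nn_integral_cong) (auto simp: indicator_def)
    also have "\<dots> = emeasure M ((rvTheta -` B \<inter> space Omega) \<inter> (?N -` S \<inter> space Omega))"
      using S' BO MO by (intro nn_integral_indicator) auto
    also have "(rvTheta -` B \<inter> space Omega) \<inter> (?N -` S \<inter> space Omega) = {\<omega>\<in>space Omega. ?N \<omega> \<in> S \<and> rvTheta \<omega> \<in> B}"
      by auto
    finally show ?thesis .
  qed
  have eq: "?F Q = ?F R"
  proof (rule measure_eqI_countable)
    show "countable (\<Pi>\<^sub>E u\<in>J. UNIV :: nat set)" using J by (intro countable_PiE) auto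
    show "sets (?F Q) = Pow (\<Pi>\<^sub>E u\<in>J. UNIV)" "sets (?F R) = Pow (\<Pi>\<^sub>E u\<in>J. UNIV)" by (simp_all add: C)
    fix n :: "real \<Rightarrow> nat" assume n: "n \<in> (\<Pi>\<^sub>E u\<in>J. UNIV)"
    then have "{n} \<in> sets ?C" by (simp add: C)
    moreover have "{\<omega>\<in>space Omega. ?N \<omega> \<in> {n} \<and> rvTheta \<omega> \<in> B} = {\<omega>\<in>space Omega. (\<forall>u\<in>J. procN u \<omega> = n u) \<and> rvTheta \<omega> \<in> B}"
      using n by (auto simp: fun_eq_iff restrict_def PiE_def extensional_def)
    ultimately show "emeasure (?F Q) {n} = emeasure (?F R) {n}"
      using F[OF Q(1)] F[OF R(1)] mixed_poisson_unique_fdd[OF Q(1,2) R(1,2) law g J B, of n] by simp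
  qed
  define S where "S = {n \<in> (\<Pi>\<^sub>E u\<in>J. UNIV). \<forall>(i, t)\<in>set L. i \<le> n t}"
  have S: "S \<in> sets ?C" by (auto simp: C S_def)
  have *: "emeasure M {\<omega>\<in>space Omega. (\<forall>(i, t)\<in>set L. arrival (seqW \<omega>) i \<le> t) \<and> rvTheta \<omega> \<in> B} = emeasure (?F M) S"
    if M: "M \<in> space (prob_algebra Omega)" "counting_process M procN" for M
    unfolding F[OF M(1) S]
  proof (rule emeasure_eq_AE)
    note MO = prob_algebraD[OF M(1)]
    show "AE \<omega> in M. (\<omega> \<in> {\<omega>\<in>space Omega. (\<forall>(i, t)\<in>set L. arrival (seqW \<omega>) i \<le> t) \<and> rvTheta \<omega> \<in> B})
      = (\<omega> \<in> {\<omega>\<in>space Omega. ?N \<omega> \<in> S \<and> rvTheta \<omega> \<in> B})"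
      using counting_process_nonexploding[OF M] AE_space
    proof eventually_elim
      case (elim \<omega>)
      then have w: "seqW \<omega> \<in> space SeqU" using MO by (simp add: space_OmegaI)
      have "i \<le> procN t \<omega> \<longleftrightarrow> arrival (seqW \<omega>) i \<le> t" if "(i, t) \<in> set L" for i t
        using True that unfolding procN_eq by (intro le_num_arrivals_iff[OF w nonexplodingD[OF elim(1)]]) auto
      then have "(\<forall>(i, t)\<in>set L. arrival (seqW \<omega>) i \<le> t) \<longleftrightarrow> ?N \<omega> \<in> S"
        by (force simp: S_def J_def)
      then show ?case by auto
    qed
    have [measurable]: "(\<lambda>\<omega>. arrival (seqW \<omega>) i) \<in> borel_measurable Omega" for i
      by (rule measurable_compose[OF measurable_seqW measurable_arrival])
    have "{\<omega>\<in>space Omega. (\<forall>(i, t)\<in>set L. arrival (seqW \<omega>) i \<le> t) \<and> rvTheta \<omega> \<in> B} \<in> sets Omega"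
      using B by measurable
    then show "{\<omega>\<in>space Omega. (\<forall>(i, t)\<in>set L. arrival (seqW \<omega>) i \<le> t) \<and> rvTheta \<omega> \<in> B} \<in> sets M" using MO by simp
    have "{\<omega>\<in>space Omega. ?N \<omega> \<in> S \<and> rvTheta \<omega> \<in> B} = (rvTheta -` B \<inter> space Omega) \<inter> (?N -` S \<inter> space Omega)" by auto
    then show "{\<omega>\<in>space Omega. ?N \<omega> \<in> S \<and> rvTheta \<omega> \<in> B} \<in> sets M"
      using BO measurable_sets[OF N S] MO by auto
  qed
  show ?thesis using *[OF Q(1,3)] *[OF R(1,3)] eq by simp
qed

lemma indep_rvD:
  assumes "prob_space R" "indep_rv R M1 Y1 M2 Y2" "A \<in> sets M1" "B \<in> sets M2"
  shows "emeasure R {\<omega>\<in>space R. Y1 \<omega> \<in> A \<and> Y2 \<omega> \<in> B}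
      = emeasure R {\<omega>\<in>space R. Y1 \<omega> \<in> A} * emeasure R {\<omega>\<in>space R. Y2 \<omega> \<in> B}"
proof -
  interpret R: prob_space R by fact
  have *: "Y1 -` A \<inter> space R = {\<omega>\<in>space R. Y1 \<omega> \<in> A}" "Y2 -` B \<inter> space R = {\<omega>\<in>space R. Y2 \<omega> \<in> B}"
    "(Y1 -` A \<inter> space R) \<inter> (Y2 -` B \<inter> space R) = {\<omega>\<in>space R. Y1 \<omega> \<in> A \<and> Y2 \<omega> \<in> B}" by auto
  have "R.prob ((Y1 -` A \<inter> space R) \<inter> (Y2 -` B \<inter> space R)) = R.prob (Y1 -` A \<inter> space R) * R.prob (Y2 -` B \<inter> space R)"
    using assms(2-4) unfolding indep_rv_def by (intro R.indep_setD) auto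
  then show ?thesis unfolding *(3) unfolding *(1,2) by (simp add: R.emeasure_eq_measure ennreal_mult)
qed

text \<open>By (a1) the conditional probability given \<Theta> of an event of W and an event of X is
  a product; by (a2) the factor of X is almost surely constant and leaves the integral over
  \<Theta>. Pairwise independence alone would not give this factorisation.\<close>

lemma emeasure_indep_X:
  assumes Q: "Q \<in> space (prob_algebra Omega)" and a1: "cond_a1 Q" and a2: "cond_a2 Q"
    and A: "A \<in> sets SeqU" and C: "C \<in> sets SeqU" and B: "B \<in> sets Upsilon"
  shows "emeasure Q {\<omega>\<in>space Omega. seqW \<omega> \<in> A \<and> seqX \<omega> \<in> C \<and> rvTheta \<omega> \<in> B}
    = emeasure Q {\<omega>\<in>space Omega. seqW \<omega> \<in> A \<and> rvTheta \<omega> \<in> B} * emeasure Q {\<omega>\<in>space Omega. seqX \<omega> \<in> C}"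
proof -
  note QO = prob_algebraD[OF Q]
  interpret Q: prob_space Q by (rule QO)
  let ?DW = "seqW -` A \<inter> space Omega" and ?DX = "seqX -` C \<inter> space Omega"
  have DW: "?DW \<in> sets Omega" and DX: "?DX \<in> sets Omega"
    using measurable_sets[OF measurable_seqW A] measurable_sets[OF measurable_seqX C] by auto
  have X: "{\<omega>\<in>space Omega. seqX \<omega> \<in> C} = ?DX" by auto
  have c: "AE \<omega> in Q. cpTheta Q (?DW \<inter> ?DX) \<omega> = cpTheta Q ?DW \<omega> * cpTheta Q ?DX \<omega>"
    using a1[unfolded cond_a1_def cond_indep_vars_def, THEN conjunct2, rule_format, of UNIV "case_bool A C"] A C
    by (simp add: QO UNIV_bool Pi_iff Int_commute mult.commute split: bool.split)
  have x: "AE \<omega> in Q. cpTheta Q ?DX \<omega> = (\<lambda>_. Q.prob ?DX) (rvTheta \<omega>)"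
  proof (rule cpTheta_eqI[OF Q DX])
    fix B assume B: "B \<in> sets Upsilon"
    have "emeasure Q {\<omega>\<in>?DX. rvTheta \<omega> \<in> B} = emeasure Q {\<omega>\<in>space Q. rvTheta \<omega> \<in> B \<and> seqX \<omega> \<in> C}"
      using QO by (intro arg_cong[of _ _ "emeasure Q"]) auto
    also have "\<dots> = emeasure Q {\<omega>\<in>space Q. rvTheta \<omega> \<in> B} * emeasure Q {\<omega>\<in>space Q. seqX \<omega> \<in> C}"
      by (rule indep_rvD[OF QO(1) a2[unfolded cond_a2_def] B C])
    also have "{\<omega>\<in>space Q. seqX \<omega> \<in> C} = ?DX" using QO by auto
    also have "{\<omega>\<in>space Q. rvTheta \<omega> \<in> B} = rvTheta -` B \<inter> space Q" by auto
    also have "emeasure Q (rvTheta -` B \<inter> space Q) = (\<integral>\<^sup>+\<omega>. indicator (rvTheta -` B \<inter> space Q) \<omega> \<partial>Q)"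
      using measurable_sets[OF measurable_rvTheta B] QO by simp
    also have "\<dots> = (\<integral>\<^sup>+\<omega>. indicator B (rvTheta \<omega>) \<partial>Q)"
      by (rule nn_integral_cong) (auto simp: indicator_def)
    also have "\<dots> * emeasure Q ?DX = (\<integral>\<^sup>+\<omega>. indicator B (rvTheta \<omega>) * ennreal (Q.prob ?DX) \<partial>Q)"
      using measurable_compose[OF measurable_rvTheta borel_measurable_indicator[OF B]] QO
      by (subst nn_integral_multc) (auto simp: Q.emeasure_eq_measure cong: measurable_cong_sets)
    finally show "emeasure Q {\<omega>\<in>?DX. rvTheta \<omega> \<in> B} = (\<integral>\<^sup>+\<omega>. indicator B (rvTheta \<omega>) * ennreal (Q.prob ?DX) \<partial>Q)" .
  qed auto
  have "emeasure Q {\<omega>\<in>space Omega. seqW \<omega> \<in> A \<and> seqX \<omega> \<in> C \<and> rvTheta \<omega> \<in> B}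
     = emeasure Q {\<omega>\<in>?DW \<inter> ?DX. rvTheta \<omega> \<in> B}" by (intro arg_cong[of _ _ "emeasure Q"]) auto
  also have "\<dots> = (\<integral>\<^sup>+\<omega>. indicator B (rvTheta \<omega>) * ennreal (cpTheta Q (?DW \<inter> ?DX) \<omega>) \<partial>Q)"
    using DW DX by (intro cpTheta_nn_integral[OF Q _ B]) auto
  also have "\<dots> = (\<integral>\<^sup>+\<omega>. (indicator B (rvTheta \<omega>) * ennreal (cpTheta Q ?DW \<omega>)) * ennreal (Q.prob ?DX) \<partial>Q)"
  proof (rule nn_integral_cong_AE)
    show "AE \<omega> in Q. indicator B (rvTheta \<omega>) * ennreal (cpTheta Q (?DW \<inter> ?DX) \<omega>)
       = (indicator B (rvTheta \<omega>) * ennreal (cpTheta Q ?DW \<omega>)) * ennreal (Q.prob ?DX)"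
      using c x cpTheta_nonneg[OF Q DW]
      by eventually_elim (simp add: ennreal_mult mult.assoc)
  qed
  also have "\<dots> = (\<integral>\<^sup>+\<omega>. indicator B (rvTheta \<omega>) * ennreal (cpTheta Q ?DW \<omega>) \<partial>Q) * ennreal (Q.prob ?DX)"
  proof (rule nn_integral_multc)
    have [measurable]: "(\<lambda>\<omega>. indicator B (rvTheta \<omega>) :: ennreal) \<in> borel_measurable Q"
      using measurable_compose[OF measurable_rvTheta borel_measurable_indicator[OF B]] QO by (simp cong: measurable_cong_sets)
    note [measurable] = measurable_cpTheta[OF Q]
    show "(\<lambda>\<omega>. indicator B (rvTheta \<omega>) * ennreal (cpTheta Q ?DW \<omega>)) \<in> borel_measurable Q" by measurable
  qed
  also have "(\<integral>\<^sup>+\<omega>. indicator B (rvTheta \<omega>) * ennreal (cpTheta Q ?DW \<omega>) \<partial>Q) = emeasure Q {\<omega>\<in>?DW. rvTheta \<omega> \<in> B}"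
    by (rule cpTheta_nn_integral[OF Q DW B, symmetric])
  also have "{\<omega>\<in>?DW. rvTheta \<omega> \<in> B} = {\<omega>\<in>space Omega. seqW \<omega> \<in> A \<and> rvTheta \<omega> \<in> B}" by auto
  finally show ?thesis unfolding X Q.emeasure_eq_measure .
qed

lemma risk_process_distr_seqX:
  assumes Q: "Q \<in> space (prob_algebra Omega)" and rp: "risk_process Q"
  shows "distr Q SeqU seqX = iid_seq (lawX1 Q)"
proof -
  note QO = prob_algebraD[OF Q]
  interpret Q: prob_space Q by (rule QO)
  have rv: "rvX n \<in> Q \<rightarrow>\<^sub>M Upsilon" if "n \<in> {1..}" for n
    using measurable_rvX[of n] that QO by (simp cong: measurable_cong_sets)
  have eqd: "distr Q Upsilon (rvX n) = distr Q Upsilon (rvX 1)" if "n \<in> {1..}" for n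
    using rp that unfolding risk_process_def by blast
  have iv: "Q.indep_vars (\<lambda>_. Upsilon) rvX {1..}" using rp by (simp add: risk_process_def)
  have "distr Q (\<Pi>\<^sub>M n\<in>{1..}. Upsilon) (\<lambda>\<omega>. \<lambda>n\<in>{1..}. rvX n \<omega>) = (\<Pi>\<^sub>M n\<in>{1..}. distr Q Upsilon (rvX n))"
    by (rule Q.indep_vars_iff_distr_eq_PiM'[THEN iffD1, OF _ rv iv]) auto
  also have "\<dots> = iid_seq (lawX1 Q)"
    unfolding iid_seq_def lawX1_def by (rule PiM_cong[OF refl eqd])
  also have "distr Q (\<Pi>\<^sub>M n\<in>{1..}. Upsilon) (\<lambda>\<omega>. \<lambda>n\<in>{1..}. rvX n \<omega>) = distr Q SeqU seqX"
    unfolding SeqU_def[symmetric] using QO by (intro distr_cong) (simp_all add: seqX_eq_restrict del: One_nat_def)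
  finally show ?thesis .
qed

text \<open>Upper bounds on arrival times are what N can express. Listing finitely many of them
  makes the family stable under intersection by concatenating lists, and it generates
  \<open>sets Omega\<close> because the waiting times are differences of consecutive arrival
  times.\<close>

definition arrivals_gen :: "outcome set set" where
  "arrivals_gen = {{\<omega>\<in>space Omega. (\<forall>(i, t)\<in>set L. arrival (seqW \<omega>) i \<le> t) \<and> seqX \<omega> \<in> C \<and> rvTheta \<omega> \<in> B} |
     (L :: (nat \<times> real) list) C B. C \<in> sets SeqU \<and> B \<in> sets Upsilon}"

lemma arrivals_genI:
  "C \<in> sets SeqU \<Longrightarrow> B \<in> sets Upsilon \<Longrightarrow>
    {\<omega>\<in>space Omega. (\<forall>(i, t)\<in>set L. arrival (seqW \<omega>) i \<le> t) \<and> seqX \<omega> \<in> C \<and> rvTheta \<omega> \<in> B} \<in> arrivals_gen"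
  unfolding arrivals_gen_def by blast

lemma Int_stable_arrivals_gen: "Int_stable arrivals_gen"
proof (rule Int_stableI)
  fix a b assume "a \<in> arrivals_gen" "b \<in> arrivals_gen"
  then obtain L C B L' C' B' where
    a: "a = {\<omega>\<in>space Omega. (\<forall>(i, t)\<in>set L. arrival (seqW \<omega>) i \<le> t) \<and> seqX \<omega> \<in> C \<and> rvTheta \<omega> \<in> B}" and
    b: "b = {\<omega>\<in>space Omega. (\<forall>(i, t)\<in>set L'. arrival (seqW \<omega>) i \<le> t) \<and> seqX \<omega> \<in> C' \<and> rvTheta \<omega> \<in> B'}" and
    *: "C \<in> sets SeqU" "B \<in> sets Upsilon" "C' \<in> sets SeqU" "B' \<in> sets Upsilon"
    unfolding arrivals_gen_def by blast
  have "a \<inter> b = {\<omega>\<in>space Omega. (\<forall>(i, t)\<in>set (L @ L'). arrival (seqW \<omega>) i \<le> t) \<and> seqX \<omega> \<in> C \<inter> C' \<and> rvTheta \<omega> \<in> B \<inter> B'}"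
    unfolding a b by auto
  then show "a \<inter> b \<in> arrivals_gen" using arrivals_genI[of "C \<inter> C'" "B \<inter> B'" "L @ L'"] * by auto
qed

lemma arrivals_gen_sets: "arrivals_gen \<subseteq> sets Omega"
proof
  fix a assume "a \<in> arrivals_gen"
  then obtain L C B where a: "a = {\<omega>\<in>space Omega. (\<forall>(i, t)\<in>set L. arrival (seqW \<omega>) i \<le> t) \<and> seqX \<omega> \<in> C \<and> rvTheta \<omega> \<in> B}"
    and [measurable]: "C \<in> sets SeqU" "B \<in> sets Upsilon" unfolding arrivals_gen_def by blast
  have [measurable]: "(\<lambda>\<omega>. arrival (seqW \<omega>) i) \<in> borel_measurable Omega" for i
    by (rule measurable_compose[OF measurable_seqW measurable_arrival])
  show "a \<in> sets Omega" unfolding a by measurable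
qed

lemma sets_Omega_arrivals_gen: "sets Omega = sigma_sets (space Omega) arrivals_gen"
proof (rule antisym)
  show "sigma_sets (space Omega) arrivals_gen \<subseteq> sets Omega"
    by (rule sets.sigma_sets_subset[OF arrivals_gen_sets])
  define N where "N = sigma (space Omega) arrivals_gen"
  have gP: "arrivals_gen \<subseteq> Pow (space Omega)" using arrivals_gen_sets sets.space_closed by blast
  have N: "space N = space Omega" "sets N = sigma_sets (space Omega) arrivals_gen"
    unfolding N_def using gP by (auto simp: space_measure_of)
  have gen: "a \<in> arrivals_gen \<Longrightarrow> a \<in> sets N" for a by (auto simp: N)
  have arrm: "(\<lambda>\<omega>. arrival (seqW \<omega>) i) \<in> borel_measurable N" for i
    unfolding borel_measurable_iff_le
  proof
    fix a
    have "{\<omega> \<in> space N. arrival (seqW \<omega>) i \<le> a} = {\<omega>\<in>space Omega. (\<forall>(i, t)\<in>set [(i, a)]. arrival (seqW \<omega>) i \<le> t) \<and> seqX \<omega> \<in> space SeqU \<and> rvTheta \<omega> \<in> space Upsilon}"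
      by (auto simp: N space_OmegaI)
    also have "\<dots> \<in> sets N" by (intro gen arrivals_genI sets.top)
    finally show "{\<omega> \<in> space N. arrival (seqW \<omega>) i \<le> a} \<in> sets N" .
  qed
  have "sets Omega \<subseteq> sets N"
  proof (rule sets_Omega_subsetI[OF N(1)])
    show "seqW \<in> N \<rightarrow>\<^sub>M SeqU"
    proof (rule measurable_SeqUI)
      show "\<omega> \<in> space N \<Longrightarrow> seqW \<omega> \<in> space SeqU" for \<omega> by (simp add: N space_OmegaI)
      fix n :: nat assume n: "1 \<le> n"
      have "(\<lambda>\<omega>. arrival (seqW \<omega>) n - arrival (seqW \<omega>) (n - 1)) \<in> borel_measurable N"
        by (intro borel_measurable_diff arrm)
      moreover have "arrival w n - arrival w (n - 1) = w n" for w using n by (cases n) (auto simp: arrival_Suc)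
      ultimately have "(\<lambda>\<omega>. seqW \<omega> n) \<in> borel_measurable N" by simp
      then show "(\<lambda>\<omega>. seqW \<omega> n) \<in> N \<rightarrow>\<^sub>M Upsilon"
        using n by (intro measurable_UpsilonI) (auto simp: N space_OmegaI intro: SeqU_pos)
    qed
    show "seqX \<in> N \<rightarrow>\<^sub>M SeqU"
    proof (rule measurableI)
      fix C assume C: "C \<in> sets SeqU"
      have "seqX -` C \<inter> space N = {\<omega>\<in>space Omega. (\<forall>(i, t)\<in>set []. arrival (seqW \<omega>) i \<le> t) \<and> seqX \<omega> \<in> C \<and> rvTheta \<omega> \<in> space Upsilon}"
        by (auto simp: N space_OmegaI)
      also have "\<dots> \<in> sets N" by (intro gen arrivals_genI sets.top C)
      finally show "seqX -` C \<inter> space N \<in> sets N" .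
    qed (simp add: N space_OmegaI)
    show "rvTheta \<in> N \<rightarrow>\<^sub>M Upsilon"
    proof (rule measurableI)
      fix B assume B: "B \<in> sets Upsilon"
      have "rvTheta -` B \<inter> space N = {\<omega>\<in>space Omega. (\<forall>(i, t)\<in>set []. arrival (seqW \<omega>) i \<le> t) \<and> seqX \<omega> \<in> space SeqU \<and> rvTheta \<omega> \<in> B}"
        by (auto simp: N space_OmegaI)
      also have "\<dots> \<in> sets N" by (intro gen arrivals_genI sets.top B)
      finally show "rvTheta -` B \<inter> space N \<in> sets N" .
    qed (simp add: N space_OmegaI)
  qed
  then show "sets Omega \<subseteq> sigma_sets (space Omega) arrivals_gen" by (simp add: N)
qed

text \<open>On the generator \<open>arrivals_gen\<close> both measures split into a part for (W,
  \<Theta>) and a part for X. The first agrees because N determines the arrival events and its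
  conditional law depends only on g; the second because both claim sequences are i.i.d. with the law
  of the first claim.\<close>

lemma CMPP_law:
  assumes Q: "Q \<in> space (prob_algebra Omega)" and a1: "cond_a1 Q" and a2: "cond_a2 Q"
    and S: "S_is_CMPP Q g" and g: "g \<in> M_plus"
  shows "Q = cmpp_law g (lawX1 Q) (lawTheta Q)"
proof -
  note QO = prob_algebraD[OF Q]
  note m = lawX1_in_prob_algebra[OF Q] and r = lawTheta_in_prob_algebra[OF Q]
  let ?R = "cmpp_law g (lawX1 Q) (lawTheta Q)"
  note R = cmpp_law_in_prob_algebra[OF g m r]
  note RO = prob_algebraD[OF R]
  have rp: "risk_process Q" and mp: "mixed_poisson_process Q procN g" using S by (auto simp: S_is_CMPP_def)
  have S': "S_is_CMPP ?R g" by (rule S_is_CMPP_cmpp_law[OF g m r])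
  have rp': "risk_process ?R" and mp': "mixed_poisson_process ?R procN g" using S' by (auto simp: S_is_CMPP_def)
  have c: "counting_process Q procN" "counting_process ?R procN" using rp rp' by (auto simp: risk_process_def)
  have X: "emeasure M {\<omega>\<in>space Omega. seqX \<omega> \<in> C} = emeasure (distr M SeqU seqX) C"
    if "M \<in> space (prob_algebra Omega)" "C \<in> sets SeqU" for M C
  proof -
    have "seqX \<in> M \<rightarrow>\<^sub>M SeqU" using prob_algebraD[OF that(1)] by (simp cong: measurable_cong_sets)
    from emeasure_distr[OF this that(2)] show ?thesis using prob_algebraD[OF that(1)]
      by (auto intro!: arg_cong[of _ _ "emeasure M"])
  qed
  show ?thesis
  proof (rule measure_eqI_generator_eq[OF Int_stable_arrivals_gen])
    show "arrivals_gen \<subseteq> Pow (space Omega)" using arrivals_gen_sets sets.space_closed by blast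
    show "sets Q = sigma_sets (space Omega) arrivals_gen" "sets ?R = sigma_sets (space Omega) arrivals_gen"
      using QO RO sets_Omega_arrivals_gen by auto
    show "range (\<lambda>_::nat. space Omega) \<subseteq> arrivals_gen"
    proof -
      have "space Omega = {\<omega>\<in>space Omega. (\<forall>(i, t)\<in>set []. arrival (seqW \<omega>) i \<le> t) \<and> seqX \<omega> \<in> space SeqU \<and> rvTheta \<omega> \<in> space Upsilon}"
        by (auto simp: space_OmegaI)
      also have "\<dots> \<in> arrivals_gen" by (intro arrivals_genI sets.top)
      finally show ?thesis by auto
    qed
    show "(\<Union>i::nat. space Omega) = space Omega" by simp
    show "emeasure Q (space Omega) \<noteq> \<infinity>" using prob_space.emeasure_space_1[OF QO(1)] QO by simp
    fix a assume "a \<in> arrivals_gen"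
    then obtain L C B where a: "a = {\<omega>\<in>space Omega. (\<forall>(i, t)\<in>set L. arrival (seqW \<omega>) i \<le> t) \<and> seqX \<omega> \<in> C \<and> rvTheta \<omega> \<in> B}"
      and C: "C \<in> sets SeqU" and B: "B \<in> sets Upsilon" unfolding arrivals_gen_def by blast
    define A where "A = {w\<in>space SeqU. \<forall>(i, t)\<in>set L. arrival w i \<le> t}"
    have A: "A \<in> sets SeqU" unfolding A_def by measurable
    have a': "a = {\<omega>\<in>space Omega. seqW \<omega> \<in> A \<and> seqX \<omega> \<in> C \<and> rvTheta \<omega> \<in> B}"
      unfolding a A_def by (auto simp: space_OmegaI)
    have A': "{\<omega>\<in>space Omega. seqW \<omega> \<in> A \<and> rvTheta \<omega> \<in> B}
        = {\<omega>\<in>space Omega. (\<forall>(i, t)\<in>set L. arrival (seqW \<omega>) i \<le> t) \<and> rvTheta \<omega> \<in> B}"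
      unfolding A_def by (auto simp: space_OmegaI)
    have "emeasure Q {\<omega>\<in>space Omega. seqX \<omega> \<in> C} = emeasure ?R {\<omega>\<in>space Omega. seqX \<omega> \<in> C}"
      using X[OF Q C] X[OF R C] risk_process_distr_seqX[OF Q rp] distr_cmpp_law_seqX[OF g m r] by simp
    moreover have "emeasure Q {\<omega>\<in>space Omega. seqW \<omega> \<in> A \<and> rvTheta \<omega> \<in> B} = emeasure ?R {\<omega>\<in>space Omega. seqW \<omega> \<in> A \<and> rvTheta \<omega> \<in> B}"
      unfolding A' by (rule mixed_poisson_unique_arrivals[OF Q mp c(1) R mp' c(2) _ g B])
        (simp add: lawTheta_cmpp_law[OF g m r])
    ultimately show "emeasure Q a = emeasure ?R a"
      unfolding a' emeasure_indep_X[OF Q a1 a2 A C B] emeasure_cmpp_law_indep[OF g m r A C B] by simp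
  qed
qed

lemma lawX1_cmpp_law:
  assumes g: "g \<in> M_plus" and m: "m \<in> space (prob_algebra Upsilon)" and r: "r \<in> space (prob_algebra Upsilon)"
  shows "lawX1 (cmpp_law g m r) = m"
  unfolding lawX1_def
  by (rule risk_process_iidI(2)[OF cmpp_law_in_prob_algebra[OF g m r] m distr_cmpp_law_seqX[OF g m r]]) simp

section \<open>Essential uniqueness of the disintegration\<close>

definition coord :: "nat \<times> nat \<Rightarrow> outcome \<Rightarrow> real" where
  "coord c \<omega> = (if fst c = 0 then rvTheta \<omega> else if fst c = 1 then seqW \<omega> (Suc (snd c)) else seqX \<omega> (Suc (snd c)))"

text \<open>Conditions with rational bounds on finitely many of the coordinates W_n, X_n and
  \<Theta>, enumerated by \<open>coord\<close>. This gives a countable intersection-stable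
  generator, so the null sets belonging to its members have a null union.\<close>

definition rat_gen :: "outcome set set" where
  "rat_gen = range (\<lambda>L :: ((nat \<times> nat) \<times> rat) list. {\<omega>\<in>space Omega. \<forall>(c, q)\<in>set L. coord c \<omega> \<le> of_rat q})"

lemma measurable_coord: "coord c \<in> borel_measurable Omega"
proof -
  have "(\<lambda>\<omega>. seqW \<omega> (Suc k)) \<in> borel_measurable Omega" "(\<lambda>\<omega>. seqX \<omega> (Suc k)) \<in> borel_measurable Omega" for k
    by (rule measurable_UpsilonD, rule measurable_compose[OF measurable_seqW measurable_SeqU_component], simp,
        rule measurable_UpsilonD, rule measurable_compose[OF measurable_seqX measurable_SeqU_component], simp)
  moreover have "rvTheta \<in> borel_measurable Omega" by (rule measurable_UpsilonD) measurable
  ultimately show ?thesis unfolding coord_def[abs_def] by simp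
qed

lemma countable_rat_gen: "countable rat_gen"
  by (simp add: rat_gen_def)

lemma rat_gen_sets: "rat_gen \<subseteq> sets Omega"
proof -
  note [measurable] = measurable_coord
  show ?thesis unfolding rat_gen_def by (auto, measurable)
qed

lemma Int_stable_rat_gen: "Int_stable rat_gen"
proof (rule Int_stableI)
  fix a b assume "a \<in> rat_gen" "b \<in> rat_gen"
  then obtain L L' where "a = {\<omega>\<in>space Omega. \<forall>(c, q)\<in>set L. coord c \<omega> \<le> of_rat q}"
    "b = {\<omega>\<in>space Omega. \<forall>(c, q)\<in>set L'. coord c \<omega> \<le> of_rat q}" unfolding rat_gen_def by blast
  then have "a \<inter> b = {\<omega>\<in>space Omega. \<forall>(c, q)\<in>set (L @ L'). coord c \<omega> \<le> of_rat q}" by auto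
  then show "a \<inter> b \<in> rat_gen" unfolding rat_gen_def by blast
qed

lemma sets_Omega_rat_gen: "sets Omega = sigma_sets (space Omega) rat_gen"
proof (rule antisym)
  show "sigma_sets (space Omega) rat_gen \<subseteq> sets Omega"
    by (rule sets.sigma_sets_subset[OF rat_gen_sets])
  define N where "N = sigma (space Omega) rat_gen"
  have gP: "rat_gen \<subseteq> Pow (space Omega)" using rat_gen_sets sets.space_closed by blast
  have N: "space N = space Omega" "sets N = sigma_sets (space Omega) rat_gen"
    unfolding N_def using gP by (auto simp: space_measure_of)
  have cm: "coord c \<in> borel_measurable N" for c
    unfolding borel_measurable_iff_le
  proof
    fix a
    have "{\<omega>\<in>space N. coord c \<omega> \<le> of_rat q} = {\<omega>\<in>space Omega. \<forall>(c, q)\<in>set [(c, q)]. coord c \<omega> \<le> of_rat q}" for q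
      by (auto simp: N)
    then have "{\<omega>\<in>space N. coord c \<omega> \<le> of_rat q} \<in> rat_gen" for q unfolding rat_gen_def by blast
    then have 1: "{\<omega>\<in>space N. coord c \<omega> \<le> of_rat q} \<in> sets N" for q by (auto simp: N)
    have "x \<le> a \<longleftrightarrow> (\<forall>q::rat. a < of_rat q \<longrightarrow> x \<le> of_rat q)" for x :: real
    proof
      assume *: "\<forall>q::rat. a < of_rat q \<longrightarrow> x \<le> of_rat q"
      show "x \<le> a"
      proof (rule ccontr)
        assume "\<not> x \<le> a"
        then obtain q where "a < of_rat q" "of_rat q < x" using of_rat_dense[of a x] by auto
        then show False using * by fastforce
      qed
    qed auto
    then have "{\<omega>\<in>space N. coord c \<omega> \<le> a} = {\<omega>\<in>space N. \<forall>q::rat. a < of_rat q \<longrightarrow> coord c \<omega> \<le> of_rat q}"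
      by blast
    also have "\<dots> \<in> sets N"
    proof (rule sets.sets_Collect_countable_All)
      show "{\<omega>\<in>space N. a < of_rat q \<longrightarrow> coord c \<omega> \<le> of_rat q} \<in> sets N" for q
        using 1[of q] by (cases "a < of_rat q") auto
    qed
    finally show "{\<omega>\<in>space N. coord c \<omega> \<le> a} \<in> sets N" .
  qed
  have "sets Omega \<subseteq> sets N"
  proof (rule sets_Omega_subsetI[OF N(1)])
    show "rvTheta \<in> N \<rightarrow>\<^sub>M Upsilon"
      using cm[of "(0, 0)"] by (intro measurable_UpsilonI) (auto simp: coord_def[abs_def] N space_OmegaI)
    show "seqW \<in> N \<rightarrow>\<^sub>M SeqU"
    proof (rule measurable_SeqUI)
      show "\<omega> \<in> space N \<Longrightarrow> seqW \<omega> \<in> space SeqU" for \<omega> by (simp add: N space_OmegaI)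
      show "(\<lambda>\<omega>. seqW \<omega> n) \<in> N \<rightarrow>\<^sub>M Upsilon" if "1 \<le> n" for n
        using cm[of "(1, n - 1)"] that
        by (intro measurable_UpsilonI) (auto simp: coord_def[abs_def] N space_OmegaI intro: SeqU_pos)
    qed
    show "seqX \<in> N \<rightarrow>\<^sub>M SeqU"
    proof (rule measurable_SeqUI)
      show "\<omega> \<in> space N \<Longrightarrow> seqX \<omega> \<in> space SeqU" for \<omega> by (simp add: N space_OmegaI)
      show "(\<lambda>\<omega>. seqX \<omega> n) \<in> N \<rightarrow>\<^sub>M Upsilon" if "1 \<le> n" for n
        using cm[of "(2, n - 1)"] that
        by (intro measurable_UpsilonI) (auto simp: coord_def[abs_def] N space_OmegaI intro: SeqU_pos)
    qed
  qed
  then show "sets Omega \<subseteq> sigma_sets (space Omega) rat_gen" by (simp add: N)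
qed

text \<open>Consistency, applied to \<open>B\<close> and to its complement, says that almost every
  \<open>K \<theta>\<close> lives on the event that \<Theta> is in \<open>B\<close> or on its
  complement, according to whether \<theta> is in \<open>B\<close>. Without it, only the integral of
  \<open>K \<theta> D\<close> over all \<theta> would be known.\<close>

lemma rcp_integral:
  assumes Q: "Q \<in> space (prob_algebra Omega)" and K: "is_rcp Q K" "consistent_with_Theta Q K"
    and D: "D \<in> sets Omega" and B: "B \<in> sets Upsilon"
  shows "(\<integral>\<^sup>+\<theta>. emeasure (K \<theta>) D * indicator B \<theta> \<partial>lawTheta Q) = emeasure Q {\<omega>\<in>D. rvTheta \<omega> \<in> B}"
proof -
  let ?B = "rvTheta -` B \<inter> space Omega" and ?B' = "rvTheta -` (space Upsilon - B) \<inter> space Omega"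
  have BO: "?B \<in> sets Omega" and BO': "?B' \<in> sets Omega"
    by (intro measurable_sets[OF measurable_rvTheta] B sets.compl_sets)+
  have sp: "space (lawTheta Q) = {0<..}" by (simp add: lawTheta_def)
  have DB: "{\<omega>\<in>D. rvTheta \<omega> \<in> B} = D \<inter> ?B" using sets.sets_into_space[OF D] by auto
  have c: "AE \<theta> in lawTheta Q. \<theta> \<in> B \<longrightarrow> emeasure (K \<theta>) ?B = 1"
    using K(2) B unfolding consistent_with_Theta_def by blast
  have c': "AE \<theta> in lawTheta Q. \<theta> \<in> space Upsilon - B \<longrightarrow> emeasure (K \<theta>) ?B' = 1"
    using K(2) sets.compl_sets[OF B] unfolding consistent_with_Theta_def by blast
  have "AE \<theta> in lawTheta Q. emeasure (K \<theta>) (D \<inter> ?B) = emeasure (K \<theta>) D * indicator B \<theta>"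
    using c c' AE_space
  proof eventually_elim
    case (elim \<theta>)
    then have KP: "K \<theta> \<in> space (prob_algebra Omega)" using K(1) sp by (auto simp: is_rcp_def)
    note KO = prob_algebraD[OF KP]
    interpret K: prob_space "K \<theta>" by (rule KO)
    have 1: "AE \<omega> in K \<theta>. \<omega> \<in> A" if "A \<in> sets Omega" "emeasure (K \<theta>) A = 1" for A
      using that KO by (intro K.AE_prob_1) (auto simp: measure_def)
    show ?case
    proof (cases "\<theta> \<in> B")
      case True
      then have "emeasure (K \<theta>) (D \<inter> ?B) = emeasure (K \<theta>) D"
        using 1[OF BO] elim(1) D BO KO by (intro emeasure_eq_AE) auto
      then show ?thesis using True by simp
    next
      case False
      then have "AE \<omega> in K \<theta>. \<omega> \<in> ?B'" using 1[OF BO'] elim sp by auto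
      then have "emeasure (K \<theta>) (D \<inter> ?B) = emeasure (K \<theta>) {}"
        using D BO KO by (intro emeasure_eq_AE) auto
      then show ?thesis using False by simp
    qed
  qed
  then have "(\<integral>\<^sup>+\<theta>. emeasure (K \<theta>) D * indicator B \<theta> \<partial>lawTheta Q) = (\<integral>\<^sup>+\<theta>. emeasure (K \<theta>) (D \<inter> ?B) \<partial>lawTheta Q)"
    by (intro nn_integral_cong_AE) auto
  also have "\<dots> = emeasure Q (D \<inter> ?B)"
    using K(1) D BO unfolding is_rcp_def by auto
  finally show ?thesis by (simp add: DB)
qed

text \<open>For fixed \<open>D\<close>, both \<open>K \<theta> D\<close> and
  \<open>K' \<theta> D\<close> are densities with respect to the law of \<Theta> of the same
  measure, hence agree almost everywhere. This is used for the countably many \<open>D\<close> in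
  \<open>rat_gen\<close>; off one null set the measures then agree on a generator.\<close>

lemma rcp_unique:
  assumes Q: "Q \<in> space (prob_algebra Omega)"
  shows "rcp_essentially_unique Q"
  unfolding rcp_essentially_unique_def
proof (intro allI impI, elim conjE)
  fix K K' assume K: "is_rcp Q K" "consistent_with_Theta Q K" and K': "is_rcp Q K'" "consistent_with_Theta Q K'"
  interpret L: prob_space "lawTheta Q" by (rule prob_algebraD[OF lawTheta_in_prob_algebra[OF Q]])
  have sL: "sets (lawTheta Q) = sets Upsilon" by (simp add: lawTheta_def)
  have sp: "space (lawTheta Q) = {0<..}" by (simp add: lawTheta_def)
  have "AE \<theta> in lawTheta Q. emeasure (K \<theta>) D = emeasure (K' \<theta>) D" if D: "D \<in> rat_gen" for D
  proof -
    have DO: "D \<in> sets Omega" using D rat_gen_sets by auto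
    have m: "(\<lambda>\<theta>. emeasure (K \<theta>) D) \<in> borel_measurable (lawTheta Q)" "(\<lambda>\<theta>. emeasure (K' \<theta>) D) \<in> borel_measurable (lawTheta Q)"
      using K(1) K'(1) DO by (auto simp: is_rcp_def lawTheta_def)
    have "density (lawTheta Q) (\<lambda>\<theta>. emeasure (K \<theta>) D) = density (lawTheta Q) (\<lambda>\<theta>. emeasure (K' \<theta>) D)"
    proof (rule measure_eqI)
      fix B assume "B \<in> sets (density (lawTheta Q) (\<lambda>\<theta>. emeasure (K \<theta>) D))"
      then have B: "B \<in> sets Upsilon" by (simp add: sL)
      then show "emeasure (density (lawTheta Q) (\<lambda>\<theta>. emeasure (K \<theta>) D)) B = emeasure (density (lawTheta Q) (\<lambda>\<theta>. emeasure (K' \<theta>) D)) B"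
        using m rcp_integral[OF Q K DO B] rcp_integral[OF Q K' DO B] by (simp add: emeasure_density sL)
    qed simp
    then show ?thesis using L.density_unique_iff[OF m] by simp
  qed
  then have "AE \<theta> in lawTheta Q. \<forall>D\<in>rat_gen. emeasure (K \<theta>) D = emeasure (K' \<theta>) D"
    by (simp add: AE_ball_countable[OF countable_rat_gen])
  then show "AE \<theta> in lawTheta Q. K \<theta> = K' \<theta>"
    using AE_space
  proof eventually_elim
    case (elim \<theta>)
    then have KP: "K \<theta> \<in> space (prob_algebra Omega)" "K' \<theta> \<in> space (prob_algebra Omega)"
      using K(1) K'(1) sp by (auto simp: is_rcp_def)
    note KO = prob_algebraD[OF KP(1)] prob_algebraD[OF KP(2)]
    show ?case
    proof (rule measure_eqI_generator_eq[OF Int_stable_rat_gen])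
      show "rat_gen \<subseteq> Pow (space Omega)" using rat_gen_sets sets.space_closed by blast
      show "sets (K \<theta>) = sigma_sets (space Omega) rat_gen" "sets (K' \<theta>) = sigma_sets (space Omega) rat_gen"
        using KO sets_Omega_rat_gen by auto
      have "space Omega = {\<omega>\<in>space Omega. \<forall>(c, q)\<in>set []. coord c \<omega> \<le> of_rat q}" by auto
      then have "space Omega \<in> rat_gen" unfolding rat_gen_def by blast
      then show "range (\<lambda>_::nat. space Omega) \<subseteq> rat_gen" by auto
      show "(\<Union>i::nat. space Omega) = space Omega" by simp
      show "emeasure (K \<theta>) (space Omega) \<noteq> \<infinity>" using prob_space.emeasure_space_1[OF KO(1)] KO by simp
      show "emeasure (K \<theta>) D = emeasure (K' \<theta>) D" if "D \<in> rat_gen" for D using elim that by blast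
    qed
  qed
qed

section \<open>The filtration and density processes\<close>

lemma measurable_jump_sum_Omega:
  assumes "0 \<le> t" and \<phi>: "\<phi> \<in> borel_measurable Upsilon"
  shows "(\<lambda>\<omega>. \<Sum>k = 1..procN t \<omega>. \<phi> (rvX k \<omega>) :: real) \<in> borel_measurable Omega"
proof -
  have "(\<lambda>\<omega>. \<Sum>k = 1..n. \<phi> (rvX k \<omega>)) \<in> borel_measurable Omega" for n
    by (intro borel_measurable_sum measurable_compose[OF measurable_rvX \<phi>]) auto
  then show ?thesis
    by (rule measurable_compose_countable[where f="\<lambda>n \<omega>. \<Sum>k = 1..n. \<phi> (rvX k \<omega>)" and g="procN t"])
      (rule measurable_procN[OF assms(1)])
qed

lemma measurable_procS: "0 \<le> t \<Longrightarrow> procS t \<in> borel_measurable Omega"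
  unfolding procS_def[abs_def] using measurable_jump_sum_Omega[OF _ measurable_Upsilon_borel] by simp

definition filt_gen :: "real \<Rightarrow> outcome set set" where
  "filt_gen t = (\<Union>u\<in>{0..t}. {procS u -` B \<inter> space Omega | B. B \<in> sets borel})
      \<union> {rvTheta -` B \<inter> space Omega | B. B \<in> sets Upsilon}"

lemma filt_gen_Omega: "filt_gen t \<subseteq> sets Omega"
  unfolding filt_gen_def using measurable_sets[OF measurable_procS] measurable_sets[OF measurable_rvTheta]
  by auto

lemma filt_gen_Pow: "filt_gen t \<subseteq> Pow (space Omega)"
  using filt_gen_Omega sets.space_closed by blast

lemma space_filt [simp]: "space (filt t) = space Omega"
  unfolding filt_def filt_gen_def[symmetric] using filt_gen_Pow by (simp add: space_measure_of)

lemma sets_filt: "sets (filt t) = sigma_sets (space Omega) (filt_gen t)"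
  unfolding filt_def filt_gen_def[symmetric] using filt_gen_Pow by simp

lemma sets_filt_Omega: "sets (filt t) \<subseteq> sets Omega"
  unfolding sets_filt by (rule sets.sigma_sets_subset[OF filt_gen_Omega])

lemma sets_filt_mono: "s \<le> t \<Longrightarrow> sets (filt s) \<subseteq> sets (filt t)"
  unfolding sets_filt filt_gen_def by (intro sigma_sets_mono' Un_mono UN_mono) auto

lemma subalgebra_filt: "R \<in> space (prob_algebra Omega) \<Longrightarrow> subalgebra R (filt t)"
  using prob_algebraD[of R Omega] sets_filt_Omega by (auto simp: subalgebra_def)

lemma procS_filt: assumes "0 \<le> u" "u \<le> t" shows "procS u \<in> borel_measurable (filt t)"
proof (rule measurableI)
  fix B :: "real set" assume "B \<in> sets borel"
  then have "procS u -` B \<inter> space Omega \<in> filt_gen t" using assms by (auto simp: filt_gen_def)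
  then show "procS u -` B \<inter> space (filt t) \<in> sets (filt t)" by (auto simp: sets_filt)
qed simp

lemma rvTheta_filt: "rvTheta \<in> filt t \<rightarrow>\<^sub>M Upsilon"
proof (rule measurableI)
  fix B :: "real set" assume "B \<in> sets Upsilon"
  then have "rvTheta -` B \<inter> space Omega \<in> filt_gen t" by (auto simp: filt_gen_def)
  then show "rvTheta -` B \<inter> space (filt t) \<in> sets (filt t)" by (auto simp: sets_filt)
qed (simp add: space_OmegaI)

lemma rvX_pos: "\<omega> \<in> space Omega \<Longrightarrow> 1 \<le> k \<Longrightarrow> 0 < rvX k \<omega>"
  unfolding rvX_def by (rule SeqU_pos) (auto simp: space_OmegaI)

text \<open>Once the mesh of a partition of \<open>[0, t]\<close> is smaller than all the relevant waiting times, each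
  increment of \<open>S\<close> is zero or a single claim, so that a sum over the claims is a sum over the
  increments of \<open>S\<close>.\<close>

lemma jump_sum_partition:
  fixes \<phi> :: "real \<Rightarrow> real" and p :: nat
  assumes \<omega>: "\<omega> \<in> space Omega" and ex: "\<exists>n. t < arrival (seqW \<omega>) n" and t: "0 \<le> t" and p: "0 < p"
    and gap: "\<And>k. 1 \<le> k \<Longrightarrow> k \<le> procN t \<omega> \<Longrightarrow> t / p < seqW \<omega> k"
  shows "(\<Sum>j<p. let d = procS (t * Suc j / p) \<omega> - procS (t * j / p) \<omega> in if 0 < d then \<phi> d else 0)
    = (\<Sum>k = 1..procN t \<omega>. \<phi> (rvX k \<omega>))"
proof -
  let ?w = "seqW \<omega>"
  have w: "?w \<in> space SeqU" using \<omega> by (simp add: space_OmegaI)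
  define u where "u j = t * real j / p" for j :: nat
  define c where "c j = num_arrivals (u j) ?w" for j
  define \<Phi> where "\<Phi> n = (\<Sum>k = 1..n. \<phi> (rvX k \<omega>))" for n
  have u0: "0 \<le> u j" for j using t by (simp add: u_def)
  have ut: "u j \<le> t" if "j \<le> p" for j
    using that t p by (simp add: u_def field_simps mult_left_mono)
  have uS: "u (Suc j) = u j + t / p" for j using p by (simp add: u_def field_simps)
  have ex': "\<exists>n. u j < arrival ?w n" if "j \<le> p" for j using ex ut[OF that] by (meson le_less_trans)
  have step: "(let d = procS (t * Suc j / p) \<omega> - procS (t * j / p) \<omega> in if 0 < d then \<phi> d else 0)
      = \<Phi> (c (Suc j)) - \<Phi> (c j)" if j: "j < p" for j
  proof -
    have mono: "c j \<le> c (Suc j)" unfolding c_def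
      using uS[of j] t p j u0 by (intro num_arrivals_mono[OF w] ex') auto
    have cN: "c (Suc j) \<le> procN t \<omega>" unfolding c_def procN_eq
      using j u0 by (intro num_arrivals_mono[OF w ex] ut) auto
    \<comment> \<open>Two arrivals within one mesh interval would be separated by the waiting time
      of the later one. Its index is at most N_t, so \<open>gap\<close> makes it longer than the
      mesh.\<close>
    have "c (Suc j) \<le> Suc (c j)"
    proof (rule ccontr)
      assume "\<not> c (Suc j) \<le> Suc (c j)"
      then have le: "Suc (Suc (c j)) \<le> c (Suc j)" by simp
      then have "arrival ?w (Suc (Suc (c j))) \<le> u (Suc j)"
        unfolding c_def using j u0 by (subst (asm) le_num_arrivals_iff[OF w ex']) (auto simp: c_def)
      moreover have "u j < arrival ?w (Suc (c j))" unfolding c_def using j u0 by (intro arrival_num_arrivals_bounds[OF w ex']) auto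
      moreover have "arrival ?w (Suc (Suc (c j))) = arrival ?w (Suc (c j)) + ?w (Suc (Suc (c j)))" by (rule arrival_Suc)
      moreover have "t / p < ?w (Suc (Suc (c j)))" using le cN by (intro gap) auto
      ultimately show False using uS[of j] by simp
    qed
    then consider "c (Suc j) = c j" | "c (Suc j) = Suc (c j)" using mono by linarith
    then show ?thesis
    proof cases
      case 1
      then have "procS (u (Suc j)) \<omega> = procS (u j) \<omega>" unfolding procS_def procN_eq c_def[symmetric] by simp
      then show ?thesis using 1 by (simp add: u_def Let_def)
    next
      \<comment> \<open>The increment of S is the claim itself. Since claims are positive, the test
        \<open>0 < d\<close> detects the jump.\<close>
      case 2
      then have "procS (u (Suc j)) \<omega> - procS (u j) \<omega> = rvX (Suc (c j)) \<omega>"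
        unfolding procS_def procN_eq c_def[symmetric] by simp
      then show ?thesis using 2 rvX_pos[OF \<omega>, of "Suc (c j)"] by (simp add: u_def Let_def \<Phi>_def)
    qed
  qed
  have "(\<Sum>j<p. let d = procS (t * Suc j / p) \<omega> - procS (t * j / p) \<omega> in if 0 < d then \<phi> d else 0)
      = (\<Sum>j<p. \<Phi> (c (Suc j)) - \<Phi> (c j))"
    by (rule sum.cong) (use step in auto)
  also have "\<dots> = \<Phi> (c p) - \<Phi> (c 0)" by (rule sum_lessThan_telescope)
  also have "c p = procN t \<omega>" using p by (simp add: c_def u_def procN_eq)
  also have "c 0 = 0" by (simp add: c_def u_def num_arrivals_0[OF w])
  finally show ?thesis by (simp add: \<Phi>_def)
qed

lemma procS_pos_iff:
  assumes \<omega>: "\<omega> \<in> space Omega" shows "0 < procS t \<omega> \<longleftrightarrow> 0 < procN t \<omega>"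
proof
  assume "0 < procN t \<omega>"
  then show "0 < procS t \<omega>" unfolding procS_def using rvX_pos[OF \<omega>] by (intro sum_pos) auto
qed (auto simp: procS_def intro: ccontr)

text \<open>The sums \<open>V p\<close> use S at finitely many times up to \<open>t\<close> and are
  therefore measurable for the filtration. On every path with N_t > 0 they are eventually constant
  in \<open>p\<close>, with the sum over the claims as final value. The case
  \<open>\<phi> = 1\<close> shows that N_t is measurable for \<F>_t.\<close>

lemma jump_sum_filt:
  assumes t: "0 \<le> t" and \<phi>: "\<phi> \<in> borel_measurable Upsilon"
  shows "(\<lambda>\<omega>. \<Sum>k = 1..procN t \<omega>. \<phi> (rvX k \<omega>) :: real) \<in> borel_measurable (filt t)"
proof -
  define \<psi> where "\<psi> x = (if 0 < x then \<phi> x else 0)" for x :: real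
  have \<psi>[measurable]: "\<psi> \<in> borel_measurable borel"
  proof -
    have "(\<lambda>x. indicator {0<..} x *\<^sub>R \<phi> x) \<in> borel_measurable borel"
      using \<phi> unfolding Upsilon_def by (subst borel_measurable_restrict_space_iff[symmetric]) auto
    moreover have "(\<lambda>x. indicator {0<..} x *\<^sub>R \<phi> x) = \<psi>" by (auto simp: \<psi>_def indicator_def)
    ultimately show ?thesis by simp
  qed
  define V where "V p \<omega> = (\<Sum>j<p. \<psi> (procS (t * real (Suc j) / real p) \<omega> - procS (t * real j / real p) \<omega>))" for p \<omega>
  have V[measurable]: "V p \<in> borel_measurable (filt t)" for p
    unfolding V_def
  proof (intro borel_measurable_sum)
    fix j assume "j \<in> {..<p}"
    then have "real (Suc j) \<le> real p" "real j \<le> real p" and p: "0 < real p" by auto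
    then have "t * real (Suc j) \<le> t * real p" "t * real j \<le> t * real p"
      using t by (auto intro!: mult_left_mono)
    then have "t * real (Suc j) / real p \<le> t" "t * real j / real p \<le> t"
      using p by (simp_all only: pos_divide_le_eq)
    then have [measurable]: "procS (t * real (Suc j) / real p) \<in> borel_measurable (filt t)"
      "procS (t * real j / real p) \<in> borel_measurable (filt t)"
      using t by (auto intro!: procS_filt)
    show "(\<lambda>\<omega>. \<psi> (procS (t * real (Suc j) / real p) \<omega> - procS (t * real j / real p) \<omega>)) \<in> borel_measurable (filt t)"
      by measurable
  qed
  have [measurable]: "procS t \<in> borel_measurable (filt t)" using t by (intro procS_filt) auto
  \<comment> \<open>Where S_t = 0 the guard supplies the empty sum. This includes paths that explode
    by time \<open>t\<close>: there N_t = 0 by convention, although earlier increments of S need not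
    vanish.\<close>
  have "(\<lambda>\<omega>. if 0 < procS t \<omega> then lim (\<lambda>p. V p \<omega>) else 0) \<in> borel_measurable (filt t)"
    by measurable
  then show ?thesis
  proof (rule measurable_cong[THEN iffD1, rotated])
    fix \<omega> assume "\<omega> \<in> space (filt t)"
    then have \<omega>: "\<omega> \<in> space Omega" by simp
    then have w: "seqW \<omega> \<in> space SeqU" by (simp add: space_OmegaI)
    show "(if 0 < procS t \<omega> then lim (\<lambda>p. V p \<omega>) else 0) = (\<Sum>k = 1..procN t \<omega>. \<phi> (rvX k \<omega>))"
    proof (cases "procN t \<omega> = 0")
      case True
      then have "\<not> 0 < procS t \<omega>" using procS_pos_iff[OF \<omega>, of t] by simp
      then show ?thesis using True by simp
    next
      case False
      have ex: "\<exists>n. t < arrival (seqW \<omega>) n"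
      proof (rule ccontr)
        assume "\<nexists>n. t < arrival (seqW \<omega>) n"
        then have "num_arrivals t (seqW \<omega>) = 0" using num_arrivals_alt[OF w t] by (simp add: not_less)
        then show False using False by (simp add: procN_eq)
      qed
      \<comment> \<open>The shortest of the first N_t waiting times. Partitions with mesh
        \<open>t / p\<close> below it isolate the claims.\<close>
      define \<delta> where "\<delta> = Min (seqW \<omega> ` {1..procN t \<omega>})"
      have fin: "finite (seqW \<omega> ` {1..procN t \<omega>})" "seqW \<omega> ` {1..procN t \<omega>} \<noteq> {}" using False by auto
      have \<delta>: "0 < \<delta>" unfolding \<delta>_def using fin SeqU_pos[OF w] by (subst Min_gr_iff) auto
      obtain p0 :: nat where p0: "t / \<delta> < real p0" using reals_Archimedean2 by blast
      have "V p \<omega> = (\<Sum>k = 1..procN t \<omega>. \<phi> (rvX k \<omega>))" if p: "p \<ge> max 1 p0" for p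
      proof -
        have p': "0 < p" "t / \<delta> < p" using p p0 by (auto intro: less_le_trans)
        then have "t / p < \<delta>" using \<delta> by (simp add: field_simps)
        then have gap: "t / p < seqW \<omega> k" if "1 \<le> k" "k \<le> procN t \<omega>" for k
          using Min_le[OF fin(1), of "seqW \<omega> k"] that unfolding \<delta>_def by fastforce
        show ?thesis
          using jump_sum_partition[OF \<omega> ex t p'(1) gap, of \<phi>] by (simp add: V_def \<psi>_def Let_def)
      qed
      then have "(\<lambda>p. V p \<omega>) \<longlonglongrightarrow> (\<Sum>k = 1..procN t \<omega>. \<phi> (rvX k \<omega>))"
        by (intro tendsto_eventually) (auto simp: eventually_sequentially intro!: exI[of _ "max 1 p0"])
      then have "lim (\<lambda>p. V p \<omega>) = (\<Sum>k = 1..procN t \<omega>. \<phi> (rvX k \<omega>))" by (rule limI)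
      then show ?thesis using False procS_pos_iff[OF \<omega>, of t] by simp
    qed
  qed
qed

lemma procN_filt: "0 \<le> t \<Longrightarrow> (\<lambda>\<omega>. real (procN t \<omega>)) \<in> borel_measurable (filt t)"
  using jump_sum_filt[of t "\<lambda>_. 1"] by simp

text \<open>The three conclusions all come from the same identities. For \<open>A\<close> in \<F>_s
  both M_s and M_t integrate over \<open>A\<close> to Q(A), which is the martingale property; the
  case of the whole space gives integrability; and positivity of M_t makes the null sets in \<F>_t
  coincide.\<close>

lemma density_process:
  assumes Q: "Q \<in> space (prob_algebra Omega)" and R: "R \<in> space (prob_algebra Omega)"
    and M: "\<And>t. 0 \<le> t \<Longrightarrow> M t \<in> borel_measurable (filt t)"
    and nn: "\<And>t. 0 \<le> t \<Longrightarrow> AE \<omega> in R. 0 < M t \<omega>"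
    and eq: "\<And>t A. 0 \<le> t \<Longrightarrow> A \<in> sets (filt t) \<Longrightarrow> emeasure Q A = (\<integral>\<^sup>+\<omega>. ennreal (M t \<omega>) * indicator A \<omega> \<partial>R)"
  shows "density_identity Q R M" "martingale_L1 R M" "progressively_equivalent Q R"
proof -
  note QO = prob_algebraD[OF Q] and RO = prob_algebraD[OF R]
  interpret Q: prob_space Q by (rule QO)
  interpret R: prob_space R by (rule RO)
  have MR: "M t \<in> borel_measurable R" if "0 \<le> t" for t
    by (rule measurable_from_subalg[OF subalgebra_filt[OF R] M[OF that]])
  have AR: "A \<in> sets R" if "A \<in> sets (filt t)" for A t using sets_filt_Omega RO that by auto
  have int: "integrable R (M t)" if t: "0 \<le> t" for t
  proof (rule integrableI_nonneg[OF MR[OF t]])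
    show "AE \<omega> in R. 0 \<le> M t \<omega>" using nn[OF t] by auto
    have "(\<integral>\<^sup>+\<omega>. ennreal (M t \<omega>) \<partial>R) = (\<integral>\<^sup>+\<omega>. ennreal (M t \<omega>) * indicator (space Omega) \<omega> \<partial>R)"
      using RO by (intro nn_integral_cong) auto
    also have "\<dots> = emeasure Q (space Omega)" using eq[OF t, of "space Omega"] sets.top[of "filt t"] by simp
    finally show "(\<integral>\<^sup>+\<omega>. ennreal (M t \<omega>) \<partial>R) < \<infinity>" by (simp add: Q.emeasure_eq_measure)
  qed
  have id: "measure Q A = (\<integral>\<omega>\<in>A. M t \<omega> \<partial>R)" if t: "0 \<le> t" and A: "A \<in> sets (filt t)" for t A
  proof -
    have iA: "integrable R (\<lambda>\<omega>. indicator A \<omega> *\<^sub>R M t \<omega>)"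
      by (rule integrable_mult_indicator[OF AR[OF A] int[OF t]])
    have nA: "AE \<omega> in R. 0 \<le> indicator A \<omega> *\<^sub>R M t \<omega>" using nn[OF t] by (auto simp: indicator_def)
    have "ennreal (measure Q A) = (\<integral>\<^sup>+\<omega>. ennreal (M t \<omega>) * indicator A \<omega> \<partial>R)"
      using eq[OF t A] by (simp add: Q.emeasure_eq_measure)
    also have "\<dots> = (\<integral>\<^sup>+\<omega>. ennreal (indicator A \<omega> *\<^sub>R M t \<omega>) \<partial>R)"
      by (intro nn_integral_cong) (auto simp: indicator_def)
    also have "\<dots> = ennreal (\<integral>\<omega>\<in>A. M t \<omega> \<partial>R)"
      unfolding set_lebesgue_integral_def by (rule nn_integral_eq_integral[OF iA nA])
    finally show ?thesis
      using integral_nonneg_AE[OF nA] by (simp add: set_lebesgue_integral_def)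
  qed
  show "density_identity Q R M"
    unfolding density_identity_def
  proof (intro allI impI ballI)
    fix s t :: real and A assume "0 \<le> s \<and> s \<le> t" "A \<in> sets (filt s)"
    then show "measure Q A = (\<integral>\<omega>\<in>A. M t \<omega> \<partial>R)" using sets_filt_mono[of s t] by (intro id) auto
  qed
  show "martingale_L1 R M"
    unfolding martingale_L1_def
  proof (intro conjI allI impI)
    fix t :: real assume "0 \<le> t"
    then show "M t \<in> borel_measurable (filt t)" "integrable R (M t)" using M int by auto
  next
    fix s t :: real assume st: "0 \<le> s \<and> s \<le> t"
    interpret finite_measure_subalgebra R "filt s" by unfold_locales (rule subalgebra_filt[OF R])
    show "AE \<omega> in R. real_cond_exp R (filt s) (M t) \<omega> = M s \<omega>"
    proof (rule real_cond_exp_charact)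
      fix A assume A: "A \<in> sets (filt s)"
      then have "A \<in> sets (filt t)" using sets_filt_mono st by blast
      then show "(\<integral>\<omega>\<in>A. M t \<omega> \<partial>R) = (\<integral>\<omega>\<in>A. M s \<omega> \<partial>R)" using id[of t A] id[of s A] A st by simp
    qed (use int M st in auto)
  qed
  have null: "emeasure Q A = 0 \<longleftrightarrow> emeasure R A = 0" if t: "0 \<le> t" and A: "A \<in> sets (filt t)" for t A
  proof -
    have "emeasure Q A = 0 \<longleftrightarrow> (AE \<omega> in R. ennreal (M t \<omega>) * indicator A \<omega> = 0)"
      unfolding eq[OF t A] using MR[OF t] AR[OF A]
      by (intro nn_integral_0_iff_AE borel_measurable_times_ennreal borel_measurable_indicator) auto
    also have "\<dots> \<longleftrightarrow> (AE \<omega> in R. \<omega> \<notin> A)"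
    proof
      assume "AE \<omega> in R. ennreal (M t \<omega>) * indicator A \<omega> = 0"
      then show "AE \<omega> in R. \<omega> \<notin> A" using nn[OF t] by eventually_elim (auto simp: indicator_def split: if_splits)
    qed (auto elim: eventually_mono)
    also have "\<dots> \<longleftrightarrow> emeasure R A = 0"
    proof -
      have "{\<omega>\<in>space R. \<not> \<omega> \<notin> A} = A" using sets.sets_into_space[OF AR[OF A]] by auto
      then show ?thesis using AR[OF A] AE_iff_measurable[of A R "\<lambda>\<omega>. \<omega> \<notin> A"] by simp
    qed
    finally show ?thesis .
  qed
  show "progressively_equivalent Q R"
    unfolding progressively_equivalent_def absolutely_continuous_def
  proof (intro allI impI conjI subsetI)
    fix t :: real and A assume t: "0 \<le> t"
    note sQ = subalgebra_filt[OF Q] and sR = subalgebra_filt[OF R]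
    { assume "A \<in> null_sets (restr_to_subalg Q (filt t))"
      then show "A \<in> null_sets (restr_to_subalg R (filt t))"
        using null[OF t, of A] by (auto simp: null_sets_def sets_restr_to_subalg[OF sQ] sets_restr_to_subalg[OF sR]
            emeasure_restr_to_subalg[OF sQ] emeasure_restr_to_subalg[OF sR]) }
    { assume "A \<in> null_sets (restr_to_subalg R (filt t))"
      then show "A \<in> null_sets (restr_to_subalg Q (filt t))"
        using null[OF t, of A] by (auto simp: null_sets_def sets_restr_to_subalg[OF sQ] sets_restr_to_subalg[OF sR]
            emeasure_restr_to_subalg[OF sQ] emeasure_restr_to_subalg[OF sR]) }
  qed
qed

lemma progressively_equivalentD:
  assumes Q: "Q \<in> space (prob_algebra Omega)" and R: "R \<in> space (prob_algebra Omega)"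
    and pe: "progressively_equivalent Q R" and t: "0 \<le> t" and A: "A \<in> sets (filt t)"
  shows "emeasure Q A = 0 \<longleftrightarrow> emeasure R A = 0"
proof -
  note sQ = subalgebra_filt[OF Q] and sR = subalgebra_filt[OF R]
  have "A \<in> null_sets (restr_to_subalg Q (filt t)) \<longleftrightarrow> A \<in> null_sets (restr_to_subalg R (filt t))"
    using pe t unfolding progressively_equivalent_def absolutely_continuous_def by blast
  then show ?thesis using A
    by (simp add: null_sets_def sets_restr_to_subalg[OF sQ] sets_restr_to_subalg[OF sR]
            emeasure_restr_to_subalg[OF sQ A] emeasure_restr_to_subalg[OF sR A])
qed

section \<open>Change of measure for compound Poisson processes\<close>

lemma Ioi_sets_Upsilon [simp]: "{0<..} \<in> sets Upsilon"
  by (simp add: sets_Upsilon)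

lemma nn_integral_iid_prod:
  assumes m: "m \<in> space (prob_algebra Upsilon)" and h: "\<And>k. h k \<in> borel_measurable Upsilon"
  shows "(\<integral>\<^sup>+x. (\<Prod>k=1..n. h k (x k)) \<partial>iid_seq m) = (\<Prod>k=1..n. \<integral>\<^sup>+y. h k y \<partial>m)"
proof -
  note mO = prob_algebraD[OF m]
  interpret P: product_prob_space "\<lambda>_::nat. m" "{1..}"
    using mO by (intro product_prob_spaceI) auto
  have hm: "h k \<in> borel_measurable m" for k using h mO by (simp cong: measurable_cong_sets)
  have F: "(\<lambda>x. \<Prod>k=1..n. h k (x k)) \<in> borel_measurable (\<Pi>\<^sub>M k\<in>{1..n}. m)"
  proof (rule borel_measurable_prod_ennreal)
    fix k assume "k \<in> {1..n}"
    then have "(\<lambda>x. x k) \<in> (\<Pi>\<^sub>M k\<in>{1..n}. m) \<rightarrow>\<^sub>M m" by (rule measurable_component_singleton)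
    from measurable_compose[OF this hm] show "(\<lambda>x. h k (x k)) \<in> borel_measurable (\<Pi>\<^sub>M k\<in>{1..n}. m)" .
  qed
  have "(\<integral>\<^sup>+x. (\<Prod>k=1..n. h k (x k)) \<partial>iid_seq m) = (\<integral>\<^sup>+x. (\<Prod>k=1..n. h k (restrict x {1..n} k)) \<partial>iid_seq m)"
    by (intro nn_integral_cong prod.cong) auto
  also have "\<dots> = (\<integral>\<^sup>+x. (\<Prod>k=1..n. h k (x k)) \<partial>distr (iid_seq m) (\<Pi>\<^sub>M k\<in>{1..n}. m) (\<lambda>x. restrict x {1..n}))"
    unfolding iid_seq_def using F
    by (intro nn_integral_distr[symmetric] measurable_restrict_subset) auto
  also have "distr (iid_seq m) (\<Pi>\<^sub>M k\<in>{1..n}. m) (\<lambda>x. restrict x {1..n}) = (\<Pi>\<^sub>M k\<in>{1..n}. m)"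
    unfolding iid_seq_def by (rule P.distr_PiM_restrict_finite) auto
  also have "(\<integral>\<^sup>+x. (\<Prod>k=1..n. h k (x k)) \<partial>(\<Pi>\<^sub>M k\<in>{1..n}. m)) = (\<Prod>k=1..n. \<integral>\<^sup>+y. h k y \<partial>m)"
    by (rule P.product_nn_integral_prod) (use hm in auto)
  finally show ?thesis .
qed

text \<open>The ratio of Poisson weights when the mean is multiplied by \<open>exp a\<close>: each
  arrival contributes \<open>exp a\<close>, and the normalising factors contribute the compensator
  \<open>exp (- r * (exp a - 1))\<close>. This is where the exponent of the density comes
  from.\<close>

lemma poisI_scale:
  assumes "0 \<le> r"
  shows "pmf (poisI (r * exp a)) j = exp (a * of_int j - r * (exp a - 1)) * pmf (poisI r) j"
proof (cases "0 \<le> j")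
  case True
  define k where "k = nat j"
  have j: "of_int j = real k" using True by (simp add: k_def)
  have "exp (a * real k - r * (exp a - 1)) * exp (- r) = exp (a * real k + - (r * exp a))"
    by (simp add: algebra_simps flip: exp_add)
  also have "\<dots> = exp a ^ k * exp (- (r * exp a))"
    by (simp only: exp_add exp_of_nat2_mult)
  finally have E: "exp (a * real k - r * (exp a - 1)) * exp (- r) = exp a ^ k * exp (- (r * exp a))" .
  have "pois (r * exp a) k = r ^ k / fact k * (exp a ^ k * exp (- (r * exp a)))"
    by (simp add: pois_def power_mult_distrib)
  also have "\<dots> = exp (a * real k - r * (exp a - 1)) * pois r k"
    unfolding E[symmetric] pois_def by (simp only: ac_simps)
  finally show ?thesis
    using True assms by (simp add: pmf_poisI k_def[symmetric] j)
qed (use assms in \<open>simp add: pmf_poisI\<close>)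

text \<open>Along a partition the ratios of the Poisson weights multiply and their exponents
  telescope, so the total ratio depends only on \<open>t\<close> and on the value of N_t. The
  condition \<open>t \<in> J\<close> makes the event fix this value.\<close>

lemma emeasure_num_arrivals_scale:
  assumes l: "0 < l" and J: "finite J" "J \<subseteq> {0..t}" "t \<in> J"
  shows "emeasure (expo_seq (l * exp a)) {w\<in>space SeqU. \<forall>u\<in>J. num_arrivals u w = \<nu> u}
    = ennreal (exp (a * real (\<nu> t) - t * l * (exp a - 1))) * emeasure (expo_seq l) {w\<in>space SeqU. \<forall>u\<in>J. num_arrivals u w = \<nu> u}"
proof (cases "0 \<in> J \<longrightarrow> \<nu> 0 = 0")
  case False
  then have "{w\<in>space SeqU. \<forall>u\<in>J. num_arrivals u w = \<nu> u} = {}" using num_arrivals_0 by fastforce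
  then show ?thesis by (simp only: emeasure_empty mult_zero_right)
next
  case True
  have J0: "J \<subseteq> {0..}" using J by auto
  have t0: "0 \<le> t" using J by auto
  obtain \<sigma> N k where \<sigma>: "\<sigma> 0 = 0" "\<And>i. i < N \<Longrightarrow> \<sigma> i < \<sigma> (Suc i)" "\<sigma> N = Max (insert 0 J)"
    and k0: "k 0 = 0" and kN: "\<sigma> N \<in> J \<Longrightarrow> k N = \<nu> (\<sigma> N)"
    and eqJ: "\<And>\<omega>. \<omega> \<in> space Omega \<Longrightarrow> (\<forall>u\<in>J. procN u \<omega> = \<nu> u) \<longleftrightarrow>
       (\<forall>i<N. increment procN (\<sigma> i) (\<sigma> (Suc i)) \<omega> = int (k (Suc i)) - int (k i))"
  proof (rule times_event_increments[where \<nu>=\<nu>, OF J(1) J0 True], goal_cases)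
    case (1 \<sigma> N k)
    show ?case by (rule 1(1)[of \<sigma> N k, OF 1(2-7)])
  qed
  have \<sigma>N: "\<sigma> N = t" unfolding \<sigma>(3) using J t0 by (intro Max_eqI) auto
  define j where "j i = int (k (Suc i)) - int (k i)" for i
  \<comment> \<open>An auxiliary claim law: only arrivals matter here, and embedding them into some
    \<open>cpp_law\<close> allows its increment formula to be applied.\<close>
  define \<mu> where "\<mu> = return Upsilon 1"
  have \<mu>: "\<mu> \<in> space (prob_algebra Upsilon)" by (simp add: \<mu>_def space_prob_algebra prob_space_return)
  let ?A = "{w\<in>space SeqU. \<forall>u\<in>J. num_arrivals u w = \<nu> u}"
  have A: "?A \<in> sets SeqU"
  proof (rule sets.sets_Collect_finite_All)
    fix u assume "u \<in> J"
    then have [measurable]: "num_arrivals u \<in> SeqU \<rightarrow>\<^sub>M count_space UNIV" using J0 by (intro measurable_num_arrivals) auto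
    show "{w\<in>space SeqU. num_arrivals u w = \<nu> u} \<in> sets SeqU" by measurable
  qed (rule J)
  have ev: "emeasure (expo_seq r) ?A = ennreal (\<Prod>i<N. pmf (poisI (r * (\<sigma> (Suc i) - \<sigma> i))) (j i))" if r: "0 < r" for r
  proof -
    have mW: "seqW \<in> cpp_law r \<mu> 1 \<rightarrow>\<^sub>M SeqU" by (rule measurable_cpp_lawI[OF \<mu> measurable_seqW])
    have "seqW -` ?A \<inter> space (cpp_law r \<mu> 1)
       = {\<omega>\<in>space (cpp_law r \<mu> 1). \<forall>i\<in>{..<N}. increment procN (\<sigma> i) (\<sigma> (Suc i)) \<omega> = j i}"
      using eqJ by (auto simp: space_cpp_law[OF \<mu>] space_OmegaI procN_eq j_def)
    then have "emeasure (expo_seq r) ?A = emeasure (cpp_law r \<mu> 1)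
        {\<omega>\<in>space (cpp_law r \<mu> 1). \<forall>i\<in>{..<N}. increment procN (\<sigma> i) (\<sigma> (Suc i)) \<omega> = j i}"
      using emeasure_distr[OF mW A] by (simp add: distr_cpp_law_seqW[OF \<mu> r zero_less_one])
    also have "\<dots> = ennreal (\<Prod>i<N. pmf (poisI (r * (\<sigma> (Suc i) - \<sigma> i))) (j i))"
      by (rule emeasure_cpp_law_increments[where \<sigma>=\<sigma>, OF \<mu> r zero_less_one \<sigma>(1)]) (use \<sigma>(2) in \<open>simp add: less_imp_le\<close>)
    finally show ?thesis .
  qed
  have "(\<Prod>i<N. pmf (poisI (l * exp a * (\<sigma> (Suc i) - \<sigma> i))) (j i))
     = (\<Prod>i<N. exp (a * of_int (j i) - l * (\<sigma> (Suc i) - \<sigma> i) * (exp a - 1)) * pmf (poisI (l * (\<sigma> (Suc i) - \<sigma> i))) (j i))"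
  proof (rule prod.cong[OF refl])
    fix i assume "i \<in> {..<N}"
    then have "0 \<le> l * (\<sigma> (Suc i) - \<sigma> i)" using \<sigma>(2)[of i] l by simp
    from poisI_scale[OF this, of a "j i"]
    show "pmf (poisI (l * exp a * (\<sigma> (Suc i) - \<sigma> i))) (j i)
      = exp (a * of_int (j i) - l * (\<sigma> (Suc i) - \<sigma> i) * (exp a - 1)) * pmf (poisI (l * (\<sigma> (Suc i) - \<sigma> i))) (j i)"
      by (simp add: ac_simps)
  qed
  also have "\<dots> = exp (\<Sum>i<N. a * of_int (j i) - l * (\<sigma> (Suc i) - \<sigma> i) * (exp a - 1)) * (\<Prod>i<N. pmf (poisI (l * (\<sigma> (Suc i) - \<sigma> i))) (j i))"
    by (simp add: prod.distrib exp_sum)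
  also have "(\<Sum>i<N. a * of_int (j i) - l * (\<sigma> (Suc i) - \<sigma> i) * (exp a - 1))
      = (\<Sum>i<N. a * (real (k (Suc i)) - real (k i))) - (\<Sum>i<N. l * (exp a - 1) * (\<sigma> (Suc i) - \<sigma> i))"
    unfolding sum_subtractf[symmetric] by (rule sum.cong) (auto simp: j_def ac_simps)
  also have "\<dots> = a * (\<Sum>i<N. real (k (Suc i)) - real (k i)) - l * (exp a - 1) * (\<Sum>i<N. \<sigma> (Suc i) - \<sigma> i)"
    by (simp only: sum_distrib_left)
  also have "\<dots> = a * real (\<nu> t) - t * l * (exp a - 1)"
  proof -
    have "(\<Sum>i<N. real (k (Suc i)) - real (k i)) = real (k N) - real (k 0)"
      by (rule sum_lessThan_telescope)
    moreover have "k N = \<nu> t" using kN J(3) \<sigma>N by simp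
    moreover have "(\<Sum>i<N. \<sigma> (Suc i) - \<sigma> i) = \<sigma> N - \<sigma> 0" by (rule sum_lessThan_telescope)
    ultimately show ?thesis using k0 \<sigma>(1) \<sigma>N by (simp only:) simp
  qed
  finally show ?thesis
    using ev[of l] ev[of "l * exp a"] l by (simp add: ennreal_mult' mult.assoc)
qed

text \<open>A generator of (a \<open>\<sigma>\<close>-algebra containing) \<open>\<F>\<^sub>t\<close>: an entry \<open>(u, n, C)\<close> of the list asks for \<open>n\<close>
  arrivals up to time \<open>u\<close>, with claims in \<open>C 1, \<dots>, C n\<close>. Only claims made up to time \<open>t\<close> are
  constrained, since the density at time \<open>t\<close> only changes the law of these.\<close>

definition claims_event :: "(real \<times> nat \<times> (nat \<Rightarrow> real set)) list \<Rightarrow> real set \<Rightarrow> outcome set" where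
  "claims_event L B = {\<omega>\<in>space Omega. (\<forall>(u, n, C)\<in>set L. procN u \<omega> = n \<and> (\<forall>k\<in>{1..n}. rvX k \<omega> \<in> C k)) \<and> rvTheta \<omega> \<in> B}"

text \<open>Some entry is at time \<open>t\<close> itself, so that each event fixes N_t, and with it
  the number of claims that enter the density at time \<open>t\<close>.\<close>

definition claims_list :: "real \<Rightarrow> (real \<times> nat \<times> (nat \<Rightarrow> real set)) list \<Rightarrow> bool" where
  "claims_list t L \<longleftrightarrow> (\<forall>(u, n, C)\<in>set L. 0 \<le> u \<and> u \<le> t \<and> (\<forall>k. C k \<in> sets Upsilon)) \<and> (\<exists>(u, n, C)\<in>set L. u = t)"

definition claims_gen :: "real \<Rightarrow> outcome set set" where
  "claims_gen t = {claims_event L B | L B. claims_list t L \<and> B \<in> sets Upsilon}"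

lemma Int_stable_claims_gen: "Int_stable (claims_gen t)"
proof (rule Int_stableI)
  fix a b assume "a \<in> claims_gen t" "b \<in> claims_gen t"
  then obtain L B L' B' where "a = claims_event L B" "b = claims_event L' B'" "claims_list t L" "claims_list t L'"
    "B \<in> sets Upsilon" "B' \<in> sets Upsilon" unfolding claims_gen_def by blast
  moreover have "claims_event L B \<inter> claims_event L' B' = claims_event (L @ L') (B \<inter> B')"
    unfolding claims_event_def set_append ball_Un by blast
  moreover have "claims_list t (L @ L')" using \<open>claims_list t L\<close> \<open>claims_list t L'\<close> by (auto simp: claims_list_def)
  ultimately show "a \<inter> b \<in> claims_gen t" unfolding claims_gen_def by blast
qed

lemma claims_event_sets:
  assumes "claims_list t L" "B \<in> sets Upsilon" shows "claims_event L B \<in> sets Omega"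
proof -
  have 1: "{\<omega>\<in>space Omega. \<forall>z\<in>set L. case z of (u, n, C) \<Rightarrow> procN u \<omega> = n \<and> (\<forall>k\<in>{1..n}. rvX k \<omega> \<in> C k)} \<in> sets Omega"
  proof (rule sets.sets_Collect_finite_All)
    fix z assume z: "z \<in> set L"
    obtain u n C where zz: "z = (u, n, C)" by (cases z)
    have u: "0 \<le> u" and C: "\<And>k. C k \<in> sets Upsilon" using assms z zz by (auto simp: claims_list_def)
    have [measurable]: "procN u \<in> Omega \<rightarrow>\<^sub>M count_space UNIV" by (rule measurable_procN[OF u])
    have 1: "{\<omega>\<in>space Omega. procN u \<omega> = n} \<in> sets Omega" by measurable
    have 2: "{\<omega>\<in>space Omega. \<forall>k\<in>{1..n}. rvX k \<omega> \<in> C k} \<in> sets Omega"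
    proof (rule sets.sets_Collect_finite_All)
      fix k assume "k \<in> {1..n}"
      then have "rvX k -` C k \<inter> space Omega \<in> sets Omega" using C by (intro measurable_sets[OF measurable_rvX]) auto
      moreover have "rvX k -` C k \<inter> space Omega = {\<omega>\<in>space Omega. rvX k \<omega> \<in> C k}" by auto
      ultimately show "{\<omega>\<in>space Omega. rvX k \<omega> \<in> C k} \<in> sets Omega" by metis
    qed simp
    show "{\<omega>\<in>space Omega. case z of (u, n, C) \<Rightarrow> procN u \<omega> = n \<and> (\<forall>k\<in>{1..n}. rvX k \<omega> \<in> C k)} \<in> sets Omega"
      unfolding zz using sets.sets_Collect_conj[OF 2 1] by simp
  qed simp
  have "claims_event L B = {\<omega>\<in>space Omega. \<forall>z\<in>set L. case z of (u, n, C) \<Rightarrow> procN u \<omega> = n \<and> (\<forall>k\<in>{1..n}. rvX k \<omega> \<in> C k)}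
     \<inter> (rvTheta -` B \<inter> space Omega)" by (auto simp: claims_event_def)
  then show ?thesis using 1 measurable_sets[OF measurable_rvTheta assms(2)] by simp
qed

lemma claims_gen_sets: "claims_gen t \<subseteq> sets Omega"
  unfolding claims_gen_def using claims_event_sets by blast

text \<open>Members of the generator have to fix N_t, so events that leave it free are recovered as
  countable unions over its possible values. S_u is then assembled from N_u and the claims counted
  by it.\<close>

lemma filt_subset_claims_gen:
  assumes t: "0 \<le> t" shows "sets (filt t) \<subseteq> sigma_sets (space Omega) (claims_gen t)"
proof -
  define N where "N = sigma (space Omega) (claims_gen t)"
  have gP: "claims_gen t \<subseteq> Pow (space Omega)" using claims_gen_sets sets.space_closed by blast
  have N: "space N = space Omega" "sets N = sigma_sets (space Omega) (claims_gen t)"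
    unfolding N_def using gP by (auto simp: space_measure_of)
  have ev: "claims_event L B \<in> sets N" if "claims_list t L" "B \<in> sets Upsilon" for L B
  proof -
    have "claims_event L B \<in> claims_gen t" using that unfolding claims_gen_def by blast
    then show ?thesis by (auto simp: N)
  qed
  let ?U = "\<lambda>_::nat. space Upsilon"
  have trivX: "\<omega> \<in> space Omega \<Longrightarrow> 1 \<le> k \<Longrightarrow> rvX k \<omega> \<in> space Upsilon" for \<omega> k
    using rvX_pos by auto
  have B: "rvTheta -` B \<inter> space Omega \<in> sets N" if "B \<in> sets Upsilon" for B
  proof -
    have "rvTheta -` B \<inter> space Omega = (\<Union>m. claims_event [(t, m, ?U)] B)"
      using trivX by (auto simp: claims_event_def)
    also have "\<dots> \<in> sets N" using that t by (intro sets.countable_UN) (auto intro!: ev simp: claims_list_def)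
    finally show ?thesis .
  qed
  have NX: "{\<omega>\<in>space Omega. procN u \<omega> = n \<and> rvX k \<omega> \<in> C} \<in> sets N"
    if u: "0 \<le> u" "u \<le> t" and k: "1 \<le> k" "k \<le> n" and C: "C \<in> sets Upsilon" for u n k C
  proof -
    let ?C = "\<lambda>i. if i = k then C else space Upsilon"
    have "{\<omega>\<in>space Omega. procN u \<omega> = n \<and> rvX k \<omega> \<in> C} = (\<Union>m. claims_event [(u, n, ?C), (t, m, ?U)] (space Upsilon))"
      using trivX k by (auto simp: claims_event_def space_OmegaI)
    also have "\<dots> \<in> sets N" using u t C by (intro sets.countable_UN) (auto intro!: ev sets.top simp: claims_list_def simp del: space_Upsilon)
    finally show ?thesis .
  qed
  have Nu: "{\<omega>\<in>space Omega. procN u \<omega> = n} \<in> sets N" if u: "0 \<le> u" "u \<le> t" for u n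
  proof -
    have "{\<omega>\<in>space Omega. procN u \<omega> = n} = (\<Union>m. claims_event [(u, n, ?U), (t, m, ?U)] (space Upsilon))"
      using trivX by (auto simp: claims_event_def space_OmegaI)
    also have "\<dots> \<in> sets N" using u t by (intro sets.countable_UN) (auto intro!: ev sets.top simp: claims_list_def simp del: space_Upsilon)
    finally show ?thesis .
  qed
  have S: "procS u \<in> borel_measurable N" if u: "0 \<le> u" "u \<le> t" for u
  proof -
    have Nm: "procN u \<in> N \<rightarrow>\<^sub>M count_space UNIV"
      using Nu[OF u] by (intro measurable_count_space_eq2_countable[THEN iffD2]) (auto simp: N vimage_def Int_def conj_commute)
    \<comment> \<open>Claim number \<open>k\<close> is not determined by time \<open>t\<close> if
      fewer than \<open>k\<close> arrivals have occurred. It is therefore only used on the event N_u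
      = n with \<open>k \<le> n\<close> and replaced by 0 elsewhere.\<close>
    have Y: "(\<lambda>\<omega>. if procN u \<omega> = n then rvX k \<omega> else 0) \<in> borel_measurable N" if k: "k \<in> {1..n}" for n k
    proof (rule measurableI)
      fix A :: "real set" assume A: "A \<in> sets borel"
      have C: "A \<inter> {0<..} \<in> sets Upsilon" using A by (auto simp: sets_Upsilon)
      have "(\<lambda>\<omega>. if procN u \<omega> = n then rvX k \<omega> else 0) -` A \<inter> space N
         = {\<omega>\<in>space Omega. procN u \<omega> = n \<and> rvX k \<omega> \<in> A \<inter> {0<..}} \<union> (if 0 \<in> A then space Omega - {\<omega>\<in>space Omega. procN u \<omega> = n} else {})"
        using rvX_pos k by (auto simp: N split: if_splits)
      also have "\<dots> \<in> sets N"
        using NX[OF u _ _ C, of k n] k Nu[OF u, of n] sets.top[of N] by (auto simp: N(1))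
      finally show "(\<lambda>\<omega>. if procN u \<omega> = n then rvX k \<omega> else 0) -` A \<inter> space N \<in> sets N" .
    qed simp
    \<comment> \<open>Substituting N_u for \<open>n\<close> in the truncated sums leaves a trivially
      true test, which simplification removes.\<close>
    have "(\<lambda>\<omega>. \<Sum>k = 1..procN u \<omega>. if procN u \<omega> = procN u \<omega> then rvX k \<omega> else 0) \<in> borel_measurable N"
      by (rule measurable_compose_countable[where f="\<lambda>n \<omega>. \<Sum>k = 1..n. if procN u \<omega> = n then rvX k \<omega> else 0" and g="procN u", OF _ Nm])
        (intro borel_measurable_sum Y)
    then show ?thesis by (simp add: procS_def[abs_def])
  qed
  have "filt_gen t \<subseteq> sets N"
    unfolding filt_gen_def using measurable_sets[OF S] B by (auto simp: N(1))
  then show ?thesis unfolding sets_filt N(2)[symmetric] using sets.sigma_sets_subset[of "filt_gen t" N] by (simp add: N(1))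
qed

text \<open>The density process with its parameters frozen: \<open>a\<close> stands for
  \<alpha>(\<theta>) and \<open>l\<close> for the original rate \<theta>. Freezing them at \<theta>
  gives \<open>M_tilde\<close>; inserting \<Theta> and multiplying by \<xi>(\<Theta>) gives
  \<open>M_beta\<close>.\<close>

definition level_density :: "(real \<Rightarrow> real) \<Rightarrow> real \<Rightarrow> real \<Rightarrow> real \<Rightarrow> outcome \<Rightarrow> real" where
  "level_density \<gamma> a l t \<omega> = exp ((\<Sum>k = 1..procN t \<omega>. a + \<gamma> (rvX k \<omega>)) - t * l * (exp a - 1))"

lemma level_density_filt:
  assumes "0 \<le> t" "\<gamma> \<in> borel_measurable Upsilon"
  shows "level_density \<gamma> a l t \<in> borel_measurable (filt t)"
proof -
  have "(\<lambda>x. a + \<gamma> x) \<in> borel_measurable Upsilon" using assms by measurable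
  from jump_sum_filt[OF assms(1) this] show ?thesis unfolding level_density_def[abs_def] by measurable
qed

text \<open>Up to a null set the event is a rectangle: \<open>A\<close> prescribes arrivals with N_t
  = M, and \<open>CC\<close> restricts the first M claims. The change of rate multiplies the mass of
  \<open>A\<close> by a constant, the change of claim law inserts the factors
  \<open>exp (\<gamma> (x k))\<close> for k up to M, and on the event the product of the two is the
  density.\<close>

lemma emeasure_level_density_event:
  assumes m: "m \<in> space (prob_algebra Upsilon)" and l: "0 < l" and \<theta>: "0 < \<theta>" and t: "0 \<le> t"
    and \<gamma>: "\<gamma> \<in> borel_measurable Upsilon" and m': "density m (\<lambda>x. ennreal (exp (\<gamma> x))) \<in> space (prob_algebra Upsilon)"
    and L: "claims_list t L" and B: "B \<in> sets Upsilon"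
  shows "emeasure (cpp_law (l * exp a) (density m (\<lambda>x. ennreal (exp (\<gamma> x)))) \<theta>) (claims_event L B)
    = (\<integral>\<^sup>+\<omega>. ennreal (level_density \<gamma> a l t \<omega>) * indicator (claims_event L B) \<omega> \<partial>cpp_law l m \<theta>)"
proof -
  let ?m' = "density m (\<lambda>x. ennreal (exp (\<gamma> x)))"
  let ?l' = "l * exp a"
  have l': "0 < ?l'" using l by simp
  note mO = prob_algebraD[OF m]
  obtain M C0 where M: "(t, M, C0) \<in> set L" using L by (auto simp: claims_list_def)
  define J where "J = fst ` set L"
  have J: "finite J" "J \<subseteq> {0..t}" "t \<in> J" using L M by (force simp: J_def claims_list_def)+
  define A where "A = {w\<in>space SeqU. \<forall>(u, n, C)\<in>set L. num_arrivals u w = n}"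
  \<comment> \<open>All conditions on claim number \<open>k\<close> gathered from the list. An entry
    with \<open>n < k\<close> imposes none.\<close>
  define D where "D k = {x\<in>space Upsilon. \<forall>(u, n, C)\<in>set L. k \<le> n \<longrightarrow> x \<in> C k}" for k
  define CC where "CC = {x\<in>space SeqU. \<forall>k\<in>{1..M}. x k \<in> D k}"
  have D: "D k \<in> sets Upsilon" for k
    unfolding D_def
  proof (rule sets.sets_Collect_finite_All)
    fix z assume z: "z \<in> set L"
    obtain u n C where zz: "z = (u, n, C)" by (cases z)
    have "C k \<in> sets Upsilon" using L z zz by (auto simp: claims_list_def)
    moreover have "{x\<in>space Upsilon. case z of (u, n, C) \<Rightarrow> k \<le> n \<longrightarrow> x \<in> C k} = (if k \<le> n then C k else space Upsilon)"
      using sets.sets_into_space[OF calculation] by (auto simp: zz)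
    ultimately show "{x\<in>space Upsilon. case z of (u, n, C) \<Rightarrow> k \<le> n \<longrightarrow> x \<in> C k} \<in> sets Upsilon"
      by (simp del: space_Upsilon)
  qed simp
  have CC: "CC \<in> sets SeqU"
    unfolding CC_def
  proof (rule sets.sets_Collect_finite_All)
    fix k assume "k \<in> {1..M}"
    then have "(\<lambda>x. x k) -` D k \<inter> space SeqU \<in> sets SeqU" by (intro measurable_sets[OF measurable_SeqU_component] D) auto
    moreover have "(\<lambda>x. x k) -` D k \<inter> space SeqU = {x\<in>space SeqU. x k \<in> D k}" by auto
    ultimately show "{x\<in>space SeqU. x k \<in> D k} \<in> sets SeqU" by metis
  qed simp
  have A: "A \<in> sets SeqU"
    unfolding A_def
  proof (rule sets.sets_Collect_finite_All)
    fix z assume z: "z \<in> set L"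
    obtain u n C where zz: "z = (u, n, C)" by (cases z)
    have "0 \<le> u" using L z zz by (auto simp: claims_list_def)
    then have [measurable]: "num_arrivals u \<in> SeqU \<rightarrow>\<^sub>M count_space UNIV" by (rule measurable_num_arrivals)
    have "{w\<in>space SeqU. num_arrivals u w = n} \<in> sets SeqU" by measurable
    then show "{w\<in>space SeqU. case z of (u, n, C) \<Rightarrow> num_arrivals u w = n} \<in> sets SeqU" by (simp add: zz)
  qed simp
  have event: "AE \<omega> in cpp_law r \<mu>' \<theta>. \<omega> \<in> claims_event L B \<longleftrightarrow> seqW \<omega> \<in> A \<and> seqX \<omega> \<in> CC \<and> rvTheta \<omega> \<in> B"
    if \<mu>': "\<mu>' \<in> space (prob_algebra Upsilon)" and r: "0 < r" for \<mu>' r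
    using AE_cpp_law_seqW[OF \<mu>' r \<theta> AE_nonexploding[OF r]] AE_space
  proof eventually_elim
    case (elim \<omega>)
    then have \<omega>: "\<omega> \<in> space Omega" by (simp add: space_cpp_law[OF \<mu>'])
    then have w: "seqW \<omega> \<in> space SeqU" and x: "seqX \<omega> \<in> space SeqU" by (auto simp: space_OmegaI)
    have "(\<forall>(u, n, C)\<in>set L. procN u \<omega> = n \<and> (\<forall>k\<in>{1..n}. rvX k \<omega> \<in> C k)) \<longleftrightarrow> seqW \<omega> \<in> A \<and> seqX \<omega> \<in> CC"
      (is "?lhs \<longleftrightarrow> ?rhs")
    proof
      assume l: ?lhs
      then have "seqW \<omega> \<in> A" using w by (auto simp: A_def procN_eq)
      moreover have "seqX \<omega> k \<in> D k" if "k \<in> {1..M}" for k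
        using l that SeqU_pos[OF x, of k] by (auto simp: D_def rvX_def)
      ultimately show ?rhs using x by (simp add: CC_def)
    next
      assume r: ?rhs
      have N: "procN u \<omega> = n" if "(u, n, C) \<in> set L" for u n C using r that by (auto simp: A_def procN_eq)
      show ?lhs
      proof (intro ballI, clarify, intro conjI ballI)
        fix u n C assume uL: "(u, n, C) \<in> set L"
        show "procN u \<omega> = n" by (rule N[OF uL])
        fix k assume k: "k \<in> {1..n}"
        have "0 \<le> u" "u \<le> t" using L uL by (auto simp: claims_list_def)
        then have "num_arrivals u (seqW \<omega>) \<le> num_arrivals t (seqW \<omega>)" by (intro num_arrivals_mono[OF w nonexplodingD[OF elim(1)]])
        \<comment> \<open>Monotonicity of N, valid off explosion, ensures that every claim
          constrained by an earlier entry is among the first M.\<close>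
        then have "n \<le> M" using N[OF uL] N[OF M] by (simp add: procN_eq)
        then have "seqX \<omega> k \<in> D k" using r k by (simp add: CC_def)
        then show "rvX k \<omega> \<in> C k" using uL k by (auto simp: D_def rvX_def)
      qed
    qed
    then show ?case using \<omega> by (auto simp: claims_event_def)
  qed
  have evO: "claims_event L B \<in> sets Omega" by (rule claims_event_sets[OF L B])
  have rectO: "{\<omega>\<in>space Omega. seqW \<omega> \<in> A \<and> seqX \<omega> \<in> CC \<and> rvTheta \<omega> \<in> B} \<in> sets Omega"
    using A CC B by measurable
  \<comment> \<open>The list may contradict itself by asking for different counts at one time, which
    makes \<open>A\<close> empty. Otherwise any element of \<open>A\<close> supplies a consistent
    function prescribing the values of N.\<close>
  have expo: "emeasure (expo_seq ?l') A = ennreal (exp (a * real M - t * l * (exp a - 1))) * emeasure (expo_seq l) A"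
  proof (cases "A = {}")
    case False
    then obtain w0 where w0: "w0 \<in> A" by auto
    then have w0n: "\<And>u n C. (u, n, C) \<in> set L \<Longrightarrow> num_arrivals u w0 = n" by (auto simp: A_def)
    have "A = {w\<in>space SeqU. \<forall>u\<in>J. num_arrivals u w = num_arrivals u w0}"
      unfolding A_def J_def using w0n by fastforce
    then show ?thesis using emeasure_num_arrivals_scale[OF l J, of a "\<lambda>u. num_arrivals u w0"] w0n[OF M] by simp
  qed simp
  have iid': "emeasure (iid_seq ?m') CC = (\<integral>\<^sup>+x. (\<Prod>k=1..M. indicator (D k) (x k) * ennreal (exp (\<gamma> (x k)))) \<partial>iid_seq m)"
  proof -
    have ind: "indicator CC x = (\<Prod>k=1..M. indicator (D k) (x k) :: ennreal)" if x: "x \<in> space SeqU" for x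
    proof (cases "x \<in> CC")
      case True then show ?thesis by (auto simp: CC_def)
    next
      case False
      then obtain k where "k \<in> {1..M}" "x k \<notin> D k" using x by (auto simp: CC_def)
      then have "(\<Prod>k=1..M. indicator (D k) (x k) :: ennreal) = 0" by (intro prod_zero bexI[of _ k]) auto
      then show ?thesis using False by simp
    qed
    have sp: "space (iid_seq ?m') = space SeqU" using sets_eq_imp_space_eq[OF sets_iid[OF m']] .
    have "emeasure (iid_seq ?m') CC = (\<integral>\<^sup>+x. indicator CC x \<partial>iid_seq ?m')"
      using CC sets_iid[OF m'] by simp
    also have "\<dots> = (\<integral>\<^sup>+x. (\<Prod>k=1..M. indicator (D k) (x k)) \<partial>iid_seq ?m')"
      by (rule nn_integral_cong) (simp add: ind sp)
    also have "\<dots> = (\<Prod>k=1..M. \<integral>\<^sup>+y. indicator (D k) y \<partial>?m')"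
      by (rule nn_integral_iid_prod[OF m']) (rule borel_measurable_indicator[OF D])
    also have "\<dots> = (\<Prod>k=1..M. \<integral>\<^sup>+y. indicator (D k) y * ennreal (exp (\<gamma> y)) \<partial>m)"
    proof (rule prod.cong[OF refl])
      fix k
      have g: "(\<lambda>x. ennreal (exp (\<gamma> x))) \<in> borel_measurable m" using \<gamma> mO by (auto cong: measurable_cong_sets)
      have i: "indicator (D k) \<in> borel_measurable m" using D mO by auto
      show "(\<integral>\<^sup>+y. indicator (D k) y \<partial>?m') = (\<integral>\<^sup>+y. indicator (D k) y * ennreal (exp (\<gamma> y)) \<partial>m)"
        by (subst nn_integral_density[OF g i]) (simp add: mult.commute)
    qed
    also have "\<dots> = (\<integral>\<^sup>+x. (\<Prod>k=1..M. indicator (D k) (x k) * ennreal (exp (\<gamma> (x k)))) \<partial>iid_seq m)"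
      by (rule nn_integral_iid_prod[OF m, symmetric])
        (use D \<gamma> in \<open>auto intro!: borel_measurable_times_ennreal borel_measurable_indicator\<close>)
    finally show ?thesis .
  qed
  define c where "c = ennreal (exp (a * real M - t * l * (exp a - 1)))"
  define v where "v x = (\<Prod>k=1..M. indicator (D k) (x k) * ennreal (exp (\<gamma> (x k))))" for x :: "nat \<Rightarrow> real"
  have v: "v \<in> borel_measurable SeqU" unfolding v_def[abs_def]
  proof (intro borel_measurable_prod_ennreal)
    fix k assume "k \<in> {1..M}"
    then show "(\<lambda>x. indicator (D k) (x k) * ennreal (exp (\<gamma> (x k)))) \<in> borel_measurable SeqU"
      using D \<gamma> by (intro measurable_compose[OF measurable_SeqU_component, where g="\<lambda>y. indicator (D k) y * ennreal (exp (\<gamma> y))"]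
          borel_measurable_times_ennreal borel_measurable_indicator) auto
  qed
  have "emeasure (cpp_law ?l' ?m' \<theta>) (claims_event L B)
     = emeasure (cpp_law ?l' ?m' \<theta>) {\<omega>\<in>space Omega. seqW \<omega> \<in> A \<and> seqX \<omega> \<in> CC \<and> rvTheta \<omega> \<in> B}"
    using event[OF m' l'] AE_space evO rectO
    by (intro emeasure_eq_AE) (auto simp: sets_cpp_law[OF m'] space_cpp_law[OF m'])
  also have "\<dots> = emeasure (expo_seq ?l') A * emeasure (iid_seq ?m') CC * indicator B \<theta>"
    by (rule emeasure_cpp_law_rect[OF m' l' \<theta> A CC B])
  also have "\<dots> = (c * indicator B \<theta>) * (emeasure (expo_seq l) A * (\<integral>\<^sup>+x. v x \<partial>iid_seq m))"
    unfolding expo iid' c_def v_def by (simp add: ac_simps)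
  also have "emeasure (expo_seq l) A * (\<integral>\<^sup>+x. v x \<partial>iid_seq m) = (\<integral>\<^sup>+\<omega>. indicator A (seqW \<omega>) * v (seqX \<omega>) \<partial>cpp_law l m \<theta>)"
    using nn_integral_cpp_law[OF m l \<theta> borel_measurable_indicator[OF A] v] A by simp
  also have "(c * indicator B \<theta>) * \<dots> = (\<integral>\<^sup>+\<omega>. (c * indicator B \<theta>) * (indicator A (seqW \<omega>) * v (seqX \<omega>)) \<partial>cpp_law l m \<theta>)"
    using A v by (intro nn_integral_cmult[symmetric] measurable_cpp_lawI[OF m] borel_measurable_times_ennreal
        measurable_compose[OF measurable_seqW] measurable_compose[OF measurable_seqX]) auto
  also have "\<dots> = (\<integral>\<^sup>+\<omega>. ennreal (level_density \<gamma> a l t \<omega>) * indicator (claims_event L B) \<omega> \<partial>cpp_law l m \<theta>)"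
  proof (rule nn_integral_cong_AE)
    show "AE \<omega> in cpp_law l m \<theta>. (c * indicator B \<theta>) * (indicator A (seqW \<omega>) * v (seqX \<omega>))
        = ennreal (level_density \<gamma> a l t \<omega>) * indicator (claims_event L B) \<omega>"
      using event[OF m l] AE_cpp_law_rvTheta[OF m l \<theta>] AE_space
    proof eventually_elim
      case (elim \<omega>)
      then have \<omega>: "\<omega> \<in> space Omega" by (simp add: space_cpp_law[OF m])
      show ?case
      proof (cases "\<omega> \<in> claims_event L B")
        case True
        then have *: "seqW \<omega> \<in> A" "seqX \<omega> \<in> CC" "\<theta> \<in> B" using elim by auto
        then have NM: "procN t \<omega> = M" using M by (auto simp: A_def procN_eq)
        have "v (seqX \<omega>) = (\<Prod>k=1..M. ennreal (exp (\<gamma> (rvX k \<omega>))))"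
          unfolding v_def using * by (intro prod.cong) (auto simp: CC_def rvX_def)
        also have "\<dots> = ennreal (exp (\<Sum>k=1..M. \<gamma> (rvX k \<omega>)))"
          by (simp add: prod_ennreal exp_sum)
        finally have "c * v (seqX \<omega>) = ennreal (level_density \<gamma> a l t \<omega>)"
          unfolding c_def level_density_def NM
          by (simp add: ennreal_mult'[symmetric] sum.distrib mult.commute flip: exp_add)
        then show ?thesis using True * by simp
      next
        case False
        then have "(indicator B \<theta> :: ennreal) * (indicator A (seqW \<omega>) * v (seqX \<omega>)) = 0"
        proof (cases "seqX \<omega> \<in> CC")
          case F: False
          have "seqX \<omega> \<in> space SeqU" using \<omega> by (simp add: space_OmegaI)
          then obtain k where "k \<in> {1..M}" "seqX \<omega> k \<notin> D k" using F by (auto simp: CC_def)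
          then have "v (seqX \<omega>) = 0" unfolding v_def by (intro prod_zero bexI[of _ k]) auto
          then show ?thesis by simp
        qed (use elim in \<open>auto simp: indicator_def\<close>)
        then show ?thesis using False by (simp add: mult.assoc)
      qed
    qed
  qed
  finally show ?thesis .
qed

text \<open>Both sides are measures on the \<sigma>-algebra generated by
  \<open>claims_gen t\<close>, agree on that generator and are therefore equal there. This
  \<sigma>-algebra contains \<F>_t.\<close>

lemma emeasure_level_density:
  assumes m: "m \<in> space (prob_algebra Upsilon)" and l: "0 < l" and \<theta>: "0 < \<theta>" and t: "0 \<le> t"
    and \<gamma>: "\<gamma> \<in> borel_measurable Upsilon" and m': "density m (\<lambda>x. ennreal (exp (\<gamma> x))) \<in> space (prob_algebra Upsilon)"
    and A: "A \<in> sets (filt t)"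
  shows "emeasure (cpp_law (l * exp a) (density m (\<lambda>x. ennreal (exp (\<gamma> x)))) \<theta>) A
    = (\<integral>\<^sup>+\<omega>. ennreal (level_density \<gamma> a l t \<omega>) * indicator A \<omega> \<partial>cpp_law l m \<theta>)"
proof -
  let ?K' = "cpp_law (l * exp a) (density m (\<lambda>x. ennreal (exp (\<gamma> x)))) \<theta>"
  let ?K = "density (cpp_law l m \<theta>) (\<lambda>\<omega>. ennreal (level_density \<gamma> a l t \<omega>))"
  define N where "N = sigma (space Omega) (claims_gen t)"
  have gP: "claims_gen t \<subseteq> Pow (space Omega)" using claims_gen_sets sets.space_closed by blast
  have N: "space N = space Omega" "sets N = sigma_sets (space Omega) (claims_gen t)"
    unfolding N_def using gP by (auto simp: space_measure_of)
  have NO: "sets N \<subseteq> sets Omega" unfolding N by (rule sets.sigma_sets_subset[OF claims_gen_sets])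
  have AN: "A \<in> sets N" using filt_subset_claims_gen[OF t] A by (auto simp: N)
  have s': "subalgebra ?K' N" using NO N by (simp add: subalgebra_def sets_cpp_law[OF m'] space_cpp_law[OF m'])
  have s: "subalgebra ?K N" using NO N by (simp add: subalgebra_def sets_cpp_law[OF m] space_cpp_law[OF m])
  interpret K': prob_space ?K' using l by (intro prob_space_cpp_law[OF m' _ \<theta>]) simp
  have md: "(\<lambda>\<omega>. ennreal (level_density \<gamma> a l t \<omega>)) \<in> borel_measurable (cpp_law l m \<theta>)"
    using measurable_from_subalg[OF subalgebra_filt level_density_filt[OF t \<gamma>]] cpp_law_in_prob_algebra[OF m l \<theta>] by auto
  have dens: "emeasure ?K E = (\<integral>\<^sup>+\<omega>. ennreal (level_density \<gamma> a l t \<omega>) * indicator E \<omega> \<partial>cpp_law l m \<theta>)"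
    if "E \<in> sets Omega" for E using that by (intro emeasure_density[OF md]) (simp add: sets_cpp_law[OF m])
  have "restr_to_subalg ?K' N = restr_to_subalg ?K N"
  proof (rule measure_eqI_generator_eq[OF Int_stable_claims_gen gP])
    show "sets (restr_to_subalg ?K' N) = sigma_sets (space Omega) (claims_gen t)"
      "sets (restr_to_subalg ?K N) = sigma_sets (space Omega) (claims_gen t)"
      by (simp_all add: sets_restr_to_subalg[OF s'] sets_restr_to_subalg[OF s] N)
    \<comment> \<open>Events of the generator fix N_t, so the space is exhausted by the countably
      many events N_t = n, each of finite mass.\<close>
    let ?E = "\<lambda>n::nat. claims_event [(t, n, \<lambda>_. space Upsilon)] (space Upsilon)"
    have E: "?E n \<in> claims_gen t" for n
      unfolding claims_gen_def using t by (intro CollectI exI conjI refl) (auto simp: claims_list_def)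
    then show "range ?E \<subseteq> claims_gen t" by blast
    show "(\<Union>n. ?E n) = space Omega" using rvX_pos by (auto simp: claims_event_def space_OmegaI)
    show "emeasure (restr_to_subalg ?K' N) (?E n) \<noteq> \<infinity>" for n
    proof -
      have "?E n \<in> sets N" using E by (auto simp: N)
      then show ?thesis by (simp add: emeasure_restr_to_subalg[OF s'])
    qed
    fix E assume E: "E \<in> claims_gen t"
    then have EN: "E \<in> sets N" and EO: "E \<in> sets Omega" using claims_gen_sets by (auto simp: N)
    obtain L B where "E = claims_event L B" "claims_list t L" "B \<in> sets Upsilon" using E unfolding claims_gen_def by blast
    then show "emeasure (restr_to_subalg ?K' N) E = emeasure (restr_to_subalg ?K N) E"
      unfolding emeasure_restr_to_subalg[OF s' EN] emeasure_restr_to_subalg[OF s EN] dens[OF EO]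
      using emeasure_level_density_event[OF m l \<theta> t \<gamma> m', of L B a] by simp
  qed
  then have "emeasure ?K' A = emeasure ?K A"
    using emeasure_restr_to_subalg[OF s' AN] emeasure_restr_to_subalg[OF s AN] by simp
  then show ?thesis using dens NO AN by auto
qed

section \<open>Change of measure for compound mixed Poisson processes\<close>

lemma has_bochner_integral_distr_iff:
  assumes Y: "Y \<in> R \<rightarrow>\<^sub>M Upsilon" and h: "h \<in> borel_measurable Upsilon" and nn: "AE x in distr R Upsilon Y. 0 \<le> h x"
  shows "has_bochner_integral R (\<lambda>\<omega>. h (Y \<omega>)) 1 \<longleftrightarrow> (\<integral>\<^sup>+x. ennreal (h x) \<partial>distr R Upsilon Y) = 1"
proof -
  have hY: "(\<lambda>\<omega>. h (Y \<omega>)) \<in> borel_measurable R" by (rule measurable_compose[OF Y h])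
  have nY: "AE \<omega> in R. 0 \<le> h (Y \<omega>)" by (rule AE_distrD[OF Y nn])
  have eq: "(\<integral>\<^sup>+x. ennreal (h x) \<partial>distr R Upsilon Y) = (\<integral>\<^sup>+\<omega>. ennreal (h (Y \<omega>)) \<partial>R)"
    using h by (intro nn_integral_distr[OF Y]) simp
  show ?thesis
  proof
    assume *: "has_bochner_integral R (\<lambda>\<omega>. h (Y \<omega>)) 1"
    then have "(\<integral>\<^sup>+\<omega>. ennreal (h (Y \<omega>)) \<partial>R) = ennreal (\<integral>\<omega>. h (Y \<omega>) \<partial>R)"
      by (intro nn_integral_eq_integral nY has_bochner_integral_integrable integrable.intros)
    then show "(\<integral>\<^sup>+x. ennreal (h x) \<partial>distr R Upsilon Y) = 1"
      using has_bochner_integral_integral_eq[OF *] eq by simp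
  next
    assume "(\<integral>\<^sup>+x. ennreal (h x) \<partial>distr R Upsilon Y) = 1"
    then show "has_bochner_integral R (\<lambda>\<omega>. h (Y \<omega>)) 1"
      using eq by (intro has_bochner_integral_nn_integral hY nY) auto
  qed
qed

lemma density_in_prob_algebra:
  assumes "m \<in> space (prob_algebra Upsilon)" "h \<in> borel_measurable Upsilon" "(\<integral>\<^sup>+x. ennreal (h x) \<partial>m) = 1"
  shows "density m (\<lambda>x. ennreal (h x)) \<in> space (prob_algebra Upsilon)"
proof -
  note m = prob_algebraD[OF assms(1)]
  have h: "(\<lambda>x. ennreal (h x)) \<in> borel_measurable m" using assms(2) m by (simp cong: measurable_cong_sets)
  have "emeasure (density m (\<lambda>x. ennreal (h x))) (space m) = (\<integral>\<^sup>+x. ennreal (h x) \<partial>m)"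
    by (subst emeasure_density[OF h sets.top]) (auto intro!: nn_integral_cong)
  then have "prob_space (density m (\<lambda>x. ennreal (h x)))" using assms(3) by (intro prob_spaceI) simp
  then show ?thesis using m by (simp add: space_prob_algebra)
qed

text \<open>The derivative is positive almost everywhere for \<open>N\<close>; absolute continuity
  of \<open>M\<close> with respect to \<open>N\<close> transfers this to \<open>M\<close>. Strict
  positivity is needed for \<open>R_plus\<close> and for taking the logarithm.\<close>

lemma prob_algebra_RN:
  assumes M: "M \<in> space (prob_algebra Upsilon)" and N: "N \<in> space (prob_algebra Upsilon)"
    and null: "\<And>B. B \<in> sets Upsilon \<Longrightarrow> emeasure M B = 0 \<longleftrightarrow> emeasure N B = 0"
  obtains D where "D \<in> borel_measurable Upsilon" "\<And>x. 0 \<le> D x" "AE x in M. 0 < D x" "N = density M (\<lambda>x. ennreal (D x))"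
proof -
  note MO = prob_algebraD[OF M] and NO = prob_algebraD[OF N]
  interpret M: prob_space M by (rule MO)
  interpret N: prob_space N by (rule NO)
  have sets: "sets N = sets M" using MO NO by simp
  have ac: "absolutely_continuous M N" "absolutely_continuous N M"
    using null MO NO by (auto simp: absolutely_continuous_def null_sets_def)
  obtain D where D: "D \<in> borel_measurable M" "AE x in M. RN_deriv M N x = ennreal (D x)" "AE x in N. 0 < D x" "\<And>x. 0 \<le> D x"
    using M.real_RN_deriv[OF N.finite_measure_axioms ac(1) sets] by metis
  show thesis
  proof (rule that)
    show "D \<in> borel_measurable Upsilon" using D(1) MO by (simp cong: measurable_cong_sets)
    show "AE x in M. 0 < D x" by (rule absolutely_continuous_AE[OF sets[symmetric] ac(2) D(3)])
    have "N = density M (RN_deriv M N)" using M.density_RN_deriv[OF ac(1) sets] by simp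
    also have "\<dots> = density M (\<lambda>x. ennreal (D x))" using D by (intro density_cong) auto
    finally show "N = density M (\<lambda>x. ennreal (D x))" .
  qed (rule D(4))
qed

text \<open>\<Theta> is measurable already for the filtration at time 0, so equivalence there is
  enough.\<close>

lemma lawTheta_null_iff:
  assumes Q: "Q \<in> space (prob_algebra Omega)" and R: "R \<in> space (prob_algebra Omega)"
    and pe: "progressively_equivalent Q R" and B: "B \<in> sets Upsilon"
  shows "emeasure (lawTheta R) B = 0 \<longleftrightarrow> emeasure (lawTheta Q) B = 0"
proof -
  have "rvTheta -` B \<inter> space (filt 0) \<in> sets (filt 0)" by (rule measurable_sets[OF rvTheta_filt B])
  moreover have "rvTheta -` B \<inter> space (filt 0) = {\<omega>\<in>space Omega. rvTheta \<omega> \<in> B}" by auto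
  ultimately show ?thesis
    using progressively_equivalentD[OF Q R pe order_refl] by (simp add: emeasure_lawTheta[OF Q B] emeasure_lawTheta[OF R B])
qed

text \<open>The event that some claim made up to time \<open>m\<close> falls into \<open>B\<close> belongs to \<open>\<F>\<^sub>m\<close>; it
  eventually occurs if the first claim is in \<open>B\<close>.\<close>

lemma lawX1_null:
  assumes Q: "Q \<in> space (prob_algebra Omega)" and R: "R \<in> space (prob_algebra Omega)"
    and null: "\<And>t A. 0 \<le> t \<Longrightarrow> A \<in> sets (filt t) \<Longrightarrow> emeasure R A = 0 \<Longrightarrow> emeasure Q A = 0"
    and rR: "risk_process R" and rQ: "risk_process Q" and B: "B \<in> sets Upsilon" and R0: "emeasure (lawX1 R) B = 0"
  shows "emeasure (lawX1 Q) B = 0"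
proof -
  note QO = prob_algebraD[OF Q] and RO = prob_algebraD[OF R]
  have XM: "rvX k \<in> M \<rightarrow>\<^sub>M Upsilon" if "M \<in> space (prob_algebra Omega)" "1 \<le> k" for M k
    using measurable_rvX[OF that(2)] prob_algebraD[OF that(1)] by (simp cong: measurable_cong_sets)
  have "AE \<omega> in R. rvX (Suc k) \<omega> \<notin> B" for k
  proof -
    have "distr R Upsilon (rvX (Suc k)) = lawX1 R"
      using rR[unfolded risk_process_def, THEN conjunct2, THEN conjunct2, THEN conjunct1, rule_format, of "Suc k"]
      by (simp add: lawX1_def)
    then have "emeasure R (rvX (Suc k) -` B \<inter> space R) = 0"
      using R0 emeasure_distr[OF XM[OF R, of "Suc k"] B] by simp
    then show ?thesis
      using measurable_sets[OF XM[OF R, of "Suc k"] B]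
      by (intro AE_I[of _ _ "rvX (Suc k) -` B \<inter> space R"]) auto
  qed
  \<comment> \<open>All claims share the law of the first, so under \<open>R\<close> almost surely
    none of them is in \<open>B\<close>, whichever of them have been made by a given time.\<close>
  then have AER: "AE \<omega> in R. \<forall>k. rvX (Suc k) \<omega> \<notin> B" by (simp add: AE_all_countable)
  define E where "E m = {\<omega>\<in>space Omega. 0 < (\<Sum>k = 1..procN (real m) \<omega>. indicator B (rvX k \<omega>) :: real)}" for m :: nat
  have Em: "E m \<in> sets (filt m)" for m
  proof -
    have "(\<lambda>\<omega>. \<Sum>k = 1..procN (real m) \<omega>. indicator B (rvX k \<omega>) :: real) -` {0<..} \<inter> space (filt m) \<in> sets (filt m)"
      using B by (intro measurable_sets[OF jump_sum_filt]) auto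
    moreover have "(\<lambda>\<omega>. \<Sum>k = 1..procN (real m) \<omega>. indicator B (rvX k \<omega>) :: real) -` {0<..} \<inter> space (filt m) = E m"
      by (auto simp: E_def)
    ultimately show ?thesis by simp
  qed
  have EO: "E m \<in> sets Omega" for m using Em sets_filt_Omega by blast
  have "AE \<omega> in Q. \<omega> \<notin> E m" for m
  proof -
    have "AE \<omega> in R. \<omega> \<notin> E m"
      using AER
    proof eventually_elim
      case (elim \<omega>)
      have "indicator B (rvX k \<omega>) = (0::real)" if "k \<in> {1..procN (real m) \<omega>}" for k
        using elim that by (cases k) auto
      then show ?case by (simp add: E_def)
    qed
    then have "emeasure R (E m) = 0"
      using EO[of m] RO sets.sets_into_space[OF EO[of m]]
      by (subst (asm) AE_iff_measurable[of "E m"]) auto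
    then have "emeasure Q (E m) = 0" using null[OF _ Em[of m]] by simp
    then show ?thesis using EO[of m] QO by (intro AE_I[of _ _ "E m"]) auto
  qed
  then have "AE \<omega> in Q. \<forall>m. \<omega> \<notin> E m" by (simp add: AE_all_countable)
  moreover have "AE \<omega> in Q. nonexploding (seqW \<omega>)"
    using rQ unfolding risk_process_def by (intro counting_process_nonexploding[OF Q]) blast
  ultimately have "AE \<omega> in Q. rvX 1 \<omega> \<notin> B"
    using AE_space
  proof eventually_elim
    case (elim \<omega>)
    then have w: "seqW \<omega> \<in> space SeqU" and \<omega>: "\<omega> \<in> space Omega" using QO by (auto simp: space_OmegaI)
    show ?case
    proof
      assume X: "rvX 1 \<omega> \<in> B"
      obtain m :: nat where "arrival (seqW \<omega>) 1 \<le> real m" using real_arch_simple by blast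
      then have N: "1 \<le> procN (real m) \<omega>"
        unfolding procN_eq by (subst le_num_arrivals_iff[OF w nonexplodingD[OF elim(2)]]) auto
      have "0 < (\<Sum>k = 1..procN (real m) \<omega>. indicator B (rvX k \<omega>) :: real)"
        by (rule sum_pos2[of _ 1]) (use X N in auto)
      then show False using elim(1) \<omega> by (auto simp: E_def)
    qed
  qed
  then have "emeasure Q (rvX 1 -` B \<inter> space Q) = 0"
    using measurable_sets[OF XM[OF Q, of 1] B] by (subst (asm) AE_iff_measurable[OF _ refl]) (auto simp: vimage_def Int_def conj_commute)
  then show ?thesis using emeasure_distr[OF XM[OF Q, of 1] B] by (simp add: lawX1_def)
qed

lemma level_density_pos: "0 < level_density \<gamma> a l t \<omega>"
  by (simp add: level_density_def)

lemma M_tilde_eq: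
  assumes "F_P_rep P \<beta> \<alpha> \<gamma>" "\<omega> \<in> space Omega" "0 < \<theta>"
  shows "M_tilde \<beta> \<alpha> \<theta> t \<omega> = level_density \<gamma> (\<alpha> \<theta>) \<theta> t \<omega>"
proof -
  have "(\<Sum>k = 1..procN t \<omega>. \<beta> (rvX k \<omega>) \<theta>) = (\<Sum>k = 1..procN t \<omega>. \<alpha> \<theta> + \<gamma> (rvX k \<omega>))"
    using assms rvX_pos by (intro sum.cong) (auto simp: F_P_rep_def)
  then show ?thesis by (simp add: M_tilde_def S_beta_def level_density_def)
qed

lemma M_beta_eq:
  assumes "F_P_rep P \<beta> \<alpha> \<gamma>" "\<omega> \<in> space Omega"
  shows "M_beta \<beta> \<alpha> \<xi> t \<omega> = \<xi> (rvTheta \<omega>) * level_density \<gamma> (\<alpha> (rvTheta \<omega>)) (rvTheta \<omega>) t \<omega>"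
  using M_tilde_eq[OF assms, of "rvTheta \<omega>" t] assms(2)
  by (simp add: M_beta_def M_tilde_def space_OmegaI)

lemma level_density_Theta_filt:
  assumes t: "0 \<le> t" and \<alpha>: "\<alpha> \<in> borel_measurable Upsilon" and \<gamma>: "\<gamma> \<in> borel_measurable Upsilon"
  shows "(\<lambda>\<omega>. level_density \<gamma> (\<alpha> (rvTheta \<omega>)) (rvTheta \<omega>) t \<omega>) \<in> borel_measurable (filt t)"
proof -
  have [measurable]: "(\<lambda>\<omega>. \<alpha> (rvTheta \<omega>)) \<in> borel_measurable (filt t)" by (rule measurable_compose[OF rvTheta_filt \<alpha>])
  have [measurable]: "rvTheta \<in> borel_measurable (filt t)" by (rule measurable_UpsilonD[OF rvTheta_filt])
  note [measurable] = procN_filt[OF t] jump_sum_filt[OF t \<gamma>]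
  have eq: "level_density \<gamma> (\<alpha> (rvTheta \<omega>)) (rvTheta \<omega>) t \<omega>
     = exp (real (procN t \<omega>) * \<alpha> (rvTheta \<omega>) + (\<Sum>k = 1..procN t \<omega>. \<gamma> (rvX k \<omega>))
         - t * rvTheta \<omega> * (exp (\<alpha> (rvTheta \<omega>)) - 1))" for \<omega>
    by (simp add: level_density_def sum.distrib)
  show ?thesis unfolding eq by measurable
qed

lemma F_P_repD:
  assumes \<mu>: "\<mu> \<in> space (prob_algebra Upsilon)" and P: "P \<in> space (prob_algebra Omega)" "lawX1 P = \<mu>"
    and F: "F_P_rep P \<beta> \<alpha> \<gamma>"
  shows "\<alpha> \<in> borel_measurable Upsilon" "\<gamma> \<in> borel_measurable Upsilon"
    "density \<mu> (\<lambda>x. ennreal (exp (\<gamma> x))) \<in> space (prob_algebra Upsilon)"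
proof -
  show \<alpha>: "\<alpha> \<in> borel_measurable Upsilon" and \<gamma>: "\<gamma> \<in> borel_measurable Upsilon" using F by (auto simp: F_P_rep_def)
  have X: "rvX 1 \<in> P \<rightarrow>\<^sub>M Upsilon" using measurable_rvX[of 1] prob_algebraD[OF P(1)] by (simp cong: measurable_cong_sets)
  have e: "(\<lambda>x. exp (\<gamma> x)) \<in> borel_measurable Upsilon" using \<gamma> by measurable
  have "(\<integral>\<^sup>+x. ennreal (exp (\<gamma> x)) \<partial>\<mu>) = 1"
    using F has_bochner_integral_distr_iff[OF X e] P(2) by (simp add: F_P_rep_def lawX1_def)
  then show "density \<mu> (\<lambda>x. ennreal (exp (\<gamma> x))) \<in> space (prob_algebra Upsilon)"
    by (rule density_in_prob_algebra[OF \<mu> e])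
qed

lemma R_plusD:
  assumes \<rho>: "\<rho> \<in> space (prob_algebra Upsilon)" and P: "P \<in> space (prob_algebra Omega)" "lawTheta P = \<rho>"
    and \<xi>: "\<xi> \<in> R_plus P"
  shows "\<xi> \<in> borel_measurable Upsilon" "AE \<theta> in \<rho>. 0 < \<xi> \<theta>"
    "density \<rho> (\<lambda>\<theta>. ennreal (\<xi> \<theta>)) \<in> space (prob_algebra Upsilon)"
proof -
  show m: "\<xi> \<in> borel_measurable Upsilon" and pos: "AE \<theta> in \<rho>. 0 < \<xi> \<theta>" using \<xi> P(2) by (auto simp: R_plus_def)
  have T: "rvTheta \<in> P \<rightarrow>\<^sub>M Upsilon" using prob_algebraD[OF P(1)] by (simp cong: measurable_cong_sets)
  have "AE \<theta> in distr P Upsilon rvTheta. 0 \<le> \<xi> \<theta>" using pos P(2) by (auto simp: lawTheta_def)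
  then have "(\<integral>\<^sup>+\<theta>. ennreal (\<xi> \<theta>) \<partial>\<rho>) = 1"
    using \<xi> has_bochner_integral_distr_iff[OF T m] P(2) by (simp add: R_plus_def lawTheta_def)
  then show "density \<rho> (\<lambda>\<theta>. ennreal (\<xi> \<theta>)) \<in> space (prob_algebra Upsilon)"
    by (rule density_in_prob_algebra[OF \<rho> m])
qed

text \<open>The identity for frozen parameters with original rate \<theta> and \<open>a\<close>
  equal to \<alpha>(\<theta>): the new rate is \<open>\<theta> * exp (\<alpha> \<theta>)\<close>,
  which will be \<open>g \<theta>\<close>.\<close>

lemma density_process_level:
  assumes \<mu>: "\<mu> \<in> space (prob_algebra Upsilon)" and \<theta>: "0 < \<theta>" and F: "F_P_rep P \<beta> \<alpha> \<gamma>"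
    and m': "density \<mu> (\<lambda>x. ennreal (exp (\<gamma> x))) \<in> space (prob_algebra Upsilon)"
  defines "K \<equiv> cpp_law (\<theta> * exp (\<alpha> \<theta>)) (density \<mu> (\<lambda>x. ennreal (exp (\<gamma> x)))) \<theta>"
  shows "density_identity K (Pth \<mu> \<theta>) (M_tilde \<beta> \<alpha> \<theta>)" "martingale_L1 (Pth \<mu> \<theta>) (M_tilde \<beta> \<alpha> \<theta>)"
    "progressively_equivalent K (Pth \<mu> \<theta>)"
proof -
  have \<gamma>: "\<gamma> \<in> borel_measurable Upsilon" using F by (auto simp: F_P_rep_def)
  have K: "K \<in> space (prob_algebra Omega)" unfolding K_def using \<theta> by (intro cpp_law_in_prob_algebra m') auto
  have P: "Pth \<mu> \<theta> \<in> space (prob_algebra Omega)" unfolding Pth_eq using \<theta> by (intro cpp_law_in_prob_algebra \<mu>)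
  have meas: "M_tilde \<beta> \<alpha> \<theta> t \<in> borel_measurable (filt t)" if "0 \<le> t" for t
    using level_density_filt[OF that \<gamma>]
    by (rule measurable_cong[THEN iffD1, rotated]) (simp add: M_tilde_eq[OF F _ \<theta>])
  have pos: "AE \<omega> in Pth \<mu> \<theta>. 0 < M_tilde \<beta> \<alpha> \<theta> t \<omega>" for t by (simp add: M_tilde_def)
  have eq: "emeasure K A = (\<integral>\<^sup>+\<omega>. ennreal (M_tilde \<beta> \<alpha> \<theta> t \<omega>) * indicator A \<omega> \<partial>Pth \<mu> \<theta>)"
    if "0 \<le> t" "A \<in> sets (filt t)" for t A
  proof -
    have "emeasure K A = (\<integral>\<^sup>+\<omega>. ennreal (level_density \<gamma> (\<alpha> \<theta>) \<theta> t \<omega>) * indicator A \<omega> \<partial>Pth \<mu> \<theta>)"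
      unfolding K_def Pth_eq by (rule emeasure_level_density[OF \<mu> \<theta> \<theta> that(1) \<gamma> m' that(2)])
    also have "\<dots> = (\<integral>\<^sup>+\<omega>. ennreal (M_tilde \<beta> \<alpha> \<theta> t \<omega>) * indicator A \<omega> \<partial>Pth \<mu> \<theta>)"
      using prob_algebraD(3)[OF P] by (intro nn_integral_cong) (simp add: M_tilde_eq[OF F _ \<theta>])
    finally show ?thesis .
  qed
  show "density_identity K (Pth \<mu> \<theta>) (M_tilde \<beta> \<alpha> \<theta>)" "martingale_L1 (Pth \<mu> \<theta>) (M_tilde \<beta> \<alpha> \<theta>)"
    "progressively_equivalent K (Pth \<mu> \<theta>)"
    by (rule density_process[OF K P meas pos eq]; assumption)+
qed

text \<open>The identities for the single \<theta> are integrated against the new law of \<Theta>,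
  whose density \<xi> becomes the factor \<xi>(\<Theta>) of the density process.\<close>

lemma density_process_mixed:
  assumes \<mu>: "\<mu> \<in> space (prob_algebra Upsilon)" and \<rho>: "\<rho> \<in> space (prob_algebra Upsilon)"
    and F: "F_P_rep P \<beta> \<alpha> \<gamma>" and \<xi>: "\<xi> \<in> borel_measurable Upsilon" "AE \<theta> in \<rho>. 0 < \<xi> \<theta>"
    and m': "density \<mu> (\<lambda>x. ennreal (exp (\<gamma> x))) \<in> space (prob_algebra Upsilon)"
    and r': "density \<rho> (\<lambda>\<theta>. ennreal (\<xi> \<theta>)) \<in> space (prob_algebra Upsilon)"
    and g: "g \<in> M_plus" "\<And>\<theta>. 0 < \<theta> \<Longrightarrow> g \<theta> = \<theta> * exp (\<alpha> \<theta>)"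
  defines "Q \<equiv> cmpp_law g (density \<mu> (\<lambda>x. ennreal (exp (\<gamma> x)))) (density \<rho> (\<lambda>\<theta>. ennreal (\<xi> \<theta>)))"
  shows "density_identity Q (Pmix \<mu> \<rho>) (M_beta \<beta> \<alpha> \<xi>)" "martingale_L1 (Pmix \<mu> \<rho>) (M_beta \<beta> \<alpha> \<xi>)"
    "progressively_equivalent Q (Pmix \<mu> \<rho>)"
proof -
  let ?m' = "density \<mu> (\<lambda>x. ennreal (exp (\<gamma> x)))" and ?r' = "density \<rho> (\<lambda>\<theta>. ennreal (\<xi> \<theta>))"
  let ?P = "Pmix \<mu> \<rho>"
  have \<alpha>: "\<alpha> \<in> borel_measurable Upsilon" and \<gamma>: "\<gamma> \<in> borel_measurable Upsilon" using F by (auto simp: F_P_rep_def)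
  have Q: "Q \<in> space (prob_algebra Omega)" unfolding Q_def by (rule cmpp_law_in_prob_algebra[OF g(1) m' r'])
  have P: "?P \<in> space (prob_algebra Omega)" unfolding Pmix_eq by (rule cmpp_law_in_prob_algebra[OF id_M_plus \<mu> \<rho>])
  have lP: "lawTheta ?P = \<rho>" unfolding Pmix_eq by (rule lawTheta_cmpp_law[OF id_M_plus \<mu> \<rho>])
  note \<rho>O = prob_algebraD[OF \<rho>] and PO = prob_algebraD[OF P]
  have meas: "M_beta \<beta> \<alpha> \<xi> t \<in> borel_measurable (filt t)" if "0 \<le> t" for t
  proof -
    have "(\<lambda>\<omega>. \<xi> (rvTheta \<omega>) * level_density \<gamma> (\<alpha> (rvTheta \<omega>)) (rvTheta \<omega>) t \<omega>) \<in> borel_measurable (filt t)"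
      by (intro borel_measurable_times level_density_Theta_filt that \<alpha> \<gamma> measurable_compose[OF rvTheta_filt \<xi>(1)])
    then show ?thesis by (rule measurable_cong[THEN iffD1, rotated]) (simp add: M_beta_eq[OF F])
  qed
  have pos: "AE \<omega> in ?P. 0 < M_beta \<beta> \<alpha> \<xi> t \<omega>" for t
  proof -
    have "rvTheta \<in> ?P \<rightarrow>\<^sub>M Upsilon" using PO by (simp cong: measurable_cong_sets)
    moreover have "AE \<theta> in distr ?P Upsilon rvTheta. 0 < \<xi> \<theta>"
      using \<xi>(2) unfolding lP[unfolded lawTheta_def] .
    ultimately have "AE \<omega> in ?P. 0 < \<xi> (rvTheta \<omega>)" by (rule AE_distrD)
    then show ?thesis by eventually_elim (simp add: M_beta_def)
  qed
  have eq: "emeasure Q A = (\<integral>\<^sup>+\<omega>. ennreal (M_beta \<beta> \<alpha> \<xi> t \<omega>) * indicator A \<omega> \<partial>?P)"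
    if t: "0 \<le> t" and A: "A \<in> sets (filt t)" for t A
  proof -
    define Z where "Z \<omega> = level_density \<gamma> (\<alpha> (rvTheta \<omega>)) (rvTheta \<omega>) t \<omega>" for \<omega>
    have AO: "A \<in> sets Omega" using A sets_filt_Omega by blast
    have Z: "Z \<in> borel_measurable Omega" unfolding Z_def
      using level_density_Theta_filt[OF t \<alpha> \<gamma>] sets_filt_Omega by (intro measurable_from_subalg[of Omega "filt t"]) (auto simp: subalgebra_def)
    have K: "(\<lambda>\<theta>. emeasure (cpp_law (g \<theta>) ?m' \<theta>) A) \<in> borel_measurable \<rho>"
      using measurable_compose[OF measurable_prob_algebraD[OF measurable_cpp_law[OF g(1) m']] measurable_emeasure_subprob_algebra[OF AO]] \<rho>O
      by (simp cong: measurable_cong_sets)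
    have \<xi>\<rho>: "(\<lambda>\<theta>. ennreal (\<xi> \<theta>)) \<in> borel_measurable \<rho>" using \<xi>(1) \<rho>O by (simp cong: measurable_cong_sets)
    have "emeasure Q A = (\<integral>\<^sup>+\<theta>. emeasure (cpp_law (g \<theta>) ?m' \<theta>) A \<partial>?r')"
      unfolding Q_def by (rule emeasure_cmpp_law[OF g(1) m' r' AO])
    also have "\<dots> = (\<integral>\<^sup>+\<theta>. ennreal (\<xi> \<theta>) * emeasure (cpp_law (g \<theta>) ?m' \<theta>) A \<partial>\<rho>)"
      by (rule nn_integral_density[OF \<xi>\<rho> K])
    also have "\<dots> = (\<integral>\<^sup>+\<theta>. ennreal (\<xi> \<theta>) * (\<integral>\<^sup>+\<omega>. ennreal (Z \<omega>) * indicator A \<omega> \<partial>cpp_law \<theta> \<mu> \<theta>) \<partial>\<rho>)"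
    proof (rule nn_integral_cong)
      fix \<theta> assume "\<theta> \<in> space \<rho>"
      then have \<theta>: "0 < \<theta>" using \<rho>O by simp
      have "emeasure (cpp_law (g \<theta>) ?m' \<theta>) A = (\<integral>\<^sup>+\<omega>. ennreal (level_density \<gamma> (\<alpha> \<theta>) \<theta> t \<omega>) * indicator A \<omega> \<partial>cpp_law \<theta> \<mu> \<theta>)"
        unfolding g(2)[OF \<theta>] by (rule emeasure_level_density[OF \<mu> \<theta> \<theta> t \<gamma> m' A])
      also have "\<dots> = (\<integral>\<^sup>+\<omega>. ennreal (Z \<omega>) * indicator A \<omega> \<partial>cpp_law \<theta> \<mu> \<theta>)"
        by (rule nn_integral_cong_AE, rule AE_mp[OF AE_cpp_law_rvTheta[OF \<mu> \<theta> \<theta>]]) (simp add: Z_def)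
      finally show "ennreal (\<xi> \<theta>) * emeasure (cpp_law (g \<theta>) ?m' \<theta>) A
         = ennreal (\<xi> \<theta>) * (\<integral>\<^sup>+\<omega>. ennreal (Z \<omega>) * indicator A \<omega> \<partial>cpp_law \<theta> \<mu> \<theta>)" by simp
    qed
    also have "\<dots> = (\<integral>\<^sup>+\<omega>. ennreal (\<xi> (rvTheta \<omega>)) * (ennreal (Z \<omega>) * indicator A \<omega>) \<partial>?P)"
      unfolding Pmix_eq using Z AO \<xi>(1)
      by (intro nn_integral_cmpp_law_Theta[OF id_M_plus \<mu> \<rho>, symmetric] borel_measurable_times_ennreal borel_measurable_indicator) auto
    also have "\<dots> = (\<integral>\<^sup>+\<omega>. ennreal (M_beta \<beta> \<alpha> \<xi> t \<omega>) * indicator A \<omega> \<partial>?P)"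
      using PO by (intro nn_integral_cong)
        (simp add: M_beta_eq[OF F] Z_def ennreal_mult'' less_imp_le[OF level_density_pos] mult.assoc)
    finally show ?thesis .
  qed
  show "density_identity Q ?P (M_beta \<beta> \<alpha> \<xi>)" "martingale_L1 ?P (M_beta \<beta> \<alpha> \<xi>)" "progressively_equivalent Q ?P"
    by (rule density_process[OF Q P meas pos eq]; assumption)+
qed

text \<open>The relation between g and \<alpha> in \<open>cond_star2\<close> is stated at outcomes,
  through \<Theta>. Surjectivity of \<Theta> turns it into an identity at every positive \<theta>,
  not just at almost every one.\<close>

lemma rvTheta_surj: assumes "0 < \<theta>" obtains \<omega> where "\<omega> \<in> space Omega" "rvTheta \<omega> = \<theta>"
proof -
  define w where "w = (\<lambda>n\<in>{1::nat..}. 1::real)"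
  have "w \<in> space SeqU" by (auto simp: space_SeqU w_def)
  then show thesis using that[of "(w, w, \<theta>)"] assms by (simp add: space_Omega rvTheta_def)
qed

lemma cond_star2D:
  assumes \<mu>: "\<mu> \<in> space (prob_algebra Upsilon)" "lawX1 P = \<mu>"
    and \<gamma>: "\<gamma> \<in> borel_measurable Upsilon" and c: "cond_star2 P g Q \<alpha> \<gamma>"
  shows "\<And>\<theta>. 0 < \<theta> \<Longrightarrow> g \<theta> = \<theta> * exp (\<alpha> \<theta>)" "lawX1 Q = density \<mu> (\<lambda>x. ennreal (exp (\<gamma> x)))"
proof -
  show "g \<theta> = \<theta> * exp (\<alpha> \<theta>)" if "0 < \<theta>" for \<theta>
    using rvTheta_surj[OF that] c unfolding cond_star2_def by metis
  obtain f where f: "is_RN_derivative \<mu> (lawX1 Q) f" "AE x in \<mu>. 0 < f x" "\<And>x. 0 < x \<Longrightarrow> 0 < f x \<Longrightarrow> \<gamma> x = ln (f x)"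
    using c \<mu>(2) unfolding cond_star2_def by blast
  note \<mu>O = prob_algebraD[OF \<mu>(1)]
  have "AE x in \<mu>. f x = exp (\<gamma> x)"
    using f(2) AE_space by eventually_elim (simp add: f(3) \<mu>O)
  then have "AE x in \<mu>. ennreal (f x) = ennreal (exp (\<gamma> x))" by eventually_elim simp
  moreover have "(\<lambda>x. ennreal (f x)) \<in> borel_measurable \<mu>" using f(1) by (auto simp: is_RN_derivative_def)
  moreover have "(\<lambda>x. ennreal (exp (\<gamma> x))) \<in> borel_measurable \<mu>" using \<gamma> \<mu>O by (auto cong: measurable_cong_sets)
  ultimately have "density \<mu> (\<lambda>x. ennreal (f x)) = density \<mu> (\<lambda>x. ennreal (exp (\<gamma> x)))" by (intro density_cong)
  then show "lawX1 Q = density \<mu> (\<lambda>x. ennreal (exp (\<gamma> x)))" using f(1) by (simp add: is_RN_derivative_def)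
qed

text \<open>At time 0 there are no claims and the compensator vanishes, so the density process
  starts at \<xi>(\<Theta>). The density identity on events of \<Theta> at \<open>s = t = 0\<close>
  thus exhibits \<xi> as the density of the law of \<Theta>.\<close>

lemma lawTheta_density:
  assumes P: "P \<in> space (prob_algebra Omega)" "lawTheta P = \<rho>" and \<xi>: "\<xi> \<in> R_plus P"
    and Q: "Q \<in> space (prob_algebra Omega)" and d: "density_identity Q P (M_beta \<beta> \<alpha> \<xi>)"
  shows "lawTheta Q = density \<rho> (\<lambda>\<theta>. ennreal (\<xi> \<theta>))"
proof (rule measure_eqI)
  have \<rho>: "\<rho> \<in> space (prob_algebra Upsilon)" using lawTheta_in_prob_algebra[OF P(1)] P(2) by simp
  note PO = prob_algebraD[OF P(1)] and QO = prob_algebraD[OF Q] and \<rho>O = prob_algebraD[OF \<rho>]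
  note \<xi>D = R_plusD[OF \<rho> P \<xi>]
  interpret Q: prob_space Q by (rule QO)
  show "sets (lawTheta Q) = sets (density \<rho> (\<lambda>\<theta>. ennreal (\<xi> \<theta>)))" using \<rho>O by (simp add: lawTheta_def)
  fix B assume "B \<in> sets (lawTheta Q)"
  then have B: "B \<in> sets Upsilon" by (simp add: lawTheta_def)
  let ?A = "rvTheta -` B \<inter> space Omega"
  have T: "rvTheta \<in> P \<rightarrow>\<^sub>M Upsilon" using PO by (simp cong: measurable_cong_sets)
  have A0: "?A \<in> sets (filt 0)" using measurable_sets[OF rvTheta_filt B, of 0] by simp
  have AP: "?A \<in> sets P" using A0 sets_filt_Omega PO by auto
  have pos: "AE \<omega> in P. 0 < \<xi> (rvTheta \<omega>)"
    using AE_distrD[OF T, of "\<lambda>\<theta>. 0 < \<xi> \<theta>"] \<xi>D(2) P(2) unfolding lawTheta_def by blast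
  have int: "integrable P (\<lambda>\<omega>. \<xi> (rvTheta \<omega>))"
    using \<xi> unfolding R_plus_def by (blast intro: integrable.intros)
  have intA: "integrable P (\<lambda>\<omega>. indicator ?A \<omega> *\<^sub>R \<xi> (rvTheta \<omega>))" by (rule integrable_mult_indicator[OF AP int])
  have "measure Q ?A = (\<integral>\<omega>\<in>?A. M_beta \<beta> \<alpha> \<xi> 0 \<omega> \<partial>P)"
    using d[unfolded density_identity_def, rule_format, of 0 0 ?A] A0 by simp
  also have "\<dots> = (\<integral>\<omega>. indicator ?A \<omega> *\<^sub>R \<xi> (rvTheta \<omega>) \<partial>P)"
    unfolding set_lebesgue_integral_def
    using PO by (intro Bochner_Integration.integral_cong) (auto simp: M_beta_def S_beta_def procN_0)
  finally have "emeasure Q ?A = ennreal (\<integral>\<omega>. indicator ?A \<omega> *\<^sub>R \<xi> (rvTheta \<omega>) \<partial>P)"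
    by (simp add: Q.emeasure_eq_measure)
  also have "\<dots> = (\<integral>\<^sup>+\<omega>. ennreal (indicator ?A \<omega> *\<^sub>R \<xi> (rvTheta \<omega>)) \<partial>P)"
    using pos by (intro nn_integral_eq_integral[symmetric] intA) (auto simp: indicator_def)
  also have "\<dots> = (\<integral>\<^sup>+\<omega>. ennreal (\<xi> (rvTheta \<omega>)) * indicator B (rvTheta \<omega>) \<partial>P)"
    using PO by (intro nn_integral_cong) (auto simp: indicator_def)
  also have "\<dots> = (\<integral>\<^sup>+\<theta>. ennreal (\<xi> \<theta>) * indicator B \<theta> \<partial>\<rho>)"
    using nn_integral_rvTheta[OF P(1), of "\<lambda>\<theta>. ennreal (\<xi> \<theta>) * indicator B \<theta>"] \<xi>D(1) B P(2) by simp
  also have "\<dots> = emeasure (density \<rho> (\<lambda>\<theta>. ennreal (\<xi> \<theta>))) B"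
    using \<xi>D(1) B \<rho>O by (subst emeasure_density) (auto cong: measurable_cong_sets)
  also have "emeasure Q ?A = emeasure (lawTheta Q) B"
    unfolding emeasure_lawTheta[OF Q B] by (intro arg_cong[of _ _ "emeasure Q"]) auto
  finally show "emeasure (lawTheta Q) B = emeasure (density \<rho> (\<lambda>\<theta>. ennreal (\<xi> \<theta>))) B" .
qed

lemma M_S_law:
  assumes "g \<in> M_plus" "Q \<in> M_S P g"
  shows "Q \<in> space (prob_algebra Omega)" "Q = cmpp_law g (lawX1 Q) (lawTheta Q)" "progressively_equivalent Q P"
    "risk_process Q"
  using assms CMPP_law[of Q g] by (auto simp: M_S_def S_is_CMPP_def)

lemma cmpp_law_cong:
  assumes r: "r \<in> space (prob_algebra Upsilon)" and "\<And>\<theta>. 0 < \<theta> \<Longrightarrow> g \<theta> = g' \<theta>"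
  shows "cmpp_law g m r = cmpp_law g' m r"
  unfolding cmpp_law_def using assms(2) prob_algebraD(3)[OF r] by (intro bind_cong) auto

lemma RN_derivative_unique:
  assumes M: "M \<in> space (prob_algebra Upsilon)" and f: "is_RN_derivative M L f" and f': "is_RN_derivative M L f'"
  shows "AE x in M. f x = f' x"
proof -
  interpret M: prob_space M by (rule prob_algebraD[OF M])
  have "density M (\<lambda>x. ennreal (f x)) = density M (\<lambda>x. ennreal (f' x))"
    using f f' by (simp add: is_RN_derivative_def)
  then have "AE x in M. ennreal (f x) = ennreal (f' x)"
    using f f' by (subst (asm) M.density_unique_iff) (auto simp: is_RN_derivative_def)
  moreover have "AE x in M. 0 \<le> f x" "AE x in M. 0 \<le> f' x" using f f' by (auto simp: is_RN_derivative_def)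
  ultimately show ?thesis by eventually_elim simp
qed

section \<open>The correspondence between pairs and the disintegration\<close>

context
  fixes \<mu> \<rho> :: "real measure" and P :: "outcome measure"
  assumes \<mu>: "\<mu> \<in> space (prob_algebra Upsilon)" and \<rho>: "\<rho> \<in> space (prob_algebra Upsilon)"
    and P_def: "P = Pmix \<mu> \<rho>"
begin

lemma P_prob: "P \<in> space (prob_algebra Omega)"
  unfolding P_def Pmix_eq by (rule cmpp_law_in_prob_algebra[OF id_M_plus \<mu> \<rho>])

lemma lawTheta_P: "lawTheta P = \<rho>"
  unfolding P_def Pmix_eq by (rule lawTheta_cmpp_law[OF id_M_plus \<mu> \<rho>])

lemma lawX1_P: "lawX1 P = \<mu>"
  unfolding P_def Pmix_eq by (rule lawX1_cmpp_law[OF id_M_plus \<mu> \<rho>])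

lemma risk_process_P: "risk_process P"
  unfolding P_def Pmix_eq by (rule risk_process_cmpp_law[OF id_M_plus \<mu> \<rho>])

text \<open>The relations leave no choice: \<alpha> must be the logarithm of g(\<theta>)/\<theta>,
  \<gamma> that of a density of the claim law, and \<xi> a density of the law of \<Theta>.
  Progressive equivalence provides both densities; the normalisations of \<gamma> and \<xi> hold
  because they describe probability measures.\<close>

lemma existence_of_density:
  assumes g: "g \<in> M_plus" and Q: "Q \<in> M_S P g"
  shows "\<exists>\<beta> \<alpha> \<gamma> \<xi>. F_P_rep P \<beta> \<alpha> \<gamma> \<and> \<xi> \<in> R_plus P \<and>
          is_RN_derivative (lawTheta P) (lawTheta Q) \<xi> \<and> linked P g Q \<beta> \<alpha> \<gamma> \<xi>"
proof -
  note QL = M_S_law[OF g Q]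
  note PO = prob_algebraD[OF P_prob] and \<mu>O = prob_algebraD[OF \<mu>] and \<rho>O = prob_algebraD[OF \<rho>]
  note m' = lawX1_in_prob_algebra[OF QL(1)] and r' = lawTheta_in_prob_algebra[OF QL(1)]
  have "emeasure \<rho> B = 0 \<longleftrightarrow> emeasure (lawTheta Q) B = 0" if "B \<in> sets Upsilon" for B
    using lawTheta_null_iff[OF QL(1) P_prob QL(3) that] lawTheta_P by simp
  from prob_algebra_RN[OF \<rho> r' this] obtain \<xi> where \<xi>: "\<xi> \<in> borel_measurable Upsilon" "\<And>x. 0 \<le> \<xi> x"
    "AE x in \<rho>. 0 < \<xi> x" "lawTheta Q = density \<rho> (\<lambda>x. ennreal (\<xi> x))" by metis
  have "emeasure \<mu> B = 0 \<longleftrightarrow> emeasure (lawX1 Q) B = 0" if B: "B \<in> sets Upsilon" for B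
  proof
    assume "emeasure \<mu> B = 0"
    then show "emeasure (lawX1 Q) B = 0"
      using progressively_equivalentD[OF QL(1) P_prob QL(3)] lawX1_P
      by (intro lawX1_null[OF QL(1) P_prob _ risk_process_P QL(4) B]) auto
  next
    assume "emeasure (lawX1 Q) B = 0"
    then have "emeasure (lawX1 P) B = 0"
      using progressively_equivalentD[OF QL(1) P_prob QL(3)]
      by (intro lawX1_null[OF P_prob QL(1) _ QL(4) risk_process_P B]) auto
    then show "emeasure \<mu> B = 0" by (simp add: lawX1_P)
  qed
  from prob_algebra_RN[OF \<mu> m' this] obtain f where f: "f \<in> borel_measurable Upsilon" "\<And>x. 0 \<le> f x"
    "AE x in \<mu>. 0 < f x" "lawX1 Q = density \<mu> (\<lambda>x. ennreal (f x))" by metis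
  define \<alpha> where "\<alpha> \<theta> = ln (g \<theta> / \<theta>)" for \<theta>
  \<comment> \<open>Where \<open>f\<close> vanishes, \<open>ln\<close> takes a default value; this
    happens only on a \<open>\<mu>\<close>-null set and does not affect the resulting
    measure.\<close>
  define \<gamma> where "\<gamma> x = ln (f x)" for x
  define \<beta> where "\<beta> x \<theta> = \<alpha> \<theta> + \<gamma> x" for x \<theta>
  have \<alpha>m: "\<alpha> \<in> borel_measurable Upsilon"
    using measurable_UpsilonD[OF M_plus_measurable[OF g]] measurable_Upsilon_borel unfolding \<alpha>_def by measurable
  have \<gamma>m: "\<gamma> \<in> borel_measurable Upsilon" using f(1) unfolding \<gamma>_def by measurable
  have g\<alpha>: "g \<theta> = \<theta> * exp (\<alpha> \<theta>)" if "0 < \<theta>" for \<theta>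
    using that M_plusD[OF g that] by (simp add: \<alpha>_def)
  have star: "cond_star2 P g Q \<alpha> \<gamma>"
    unfolding cond_star2_def lawX1_P
  proof (intro conjI ballI exI[of _ f])
    show "g (rvTheta \<omega>) = rvTheta \<omega> * exp (\<alpha> (rvTheta \<omega>))" if "\<omega> \<in> space Omega" for \<omega>
      using that by (intro g\<alpha>) (simp add: space_OmegaI)
    show "is_RN_derivative \<mu> (lawX1 Q) f"
      using f \<mu>O by (auto simp: is_RN_derivative_def cong: measurable_cong_sets)
  qed (use f(3) in \<open>auto simp: \<gamma>_def\<close>)
  have XQ: "lawX1 Q = density \<mu> (\<lambda>x. ennreal (exp (\<gamma> x)))"
    by (rule cond_star2D(2)[OF \<mu> lawX1_P \<gamma>m star])
  have total: "(\<integral>\<^sup>+x. ennreal (h x) \<partial>m) = 1"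
    if "m \<in> space (prob_algebra Upsilon)" "density m (\<lambda>x. ennreal (h x)) \<in> space (prob_algebra Upsilon)"
      "h \<in> borel_measurable Upsilon" for m h
  proof -
    have h: "(\<lambda>x. ennreal (h x)) \<in> borel_measurable m"
      using that(3) prob_algebraD[OF that(1)] by (auto cong: measurable_cong_sets)
    have "(\<integral>\<^sup>+x. ennreal (h x) \<partial>m) = emeasure (density m (\<lambda>x. ennreal (h x))) (space m)"
      by (subst emeasure_density[OF h sets.top]) (auto intro!: nn_integral_cong)
    then show ?thesis using prob_space.emeasure_space_1[OF prob_algebraD(1)[OF that(2)]] by simp
  qed
  have X: "rvX 1 \<in> P \<rightarrow>\<^sub>M Upsilon" using measurable_rvX[of 1] PO by (simp cong: measurable_cong_sets)
  have T: "rvTheta \<in> P \<rightarrow>\<^sub>M Upsilon" using PO by (simp cong: measurable_cong_sets)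
  have em: "(\<lambda>x. exp (\<gamma> x)) \<in> borel_measurable Upsilon" using \<gamma>m by measurable
  have "has_bochner_integral P (\<lambda>\<omega>. exp (\<gamma> (rvX 1 \<omega>))) 1"
    using total[OF \<mu> _ em] m' XQ lawX1_P by (subst has_bochner_integral_distr_iff[OF X em]) (auto simp: lawX1_def)
  then have F: "F_P_rep P \<beta> \<alpha> \<gamma>" using \<alpha>m \<gamma>m by (simp add: F_P_rep_def \<beta>_def)
  have "has_bochner_integral P (\<lambda>\<omega>. \<xi> (rvTheta \<omega>)) 1"
    using total[OF \<rho> _ \<xi>(1)] r' \<xi>(2,4) lawTheta_P by (subst has_bochner_integral_distr_iff[OF T \<xi>(1)]) (auto simp: lawTheta_def)
  then have R: "\<xi> \<in> R_plus P" using \<xi>(1,3) unfolding R_plus_def lawTheta_P by simp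
  have RN: "is_RN_derivative (lawTheta P) (lawTheta Q) \<xi>"
    using \<xi> \<rho>O by (auto simp: is_RN_derivative_def lawTheta_P cong: measurable_cong_sets)
  have "Q = cmpp_law g (density \<mu> (\<lambda>x. ennreal (exp (\<gamma> x)))) (density \<rho> (\<lambda>x. ennreal (\<xi> x)))"
    using QL(2) unfolding XQ \<xi>(4) .
  then have "linked P g Q \<beta> \<alpha> \<gamma> \<xi>"
    using density_process_mixed(1,2)[OF \<mu> \<rho> F \<xi>(1,3) m'[unfolded XQ] r'[unfolded \<xi>(4)] g g\<alpha>] star
    unfolding linked_def P_def by simp
  then show ?thesis using F R RN by blast
qed

text \<open>\<alpha> is determined at every positive \<theta>, since its relation with g is
  pointwise. \<xi> and \<gamma> inherit almost everywhere uniqueness from the Radon-Nikodym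
  derivatives, \<gamma> as the logarithm of one.\<close>

lemma uniqueness_of_density:
  assumes l: "is_RN_derivative (lawTheta P) (lawTheta Q) \<xi>" "linked P g Q \<beta> \<alpha> \<gamma> \<xi>"
    and l': "is_RN_derivative (lawTheta P) (lawTheta Q) \<xi>'" "linked P g Q \<beta>' \<alpha>' \<gamma>' \<xi>'"
  shows "AE \<theta> in lawTheta P. \<alpha>' \<theta> = \<alpha> \<theta> \<and> \<xi>' \<theta> = \<xi> \<theta>" "AE x in lawX1 P. \<gamma>' x = \<gamma> x"
proof -
  have a: "\<alpha>' \<theta> = \<alpha> \<theta>" if \<theta>: "0 < \<theta>" for \<theta>
  proof -
    obtain \<omega> where \<omega>: "\<omega> \<in> space Omega" "rvTheta \<omega> = \<theta>" using rvTheta_surj[OF \<theta>] .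
    have "\<theta> * exp (\<alpha> \<theta>) = \<theta> * exp (\<alpha>' \<theta>)"
      using l(2) l'(2) \<omega> unfolding linked_def cond_star2_def by metis
    then show ?thesis using \<theta> by simp
  qed
  have "AE \<theta> in \<rho>. \<xi>' \<theta> = \<xi> \<theta>" using RN_derivative_unique[OF \<rho>] l(1) l'(1) lawTheta_P by blast
  then show "AE \<theta> in lawTheta P. \<alpha>' \<theta> = \<alpha> \<theta> \<and> \<xi>' \<theta> = \<xi> \<theta>"
    unfolding lawTheta_P using AE_space by eventually_elim (simp add: a prob_algebraD(3)[OF \<rho>])
  obtain f where f: "is_RN_derivative \<mu> (lawX1 Q) f" "AE x in \<mu>. 0 < f x" "\<forall>x>0. 0 < f x \<longrightarrow> \<gamma> x = ln (f x)"
    using l(2) unfolding linked_def cond_star2_def lawX1_P by blast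
  obtain f' where f': "is_RN_derivative \<mu> (lawX1 Q) f'" "AE x in \<mu>. 0 < f' x" "\<forall>x>0. 0 < f' x \<longrightarrow> \<gamma>' x = ln (f' x)"
    using l'(2) unfolding linked_def cond_star2_def lawX1_P by blast
  show "AE x in lawX1 P. \<gamma>' x = \<gamma> x"
    unfolding lawX1_P using RN_derivative_unique[OF \<mu> f(1) f'(1)] f(2) f'(2) AE_space
    by eventually_elim (use f(3) f'(3) prob_algebraD(3)[OF \<mu>] in auto)
qed

text \<open>A linked pair can be reconstructed from its data: \<alpha> gives g, \<gamma> the claim
  law, \<xi> the law of \<Theta>, and by the mixture representation these three determine Q.
  Uniqueness of the pair and the form of the conditional measures both rest on this.\<close>

lemma linked_law:
  assumes g: "g \<in> M_plus" and Q: "Q \<in> M_S P g" and F: "F_P_rep P \<beta> \<alpha> \<gamma>" and \<xi>: "\<xi> \<in> R_plus P"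
    and l: "linked P g Q \<beta> \<alpha> \<gamma> \<xi>"
  shows "\<And>\<theta>. 0 < \<theta> \<Longrightarrow> g \<theta> = \<theta> * exp (\<alpha> \<theta>)" "lawX1 Q = density \<mu> (\<lambda>x. ennreal (exp (\<gamma> x)))"
    "Q = cmpp_law g (density \<mu> (\<lambda>x. ennreal (exp (\<gamma> x)))) (density \<rho> (\<lambda>x. ennreal (\<xi> x)))"
proof -
  note QL = M_S_law[OF g Q]
  have \<gamma>: "\<gamma> \<in> borel_measurable Upsilon" using F by (simp add: F_P_rep_def)
  have star: "cond_star2 P g Q \<alpha> \<gamma>" and d: "density_identity Q P (M_beta \<beta> \<alpha> \<xi>)" using l by (auto simp: linked_def)
  note s = cond_star2D[OF \<mu> lawX1_P \<gamma> star]
  show "g \<theta> = \<theta> * exp (\<alpha> \<theta>)" if "0 < \<theta>" for \<theta> by (rule s(1)[OF that])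
  show "lawX1 Q = density \<mu> (\<lambda>x. ennreal (exp (\<gamma> x)))" by (rule s(2))
  show "Q = cmpp_law g (density \<mu> (\<lambda>x. ennreal (exp (\<gamma> x)))) (density \<rho> (\<lambda>x. ennreal (\<xi> x)))"
    using QL(2) unfolding s(2) lawTheta_density[OF P_prob lawTheta_P \<xi> QL(1) d] .
qed

text \<open>The candidate is the mixture dictated by \<open>linked_law\<close>, with
  \<open>exp (\<gamma> x)\<close> as the everywhere positive density of its claim law. Uniqueness of
  Q also uses that the mixture depends on the rate function only through its values at positive
  \<theta>.\<close>

lemma existence_of_measure:
  assumes \<xi>: "\<xi> \<in> R_plus P" and F: "F_P_rep P \<beta> \<alpha> \<gamma>"
  shows "\<exists>g Q. g \<in> M_plus \<and> Q \<in> M_S P g \<and> linked P g Q \<beta> \<alpha> \<gamma> \<xi> \<and>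
          (\<forall>g' Q'. g' \<in> M_plus \<and> Q' \<in> M_S P g' \<and> linked P g' Q' \<beta> \<alpha> \<gamma> \<xi> \<longrightarrow>
               (\<forall>\<theta>>0. g' \<theta> = g \<theta>) \<and> Q' = Q)"
proof -
  note FD = F_P_repD[OF \<mu> P_prob lawX1_P F] and RD = R_plusD[OF \<rho> P_prob lawTheta_P \<xi>]
  define g where "g \<theta> = \<theta> * exp (\<alpha> \<theta>)" for \<theta>
  define Q where "Q = cmpp_law g (density \<mu> (\<lambda>x. ennreal (exp (\<gamma> x)))) (density \<rho> (\<lambda>x. ennreal (\<xi> x)))"
  have g: "g \<in> M_plus"
    using FD(1) measurable_Upsilon_borel unfolding M_plus_def g_def by (auto intro!: borel_measurable_times)
  have QP: "Q \<in> space (prob_algebra Omega)" unfolding Q_def by (rule cmpp_law_in_prob_algebra[OF g FD(3) RD(3)])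
  note dp = density_process_mixed[OF \<mu> \<rho> F RD(1,2) FD(3) RD(3) g g_def, folded Q_def P_def]
  have MS: "Q \<in> M_S P g"
    unfolding M_S_def using QP dp(3) cond_a1_cmpp_law[OF g FD(3) RD(3)] cond_a2_cmpp_law[OF g FD(3) RD(3)]
      S_is_CMPP_cmpp_law[OF g FD(3) RD(3)] by (simp add: Q_def)
  have "cond_star2 P g Q \<alpha> \<gamma>"
    unfolding cond_star2_def lawX1_P
  proof (intro conjI ballI exI[of _ "\<lambda>x. exp (\<gamma> x)"])
    show "is_RN_derivative \<mu> (lawX1 Q) (\<lambda>x. exp (\<gamma> x))"
      using FD(2) prob_algebraD[OF \<mu>] lawX1_cmpp_law[OF g FD(3) RD(3)]
      by (auto simp: is_RN_derivative_def Q_def cong: measurable_cong_sets)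
  qed (auto simp: g_def)
  then have "linked P g Q \<beta> \<alpha> \<gamma> \<xi>" using dp(1,2) by (simp add: linked_def)
  moreover have "(\<forall>\<theta>>0. g' \<theta> = g \<theta>) \<and> Q' = Q"
    if "g' \<in> M_plus" "Q' \<in> M_S P g'" "linked P g' Q' \<beta> \<alpha> \<gamma> \<xi>" for g' Q'
  proof -
    note ll = linked_law[OF that(1,2) F \<xi> that(3)]
    have "\<forall>\<theta>>0. g' \<theta> = g \<theta>" using ll(1) by (simp add: g_def)
    moreover from this have "Q' = Q" unfolding Q_def by (subst ll(3), intro cmpp_law_cong[OF RD(3)]) simp
    ultimately show ?thesis ..
  qed
  ultimately show ?thesis using g MS by blast
qed

text \<open>The family is the one Q was shown to be a mixture of, with rate
  \<open>g \<theta>\<close> and the claim law of Q. It is defined at every positive \<theta>, and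
  consistency holds because \<Theta> = \<theta> almost surely under \<open>K \<theta>\<close>. All
  remaining properties hold for every \<theta>, so the empty set serves as the exceptional null
  set.\<close>

lemma existence_of_rcp:
  assumes g: "g \<in> M_plus" and Q: "Q \<in> M_S P g" and F: "F_P_rep P \<beta> \<alpha> \<gamma>" and \<xi>: "\<xi> \<in> R_plus P"
    and l: "linked P g Q \<beta> \<alpha> \<gamma> \<xi>"
  shows "\<exists>K. is_rcp Q K \<and> consistent_with_Theta Q K \<and>
          (\<exists>V\<in>null_sets (lawTheta P). \<forall>\<theta>>0. \<theta> \<notin> V \<longrightarrow>
             K \<theta> \<in> M_S_theta \<mu> g \<theta> \<and>
             density_identity (K \<theta>) (Pth \<mu> \<theta>) (M_tilde \<beta> \<alpha> \<theta>) \<and>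
             martingale_L1 (Pth \<mu> \<theta>) (M_tilde \<beta> \<alpha> \<theta>))"
proof -
  note ll = linked_law[OF g Q F \<xi> l] and QL = M_S_law[OF g Q]
  note m' = F_P_repD(3)[OF \<mu> P_prob lawX1_P F] and r = lawTheta_in_prob_algebra[OF QL(1)]
  define m where "m = density \<mu> (\<lambda>x. ennreal (exp (\<gamma> x)))"
  define K where "K \<theta> = cpp_law (g \<theta>) m \<theta>" for \<theta>
  note m = m'[folded m_def]
  have Qm: "Q = cmpp_law g m (lawTheta Q)" using QL(2) ll(2) by (simp add: m_def)
  have KP: "K \<theta> \<in> space (prob_algebra Omega)" if "0 < \<theta>" for \<theta>
    unfolding K_def by (rule cpp_law_in_prob_algebra[OF m M_plusD[OF g that] that])
  have "is_rcp Q K"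
    unfolding is_rcp_def
  proof (intro conjI allI impI ballI)
    fix D assume D: "D \<in> sets Omega"
    show "(\<lambda>\<theta>. emeasure (K \<theta>) D) \<in> borel_measurable Upsilon"
      unfolding K_def
      by (rule measurable_compose[OF measurable_prob_algebraD[OF measurable_cpp_law[OF g m]] measurable_emeasure_subprob_algebra[OF D]])
    show "(\<integral>\<^sup>+\<theta>. emeasure (K \<theta>) D \<partial>lawTheta Q) = emeasure Q D"
      using emeasure_cmpp_law[OF g m r D] Qm by (simp add: K_def)
  qed (rule KP)
  moreover have "consistent_with_Theta Q K"
    unfolding consistent_with_Theta_def
  proof (intro ballI AE_I2 impI)
    fix B \<theta> assume B: "B \<in> sets Upsilon" and "\<theta> \<in> space (lawTheta Q)" and \<theta>B: "\<theta> \<in> B"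
    then have \<theta>: "0 < \<theta>" by (simp add: lawTheta_def)
    note KO = prob_algebraD[OF KP[OF \<theta>]]
    have "emeasure (K \<theta>) (rvTheta -` B \<inter> space Omega) = emeasure (K \<theta>) (space (K \<theta>))"
    proof (rule emeasure_eq_AE)
      show "AE \<omega> in K \<theta>. (\<omega> \<in> rvTheta -` B \<inter> space Omega) = (\<omega> \<in> space (K \<theta>))"
        using AE_cpp_law_rvTheta[OF m M_plusD[OF g \<theta>] \<theta>, folded K_def] by eventually_elim (use \<theta>B KO in auto)
    qed (use measurable_sets[OF measurable_rvTheta B] KO in auto)
    then show "emeasure (K \<theta>) (rvTheta -` B \<inter> space Omega) = 1"
      using prob_space.emeasure_space_1[OF KO(1)] by simp
  qed
  moreover have "K \<theta> \<in> M_S_theta \<mu> g \<theta> \<and> density_identity (K \<theta>) (Pth \<mu> \<theta>) (M_tilde \<beta> \<alpha> \<theta>) \<and>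
             martingale_L1 (Pth \<mu> \<theta>) (M_tilde \<beta> \<alpha> \<theta>)" if \<theta>: "0 < \<theta>" for \<theta>
    using density_process_level[OF \<mu> \<theta> F m'] S_is_CPP_cpp_law[OF m M_plusD[OF g \<theta>] \<theta>] KP[OF \<theta>]
    by (simp add: M_S_theta_def K_def m_def ll(1)[OF \<theta>])
  ultimately show ?thesis by (intro exI[of _ K] conjI bexI[of _ "{}"]) auto
qed

end

theorem theorem4p3:
  fixes \<mu> \<rho> :: "real measure" and P :: "outcome measure"
  assumes "\<mu> \<in> space (prob_algebra Upsilon)"
    and "\<rho> \<in> space (prob_algebra Upsilon)"
    and "P = Pmix \<mu> \<rho>"
  shows
    "(\<forall>g\<in>M_plus. \<forall>Q\<in>M_S P g.
        \<exists>\<beta> \<alpha> \<gamma> \<xi>.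
          F_P_rep P \<beta> \<alpha> \<gamma> \<and> \<xi> \<in> R_plus P \<and>
          is_RN_derivative (lawTheta P) (lawTheta Q) \<xi> \<and>
          linked P g Q \<beta> \<alpha> \<gamma> \<xi> \<and>
          (\<forall>\<beta>' \<alpha>' \<gamma>' \<xi>'.
             F_P_rep P \<beta>' \<alpha>' \<gamma>' \<and> \<xi>' \<in> R_plus P \<and>
             is_RN_derivative (lawTheta P) (lawTheta Q) \<xi>' \<and>
             linked P g Q \<beta>' \<alpha>' \<gamma>' \<xi>' \<longrightarrow>
               (AE \<theta> in lawTheta P. \<alpha>' \<theta> = \<alpha> \<theta> \<and> \<xi>' \<theta> = \<xi> \<theta>) \<and>
               (AE x in lawX1 P. \<gamma>' x = \<gamma> x)))
     \<and>
     (\<forall>\<beta> \<alpha> \<gamma>. \<forall>\<xi>\<in>R_plus P. F_P_rep P \<beta> \<alpha> \<gamma> \<longrightarrow>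
        (\<exists>g Q.
          g \<in> M_plus \<and> Q \<in> M_S P g \<and> linked P g Q \<beta> \<alpha> \<gamma> \<xi> \<and>
          (\<forall>g' Q'.
             g' \<in> M_plus \<and> Q' \<in> M_S P g' \<and> linked P g' Q' \<beta> \<alpha> \<gamma> \<xi> \<longrightarrow>
               (\<forall>\<theta>>0. g' \<theta> = g \<theta>) \<and> Q' = Q)))
     \<and>
     (\<forall>g Q \<beta> \<alpha> \<gamma> \<xi>.
        g \<in> M_plus \<and> Q \<in> M_S P g \<and> F_P_rep P \<beta> \<alpha> \<gamma> \<and> \<xi> \<in> R_plus P \<and>
        linked P g Q \<beta> \<alpha> \<gamma> \<xi> \<longrightarrow>
        rcp_essentially_unique Q \<and>
        (\<exists>K. is_rcp Q K \<and> consistent_with_Theta Q K \<and>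
          (\<exists>V\<in>null_sets (lawTheta P). \<forall>\<theta>>0. \<theta> \<notin> V \<longrightarrow>
             K \<theta> \<in> M_S_theta \<mu> g \<theta> \<and>
             density_identity (K \<theta>) (Pth \<mu> \<theta>) (M_tilde \<beta> \<alpha> \<theta>) \<and>
             martingale_L1 (Pth \<mu> \<theta>) (M_tilde \<beta> \<alpha> \<theta>))))"
proof (intro conjI ballI allI impI, goal_cases)
  case (1 g Q)
  from existence_of_density[OF assms 1] obtain \<beta> \<alpha> \<gamma> \<xi> where
    *: "F_P_rep P \<beta> \<alpha> \<gamma>" "\<xi> \<in> R_plus P" "is_RN_derivative (lawTheta P) (lawTheta Q) \<xi>" "linked P g Q \<beta> \<alpha> \<gamma> \<xi>"
    by blast
  with uniqueness_of_density[OF assms *(3,4)] show ?case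
    by (intro exI[of _ \<beta>] exI[of _ \<alpha>] exI[of _ \<gamma>] exI[of _ \<xi>]) blast
next
  case (2 \<beta> \<alpha> \<gamma> \<xi>)
  then show ?case by (rule existence_of_measure[OF assms])
next
  case (3 g Q \<beta> \<alpha> \<gamma> \<xi>)
  then show ?case by (intro rcp_unique M_S_law(1)) auto
next
  case (4 g Q \<beta> \<alpha> \<gamma> \<xi>)
  then show ?case by (elim conjE) (rule existence_of_rcp[OF assms])
qed

end
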